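(* Let $m,n\ge 2$, and let $G_1,G_2$ be two connected closed graphs on the vertex sets $[m]$ and $[n]$, respectively. Then the ideal $I_{G_1,G_2}\subset S=K[x_1,\ldots,x_{m+n-1}]$ has a quadratic Gröbner basis with respect to the reverse lexicographic order on $S$ induced by $x_1>x_2>\cdots>x_{m+n-1}$. Moreover, $I_{G_1,G_2}$ is a Cohen–Macaulay ideal of dimension $2$, i.e. $S/I_{G_1,G_2}$ is Cohen–Macaulay of Krull dimension $2$.
   Context: $K$ is a field, $[n]=\{1,\ldots,n\}$, and all graphs are finite and simple. A graph $H$ on $[n]$ is closed if there is a labeling of its vertices such that whenever $1\le i<j<k\le n$ or $1\le k<j<i\le n$ and $\{i,j\},\{i,k\}\in E(H)$, then $\{j,k\}\in E(H)$. For connected $H$ this is equivalent to the existence of a labeling for which all maximal cliques are intervals $[a,b]=\{a,a+1,\ldots,b\}\subset[n]$ (equivalently, if $\{i,j\}\in E(H)$ and $i<k<j$ then $\{i,k\},\{k,j\}\in E(H)$). Convention: a closed graph on $[n]$ is always labeled so that its maximal cliques are intervals $F_i=[a_i,b_i]$, $1\le i\le r$, with $1=a_1<a_2<\cdots<a_r<b_r=n$. Let $X=(x_{ij})$, $1\le i\le m$, $1\le j\le n$, be the generic Hankel matrix with $x_{ij}=x_{i+j-1}$. The Hankel ideal $I_{G_1,G_2}\subset S$ is the ideal generated by the $2$-minors $$g_{e,f}=x_{i+k-1}x_{j+l-1}-x_{j+k-1}x_{i+l-1},\qquad e=\{i,j\}\in E(G_1),\ i<j,\quad f=\{k,l\}\in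 E(G_2),\ k<l.$$ A quadratic Gröbner basis is a Gröbner basis consisting of homogeneous polynomials of degree $2$. *)

theory Defs
  imports
    "HOL-Library.Poly_Mapping"
    "HOL-Library.Extended_Nat"
    "HOL-Algebra.Algebra"
begin

definition simple_graph :: "nat \<Rightarrow> nat set set \<Rightarrow> bool" where
  "simple_graph n E \<longleftrightarrow> (\<forall>e\<in>E. e \<subseteq> {1..n} \<and> card e = 2)"

definition connected_graph :: "nat \<Rightarrow> nat set set \<Rightarrow> bool" where
  "connected_graph n E \<longleftrightarrow>
     1 \<le> n \<and> (\<forall>u\<in>{1..n}. \<forall>v\<in>{1..n}. (u, v) \<in> {(x, y). {x, y} \<in> E}\<^sup>*)"

definition clique :: "nat \<Rightarrow> nat set set \<Rightarrow> nat set \<Rightarrow> bool" where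
  "clique n E C \<longleftrightarrow> C \<subseteq> {1..n} \<and> (\<forall>x\<in>C. \<forall>y\<in>C. x \<noteq> y \<longrightarrow> {x, y} \<in> E)"

definition maximal_clique :: "nat \<Rightarrow> nat set set \<Rightarrow> nat set \<Rightarrow> bool" where
  "maximal_clique n E C \<longleftrightarrow> clique n E C \<and> (\<forall>D. clique n E D \<and> C \<subseteq> D \<longrightarrow> D = C)"

definition closed_labeling :: "nat \<Rightarrow> nat set set \<Rightarrow> bool" where
  "closed_labeling n E \<longleftrightarrow>
     (\<forall>i\<in>{1..n}. \<forall>j\<in>{1..n}. \<forall>k\<in>{1..n}.
        (i < j \<and> j < k \<or> k < j \<and> j < i) \<and> {i, j} \<in> E \<and> {i, k} \<in> E \<longrightarrow> {j, k} \<in> E)"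

definition closed_graph :: "nat \<Rightarrow> nat set set \<Rightarrow> bool" where
  "closed_graph n E \<longleftrightarrow>
     (\<exists>\<sigma>. bij_betw \<sigma> {1..n} {1..n} \<and> closed_labeling n ((\<lambda>e. \<sigma> ` e) ` E))"

text \<open>The labeling convention for closed graphs: the maximal cliques are the intervals
  \<open>[a\<^sub>i, b\<^sub>i]\<close>, \<open>1 \<le> i \<le> r\<close>, with \<open>1 = a\<^sub>1 < \<dots> < a\<^sub>r < b\<^sub>r = n\<close>.\<close>

definition interval_labeling :: "nat \<Rightarrow> nat set set \<Rightarrow> bool" where
  "interval_labeling n E \<longleftrightarrow>
     (\<exists>(r::nat) (a::nat \<Rightarrow> nat) (b::nat \<Rightarrow> nat). 1 \<le> r \<and> {C. maximal_clique n E C} = (\<lambda>i. {a i..b i}) ` {1..r} \<and>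
        a 1 = 1 \<and> strict_mono_on {1..r} a \<and> a r < b r \<and> b r = n)"

text \<open>A polynomial is a finitely supported map from exponent vectors to coefficients; the
  polynomial ring in \<open>x\<^sub>1, \<dots>, x\<^sub>N\<close> consists of those in which no other variable occurs.\<close>

type_synonym 'k mpoly = "(nat \<Rightarrow>\<^sub>0 nat) \<Rightarrow>\<^sub>0 'k"

definition mpoly_ring :: "nat \<Rightarrow> 'k::field mpoly ring" where
  "mpoly_ring N =
     \<lparr>carrier = {p. \<forall>t\<in>Poly_Mapping.keys p. Poly_Mapping.keys t \<subseteq> {1..N}},
      monoid.mult = (*), one = 1, ring.zero = 0, ring.add = (+)\<rparr>"

definition monomial :: "(nat \<Rightarrow>\<^sub>0 nat) \<Rightarrow> 'k::field mpoly" where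
  "monomial t = Poly_Mapping.single t 1"

definition mvar :: "nat \<Rightarrow> 'k::field mpoly" where
  "mvar i = monomial (Poly_Mapping.single i 1)"

definition mon_degree :: "(nat \<Rightarrow>\<^sub>0 nat) \<Rightarrow> nat" where
  "mon_degree t = (\<Sum>i\<in>Poly_Mapping.keys t. Poly_Mapping.lookup t i)"

definition homogeneous :: "nat \<Rightarrow> 'k::field mpoly \<Rightarrow> bool" where
  "homogeneous d p \<longleftrightarrow> (\<forall>t\<in>Poly_Mapping.keys p. mon_degree t = d)"

text \<open>The (graded) reverse lexicographic order with \<open>x\<^sub>1 > x\<^sub>2 > \<dots>\<close>: compare degrees first; for
  equal degree, \<open>s < t\<close> if the last nonzero entry of \<open>s - t\<close> is positive.\<close>

definition revlex_less :: "(nat \<Rightarrow>\<^sub>0 nat) \<Rightarrow> (nat \<Rightarrow>\<^sub>0 nat) \<Rightarrow> bool" where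
  "revlex_less s t \<longleftrightarrow>
     mon_degree s < mon_degree t \<or>
     mon_degree s = mon_degree t \<and>
       (\<exists>i. Poly_Mapping.lookup s i > Poly_Mapping.lookup t i \<and>
            (\<forall>j>i. Poly_Mapping.lookup s j = Poly_Mapping.lookup t j))"

text \<open>Only meaningful for \<open>p \<noteq> 0\<close>.\<close>

definition initial_monomial ::
  "((nat \<Rightarrow>\<^sub>0 nat) \<Rightarrow> (nat \<Rightarrow>\<^sub>0 nat) \<Rightarrow> bool) \<Rightarrow> 'k::field mpoly \<Rightarrow> 'k mpoly" where
  "initial_monomial lt p =
     monomial (THE t. t \<in> Poly_Mapping.keys p \<and> (\<forall>s\<in>Poly_Mapping.keys p. s \<noteq> t \<longrightarrow> lt s t))"

definition initial_ideal ::
  "((nat \<Rightarrow>\<^sub>0 nat) \<Rightarrow> (nat \<Rightarrow>\<^sub>0 nat) \<Rightarrow> bool) \<Rightarrow> nat \<Rightarrow> 'k::field mpoly set \<Rightarrow> 'k mpoly set" where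
  "initial_ideal lt N I = Idl\<^bsub>mpoly_ring N\<^esub> (initial_monomial lt ` (I - {0}))"

definition groebner_basis ::
  "((nat \<Rightarrow>\<^sub>0 nat) \<Rightarrow> (nat \<Rightarrow>\<^sub>0 nat) \<Rightarrow> bool) \<Rightarrow> nat \<Rightarrow> 'k::field mpoly set \<Rightarrow> 'k mpoly set \<Rightarrow> bool" where
  "groebner_basis lt N I G \<longleftrightarrow>
     finite G \<and> G \<subseteq> I - {0} \<and>
     initial_ideal lt N I = Idl\<^bsub>mpoly_ring N\<^esub> (initial_monomial lt ` G)"

definition has_quadratic_groebner_basis ::
  "((nat \<Rightarrow>\<^sub>0 nat) \<Rightarrow> (nat \<Rightarrow>\<^sub>0 nat) \<Rightarrow> bool) \<Rightarrow> nat \<Rightarrow> 'k::field mpoly set \<Rightarrow> bool" where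
  "has_quadratic_groebner_basis lt N I \<longleftrightarrow>
     (\<exists>G. groebner_basis lt N I G \<and> (\<forall>g\<in>G. homogeneous 2 g))"

definition hankel_entry :: "nat \<Rightarrow> nat \<Rightarrow> 'k::field mpoly" where
  "hankel_entry i j = mvar (i + j - 1)"

definition hankel_minor :: "nat \<Rightarrow> nat \<Rightarrow> nat \<Rightarrow> nat \<Rightarrow> 'k::field mpoly" where
  "hankel_minor i j k l =
     hankel_entry i k * hankel_entry j l - hankel_entry j k * hankel_entry i l"

definition hankel_ideal ::
  "nat \<Rightarrow> nat \<Rightarrow> nat set set \<Rightarrow> nat set set \<Rightarrow> 'k::field mpoly set" where
  "hankel_ideal m n E\<^sub>1 E\<^sub>2 =
     Idl\<^bsub>mpoly_ring (m + n - 1)\<^esub>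
       {hankel_minor i j k l | i j k l. i < j \<and> k < l \<and> {i, j} \<in> E\<^sub>1 \<and> {k, l} \<in> E\<^sub>2}"

text \<open>The supremum is taken in \<^typ>\<open>enat\<close>, so the zero ring gets dimension 0.\<close>

definition krull_dim :: "('a, 'b) ring_scheme \<Rightarrow> enat" where
  "krull_dim R =
     Sup {enat d | d. \<exists>P :: nat \<Rightarrow> 'a set.
            (\<forall>i\<le>d. primeideal (P i) R) \<and> (\<forall>i<d. P i \<subset> P (Suc i))}"

text \<open>Localization of a commutative ring at (the complement of) a prime ideal, as classes of
  pairs (numerator, denominator).\<close>

definition loc_rel :: "('a, 'b) ring_scheme \<Rightarrow> 'a set \<Rightarrow> (('a \<times> 'a) \<times> ('a \<times> 'a)) set" where
  "loc_rel R P =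
     {((a, s), (b, t)) | a s b t.
        a \<in> carrier R \<and> b \<in> carrier R \<and> s \<in> carrier R - P \<and> t \<in> carrier R - P \<and>
        (\<exists>u\<in>carrier R - P.
           u \<otimes>\<^bsub>R\<^esub> (a \<otimes>\<^bsub>R\<^esub> t) = u \<otimes>\<^bsub>R\<^esub> (b \<otimes>\<^bsub>R\<^esub> s))}"

definition loc_frac :: "('a, 'b) ring_scheme \<Rightarrow> 'a set \<Rightarrow> 'a \<Rightarrow> 'a \<Rightarrow> ('a \<times> 'a) set" where
  "loc_frac R P a s = loc_rel R P `` {(a, s)}"

definition localization :: "('a, 'b) ring_scheme \<Rightarrow> 'a set \<Rightarrow> ('a \<times> 'a) set ring" where
  "localization R P =
     \<lparr>carrier = (carrier R \<times> (carrier R - P)) // loc_rel R P,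
      monoid.mult = (\<lambda>A B. \<Union>(a, s)\<in>A. \<Union>(b, t)\<in>B. loc_frac R P (a \<otimes>\<^bsub>R\<^esub> b) (s \<otimes>\<^bsub>R\<^esub> t)),
      one = loc_frac R P \<one>\<^bsub>R\<^esub> \<one>\<^bsub>R\<^esub>,
      ring.zero = loc_frac R P \<zero>\<^bsub>R\<^esub> \<one>\<^bsub>R\<^esub>,
      ring.add = (\<lambda>A B. \<Union>(a, s)\<in>A. \<Union>(b, t)\<in>B.
               loc_frac R P (a \<otimes>\<^bsub>R\<^esub> t \<oplus>\<^bsub>R\<^esub> b \<otimes>\<^bsub>R\<^esub> s) (s \<otimes>\<^bsub>R\<^esub> t))\<rparr>"

definition regular_sequence :: "('a, 'b) ring_scheme \<Rightarrow> 'a list \<Rightarrow> bool" where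
  "regular_sequence R xs \<longleftrightarrow>
     set xs \<subseteq> carrier R \<and>
     (\<forall>i<length xs. \<forall>a\<in>carrier R.
        xs ! i \<otimes>\<^bsub>R\<^esub> a \<in> Idl\<^bsub>R\<^esub> (set (take i xs)) \<longrightarrow> a \<in> Idl\<^bsub>R\<^esub> (set (take i xs))) \<and>
     Idl\<^bsub>R\<^esub> (set xs) \<noteq> carrier R"

text \<open>The grade of \<open>I\<close> on \<open>R\<close>; it is the depth of \<open>R\<close> if \<open>I\<close> is the maximal ideal of a local
  ring.\<close>

definition grade :: "('a, 'b) ring_scheme \<Rightarrow> 'a set \<Rightarrow> enat" where
  "grade R I = Sup {enat (length xs) | xs. regular_sequence R xs \<and> set xs \<subseteq> I}"

definition cohen_macaulay_local :: "('a, 'b) ring_scheme \<Rightarrow> bool" where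
  "cohen_macaulay_local R \<longleftrightarrow>
     cring R \<and> noetherian_ring R \<and>
     (\<exists>M. (\<forall>J. maximalideal J R \<longleftrightarrow> J = M) \<and> grade R M = krull_dim R)"

definition cohen_macaulay :: "('a, 'b) ring_scheme \<Rightarrow> bool" where
  "cohen_macaulay R \<longleftrightarrow>
     cring R \<and> noetherian_ring R \<and>
     (\<forall>M. maximalideal M R \<longrightarrow> cohen_macaulay_local (localization R M))"

end

theory Submission
  imports Defs
begin

text \<open>A Hankel minor with rows \<open>i < j\<close> and columns \<open>k < l\<close> is \<open>x\<^sub>p x\<^sub>q - x\<^sub>a x\<^sub>b\<close>, where
  \<open>p = i + k - 1\<close>, \<open>q = j + l - 1\<close> and \<open>a\<close>, \<open>b\<close> lie between \<open>p\<close> and \<open>q\<close> with \<open>a + b = p + q\<close>. Only the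
  pairs \<open>(p, q)\<close> matter: since the cliques are intervals, a pair that occurs may be replaced by every
  pair \<open>p \<le> p' < q' \<le> q\<close> with \<open>q' - p' \<ge> 2\<close>, and since the graphs are connected, all pairs \<open>(p, p + 2)\<close>
  occur. An induction on \<open>q - p\<close> then shows that the Hankel ideal is generated by the binomials
  \<open>x\<^sub>b x\<^sub>c - x\<^sub>b\<^sub>-\<^sub>1 x\<^sub>c\<^sub>+\<^sub>1\<close> for which \<open>(b - 1, c + 1)\<close> occurs (lemma \<open>hankel_ideal_eq_spread_ideal\<close>).

  These binomials are read as moves \<open>x\<^sub>b x\<^sub>c \<rightarrow> x\<^sub>b\<^sub>-\<^sub>1 x\<^sub>c\<^sub>+\<^sub>1\<close> on monomials: two of the factors, pictured as chips
  on the positions \<open>1, \<dots>, N\<close>, are pushed one step apart. A move makes a monomial smaller in the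
  reverse lexicographic order, and any two moves from the same monomial can be completed to a common
  successor (lemma \<open>step_locally_confluent\<close>), so every monomial has a unique normal form. The linear
  extension \<open>NF\<close> of the normal form has the ideal as its kernel. Therefore the initial monomial of a nonzero
  member of the ideal admits a move, that is, it is divisible by the initial monomial \<open>x\<^sub>b x\<^sub>c\<close> of one of the
  binomials, and these form a Groebner basis.

  No move starts from a chip on position \<open>1\<close> or \<open>N\<close>, so \<open>NF\<close> is linear over \<open>K[x\<^sub>1, x\<^sub>N]\<close>: the quotient
  ring is a free module over \<open>K[x\<^sub>1, x\<^sub>N]\<close>. Hence nonzero polynomials \<open>f(x\<^sub>1)\<close>, \<open>g(x\<^sub>N)\<close> form a regular sequence
  whenever they generate a proper ideal. By Zariski's lemma every maximal ideal contains such a pair, so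
  all localizations have depth at least \<open>2\<close>. The squares \<open>x\<^sub>b\<^sup>2\<close> with \<open>1 < b < N\<close> admit a move, so the
  number of normal forms of degree at most \<open>d\<close> is bounded by a multiple of \<open>(d + 1)\<^sup>2\<close>. A chain of four primes would give
  three elements that are algebraically independent modulo the ideal, whose monomials outgrow that
  number; so the dimension is at most \<open>2\<close>. The other inequality needed, that a regular sequence of length
  \<open>d\<close> forces dimension at least \<open>d\<close>, holds in all commutative rings.\<close>

section \<open>Regular sequences and chains of primes\<close>

lemma (in cring)
  assumes M: "ideal M R" and a: "a \<in> carrier R"
  shows ideal_adjoin: "ideal (M <+>\<^bsub>R\<^esub> PIdl a) R"
    and subset_ideal_adjoin: "M \<subseteq> M <+>\<^bsub>R\<^esub> PIdl a"
    and mem_ideal_adjoin: "a \<in> M <+>\<^bsub>R\<^esub> PIdl a"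
    and ideal_adjoinD: "x \<in> M <+>\<^bsub>R\<^esub> PIdl a \<Longrightarrow> \<exists>m\<in>M. \<exists>r\<in>carrier R. x = m \<oplus> r \<otimes> a"
proof -
  have P: "ideal (PIdl a) R" by (rule cgenideal_ideal[OF a])
  show "ideal (M <+>\<^bsub>R\<^esub> PIdl a) R" by (rule add_ideals[OF M P])
  have zero: "\<zero> \<in> M" "\<zero> \<in> PIdl a"
    using M P additive_subgroup.zero_closed ideal.axioms(1) by blast+
  show "M \<subseteq> M <+>\<^bsub>R\<^esub> PIdl a"
  proof
    fix m assume m: "m \<in> M"
    then have "m \<oplus> \<zero> \<in> M <+>\<^bsub>R\<^esub> PIdl a" using zero(2) unfolding set_add_def' by blast
    then show "m \<in> M <+>\<^bsub>R\<^esub> PIdl a" using r_zero[OF ideal.Icarr[OF M m]] by simp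
  qed
  have "\<zero> \<oplus> a \<in> M <+>\<^bsub>R\<^esub> PIdl a" using zero(1) cgenideal_self[OF a] unfolding set_add_def' by blast
  then show "a \<in> M <+>\<^bsub>R\<^esub> PIdl a" using a by simp
  show "\<exists>m\<in>M. \<exists>r\<in>carrier R. x = m \<oplus> r \<otimes> a" if "x \<in> M <+>\<^bsub>R\<^esub> PIdl a"
    using that unfolding set_add_def' cgenideal_def by blast
qed

text \<open>By Zorn's lemma there is an ideal maximal among those that contain \<open>J\<close> and avoid \<open>T\<close>; it is prime
  because two elements outside it would produce two elements of \<open>T\<close> with product inside it.\<close>
lemma (in cring) ideal_avoiding_mult_set_le_prime:
  assumes J: "ideal J R" and T: "T \<subseteq> carrier R" "\<one> \<in> T" "\<And>x y. x \<in> T \<Longrightarrow> y \<in> T \<Longrightarrow> x \<otimes> y \<in> T"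
    and disj: "J \<inter> T = {}"
  obtains Q where "primeideal Q R" "J \<subseteq> Q" "Q \<inter> T = {}"
proof -
  define F where "F = {I. ideal I R \<and> J \<subseteq> I \<and> I \<inter> T = {}}"
  have "\<exists>M\<in>F. \<forall>Y\<in>F. M \<subseteq> Y \<longrightarrow> Y = M"
  proof (rule subset_Zorn_nonempty)
    show "F \<noteq> {}" using J disj by (auto simp: F_def)
    fix C assume C: "C \<noteq> {}" "subset.chain F C"
    have "subset.chain {I. ideal I R} C"
      using C(2) by (auto simp: subset.chain_def F_def)
    then have "ideal (\<Union>C) R"
      using chain_Union_is_ideal[of C] C(1) by simp
    then show "\<Union>C \<in> F" using C unfolding subset.chain_def F_def by auto
  qed
  then obtain M where M: "ideal M R" "J \<subseteq> M" "M \<inter> T = {}"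
    and max: "\<And>Y. ideal Y R \<Longrightarrow> M \<subseteq> Y \<Longrightarrow> Y \<inter> T = {} \<Longrightarrow> Y = M"
    unfolding F_def by (smt (verit) mem_Collect_eq subset_trans)
  interpret M: ideal M R by fact
  have meets: "\<exists>m\<in>M. \<exists>r\<in>carrier R. m \<oplus> r \<otimes> a \<in> T" if a: "a \<in> carrier R" "a \<notin> M" for a
  proof -
    have "(M <+>\<^bsub>R\<^esub> PIdl a) \<inter> T \<noteq> {}"
      using max[OF ideal_adjoin[OF M(1) a(1)] subset_ideal_adjoin[OF M(1) a(1)]] mem_ideal_adjoin[OF M(1) a(1)] a(2)
      by metis
    then show ?thesis using ideal_adjoinD[OF M(1) a(1)] by blast
  qed
  have "primeideal M R"
  proof (rule primeidealI)
    show "ideal M R" "cring R" by (fact M, unfold_locales)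
    show "carrier R \<noteq> M" using T M by auto
    fix a b assume ab: "a \<in> carrier R" "b \<in> carrier R" "a \<otimes> b \<in> M"
    show "a \<in> M \<or> b \<in> M"
    proof (rule ccontr)
      assume "\<not> ?thesis"
      then obtain m r m' r' where *: "m \<in> M" "r \<in> carrier R" "m \<oplus> r \<otimes> a \<in> T"
        "m' \<in> M" "r' \<in> carrier R" "m' \<oplus> r' \<otimes> b \<in> T"
        using meets ab by meson
      have c: "m \<in> carrier R" "m' \<in> carrier R" using * M.Icarr by auto
      have "(m \<oplus> r \<otimes> a) \<otimes> (m' \<oplus> r' \<otimes> b)
        = (m' \<oplus> r' \<otimes> b) \<otimes> m \<oplus> ((r \<otimes> a) \<otimes> m' \<oplus> (r \<otimes> r') \<otimes> (a \<otimes> b))"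
        using ab * c by (simp add: l_distr r_distr m_ac a_ac)
      also have "\<dots> \<in> M"
        by (rule M.a_closed[OF M.I_l_closed M.a_closed[OF M.I_l_closed M.I_l_closed]]) (use ab * c in simp_all)
      finally show False using T(3)[OF *(3,6)] M by blast
    qed
  qed
  then show thesis using that M by blast
qed

text \<open>A prime minimal over \<open>J\<close> consists of zero divisors modulo \<open>J\<close>. Here this is used in the form that a
  prime containing a nonzerodivisor modulo \<open>J\<close> can be made strictly smaller. The smaller prime is obtained
  by avoiding all products \<open>s x\<^sup>k\<close> with \<open>s\<close> outside \<open>Q\<close>.\<close>
lemma (in cring) nonzerodivisor_prime_below:
  assumes Q: "primeideal Q R" and J: "ideal J R" "J \<subseteq> Q"
    and x: "x \<in> Q" and reg: "\<And>a. a \<in> carrier R \<Longrightarrow> x \<otimes> a \<in> J \<Longrightarrow> a \<in> J"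
  obtains Q' where "primeideal Q' R" "J \<subseteq> Q'" "Q' \<subset> Q"
proof -
  interpret Q: primeideal Q R by fact
  have xc: "x \<in> carrier R" using x Q.Icarr by auto
  let ?T = "{s \<otimes> x [^] k | s k. s \<in> carrier R - Q \<and> k \<in> (UNIV :: nat set)}"
  have one: "\<one> \<in> carrier R - Q" using Q.I_notcarr Q.one_imp_carrier by auto
  have pow: "s \<in> J" if "s \<in> carrier R" "s \<otimes> x [^] (k::nat) \<in> J" for s k
    using that
  proof (induction k)
    case (Suc k)
    have "x \<otimes> (s \<otimes> x [^] k) \<in> J" using Suc.prems xc by (simp add: m_ac)
    then have "s \<otimes> x [^] k \<in> J" using reg[of "s \<otimes> x [^] k"] Suc.prems(1) xc by simp
    then show ?case using Suc.IH Suc.prems(1) by blast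
  qed simp
  have in_T: "s \<in> ?T" if "s \<in> carrier R - Q" for s
    using that by (auto intro!: exI[of _ s] exI[of _ "0::nat"])
  have "x \<in> ?T" using one xc by (intro CollectI exI[of _ \<one>] exI[of _ "1::nat"]) auto
  obtain Q' where Q': "primeideal Q' R" "J \<subseteq> Q'" "Q' \<inter> ?T = {}"
  proof (rule ideal_avoiding_mult_set_le_prime[OF J(1)])
    show "?T \<subseteq> carrier R" using xc by auto
    show "\<one> \<in> ?T" using in_T one .
    show "J \<inter> ?T = {}"
    proof -
      have False if "s \<in> carrier R - Q" "s \<otimes> x [^] (k::nat) \<in> J" for s k
        using pow[of s k] that J(2) by auto
      then show ?thesis by auto
    qed
    fix a b assume "a \<in> ?T" "b \<in> ?T"
    then obtain s k s' k' where *: "a = s \<otimes> x [^] k" "b = s' \<otimes> x [^] k'" "s \<in> carrier R - Q" "s' \<in> carrier R - Q"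
      "k \<in> (UNIV :: nat set)" "k' \<in> (UNIV :: nat set)" by auto
    have "s \<otimes> s' \<in> carrier R - Q" using * Q.I_prime by auto
    moreover have "a \<otimes> b = (s \<otimes> s') \<otimes> x [^] (k + k')"
      using * xc by (simp add: m_ac nat_pow_mult[symmetric])
    ultimately show "a \<otimes> b \<in> ?T" by blast
  qed
  have "Q' \<subseteq> Q"
    using in_T Q'(3) ideal.Icarr[OF primeideal.axioms(1)[OF Q'(1)]] by blast
  moreover have "x \<notin> Q'" using \<open>x \<in> ?T\<close> Q' by auto
  ultimately show thesis using that Q' x by blast
qed

text \<open>Starting from a prime over the whole sequence, each element of the sequence in turn, from the last to the
  first, yields a strictly smaller prime over the remaining ones.\<close>
lemma (in cring) length_regular_sequence_le_krull_dim:
  assumes "regular_sequence R xs"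
  shows "enat (length xs) \<le> krull_dim R"
proof -
  let ?J = "\<lambda>i. Idl (set (take i xs))"
  have carr: "set xs \<subseteq> carrier R" using assms by (simp add: regular_sequence_def)
  then have J: "ideal (?J i) R" for i
    by (auto intro!: genideal_ideal dest: in_set_takeD)
  have "\<exists>P. (\<forall>i\<le>j. primeideal (P i) R) \<and> (\<forall>i<j. P i \<subset> P (Suc i)) \<and> ?J (length xs - j) \<subseteq> P 0"
    if "j \<le> length xs" for j
    using that
  proof (induction j)
    case 0
    have "\<one> \<notin> Idl (set xs)"
      using assms ideal.one_imp_carrier[OF J[of "length xs"]] by (auto simp: regular_sequence_def)
    then obtain Q where "primeideal Q R" "?J (length xs) \<subseteq> Q"
      using ideal_avoiding_mult_set_le_prime[OF J[of "length xs"], of "{\<one>}"] by (simp, blast)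
    then show ?case by (intro exI[of _ "\<lambda>_. Q"]) auto
  next
    case (Suc j)
    then obtain P where P: "\<forall>i\<le>j. primeideal (P i) R" "\<forall>i<j. P i \<subset> P (Suc i)" "?J (length xs - j) \<subseteq> P 0"
      by auto
    define d where "d = length xs - Suc j"
    have d: "length xs - j = Suc d" "d < length xs" using Suc.prems by (auto simp: d_def)
    have sub: "set (take d xs) \<subseteq> set (take (Suc d) xs)" by (simp add: set_take_subset_set_take)
    have gs: "set (take (Suc d) xs) \<subseteq> ?J (Suc d)"
      by (intro genideal_self) (use carr in \<open>auto dest: in_set_takeD\<close>)
    then have "?J d \<subseteq> ?J (Suc d)" using sub genideal_minimal[OF J] by blast
    have "xs ! d \<in> set (take (Suc d) xs)" using d by (simp add: take_Suc_conv_app_nth)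
    then have "xs ! d \<in> P 0" using gs P(3) d by auto
    moreover have "a \<in> ?J d" if "a \<in> carrier R" "xs ! d \<otimes> a \<in> ?J d" for a
      using assms that d unfolding regular_sequence_def by blast
    moreover have "primeideal (P 0) R" "?J d \<subseteq> P 0"
      using P d \<open>?J d \<subseteq> ?J (Suc d)\<close> by auto
    ultimately obtain Q where Q: "primeideal Q R" "?J d \<subseteq> Q" "Q \<subset> P 0"
      using nonzerodivisor_prime_below[OF _ J, of "P 0" d "xs ! d"] by blast
    show ?case
      by (rule exI[of _ "\<lambda>i. case i of 0 \<Rightarrow> Q | Suc i \<Rightarrow> P i"])
         (use Q P in \<open>auto simp: d_def split: nat.splits\<close>)
  qed
  from this[of "length xs"] show ?thesis
    unfolding krull_dim_def by (intro Sup_upper) auto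
qed

section \<open>Homomorphisms onto rings of fractions\<close>

text \<open>A common frame for quotients (all denominators are \<open>1\<close>) and localizations: in both cases ideals are
  determined by their contractions, so finiteness and dimension carry over.\<close>
locale localizing_hom = ring_hom_cring R S h for R (structure) and S (structure) and h +
  assumes fraction: "y \<in> carrier S \<Longrightarrow> \<exists>a\<in>carrier R. \<exists>s\<in>carrier R. h s \<in> Units S \<and> y \<otimes>\<^bsub>S\<^esub> h s = h a"
begin

abbreviation contraction :: "'c set \<Rightarrow> 'a set" where
  "contraction J \<equiv> {a \<in> carrier R. h a \<in> J}"

lemma contraction_ideal: "ideal J S \<Longrightarrow> ideal (contraction J) R"
  using ring.ideal_vimage by blast

text \<open>An ideal of the target is generated by the image of its contraction, because every element becomes an
  image after multiplication by a unit.\<close>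
lemma ideal_extension:
  assumes J: "ideal J S" and K: "ideal K S" and sub: "h ` contraction J \<subseteq> K"
  shows "J \<subseteq> K"
proof
  interpret J: ideal J S by fact
  interpret K: ideal K S by fact
  fix y assume y: "y \<in> J"
  then have yc: "y \<in> carrier S" by (rule J.Icarr)
  then obtain a s where as: "a \<in> carrier R" "s \<in> carrier R" "h s \<in> Units S" "y \<otimes>\<^bsub>S\<^esub> h s = h a"
    using fraction by blast
  have "h a \<in> J" using J.I_r_closed[OF y, of "h s"] as by simp
  then have "h a \<in> K" using sub as by auto
  then have "h a \<otimes>\<^bsub>S\<^esub> inv\<^bsub>S\<^esub> (h s) \<in> K" using K.I_r_closed as by simp
  moreover have "y \<otimes>\<^bsub>S\<^esub> h s \<otimes>\<^bsub>S\<^esub> inv\<^bsub>S\<^esub> (h s) = y" using as(1-3) yc by (simp add: S.m_assoc)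
  ultimately show "y \<in> K" using as(4) by simp
qed

lemma contraction_primeideal:
  assumes "primeideal J S" shows "primeideal (contraction J) R"
proof (rule primeidealI)
  interpret J: primeideal J S by fact
  show "ideal (contraction J) R" by (rule contraction_ideal) (rule J.ideal_axioms)
  show "cring R" by (rule R.cring_axioms)
  show "carrier R \<noteq> contraction J"
    using J.I_notcarr J.one_imp_carrier R.one_closed by (metis (mono_tags, lifting) hom_one mem_Collect_eq)
  show "a \<in> contraction J \<or> b \<in> contraction J"
    if "a \<in> carrier R" "b \<in> carrier R" "a \<otimes> b \<in> contraction J" for a b
    using that J.I_prime[of "h a" "h b"] by auto
qed

lemma contraction_strict_mono:
  assumes "ideal J S" "ideal K S" "J \<subset> K" shows "contraction J \<subset> contraction K"
proof -
  have "\<not> contraction K \<subseteq> contraction J"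
    using ideal_extension[OF assms(2,1)] assms(3) by blast
  then show ?thesis using assms(3) by blast
qed

lemma noetherian:
  assumes "noetherian_ring R" shows "noetherian_ring S"
proof (rule S.noetherian_ringI)
  interpret noetherian_ring R by fact
  fix J assume J: "ideal J S"
  obtain A where A: "A \<subseteq> carrier R" "finite A" "contraction J = Idl A"
    using finetely_gen[OF contraction_ideal[OF J]] by auto
  have AJ: "A \<subseteq> contraction J" using A R.genideal_self by auto
  have hA: "h ` A \<subseteq> carrier S" using A by auto
  have K: "ideal (Idl\<^bsub>S\<^esub> (h ` A)) S" using S.genideal_ideal hA by auto
  have "A \<subseteq> contraction (Idl\<^bsub>S\<^esub> (h ` A))" using S.genideal_self[OF hA] A by auto
  then have "contraction J \<subseteq> contraction (Idl\<^bsub>S\<^esub> (h ` A))"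
    using A R.genideal_minimal[OF contraction_ideal[OF K]] by auto
  then have "J \<subseteq> Idl\<^bsub>S\<^esub> (h ` A)" using ideal_extension[OF J K] by auto
  moreover have "Idl\<^bsub>S\<^esub> (h ` A) \<subseteq> J" by (rule S.genideal_minimal[OF J]) (use AJ in auto)
  ultimately show "\<exists>A\<subseteq>carrier S. finite A \<and> J = Idl\<^bsub>S\<^esub> A" using A hA by (intro exI[of _ "h ` A"]) auto
qed

text \<open>Primes of the target contract to primes that contain the kernel, so only chains of such primes count.\<close>
lemma krull_dim_le:
  assumes "\<And>P. (\<forall>i\<le>Suc d. primeideal (P i) R \<and> a_kernel R S h \<subseteq> P i) \<Longrightarrow> (\<forall>i<Suc d. P i \<subset> P (Suc i)) \<Longrightarrow> False"
  shows "krull_dim S \<le> enat d"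
  unfolding krull_dim_def
proof (rule Sup_least, clarify)
  fix e and P :: "nat \<Rightarrow> 'c set"
  assume P: "\<forall>i\<le>e. primeideal (P i) S" "\<forall>i<e. P i \<subset> P (Suc i)"
  have "\<not> Suc d \<le> e"
  proof
    assume le: "Suc d \<le> e"
    show False
    proof (rule assms[of "\<lambda>i. contraction (P i)"]; intro allI impI)
      fix i assume "i \<le> Suc d"
      then have p: "primeideal (P i) S" using P le by auto
      then have z: "\<zero>\<^bsub>S\<^esub> \<in> P i"
        using additive_subgroup.zero_closed ideal.axioms(1) primeideal.axioms(1) by blast
      show "primeideal (contraction (P i)) R \<and> a_kernel R S h \<subseteq> contraction (P i)"
        using contraction_primeideal[OF p] z unfolding a_kernel_def' by force
    next
      fix i assume "i < Suc d"
      then show "contraction (P i) \<subset> contraction (P (Suc i))"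
        by (intro contraction_strict_mono primeideal.axioms(1)) (use P le in auto)
    qed
  qed
  then show "enat e \<le> enat d" by simp
qed

lemma krull_dim_mono: "krull_dim S \<le> krull_dim R"
  unfolding krull_dim_def
proof (rule Sup_least, clarify)
  fix e and P :: "nat \<Rightarrow> 'c set"
  assume P: "\<forall>i\<le>e. primeideal (P i) S" "\<forall>i<e. P i \<subset> P (Suc i)"
  have "(\<forall>i\<le>e. primeideal (contraction (P i)) R) \<and> (\<forall>i<e. contraction (P i) \<subset> contraction (P (Suc i)))"
    using P by (intro conjI allI impI contraction_primeideal contraction_strict_mono primeideal.axioms(1)) auto
  then show "enat e \<le> Sup {enat d |d. \<exists>P. (\<forall>i\<le>d. primeideal (P i) R) \<and> (\<forall>i<d. P i \<subset> P (Suc i))}"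
    by (intro Sup_upper) (auto intro!: exI[of _ "\<lambda>i. contraction (P i)"])
qed

end

lemma (in ideal) quotient_localizing_hom:
  assumes "cring R" shows "localizing_hom R (R Quot I) ((+>) I)"
proof -
  interpret ring_hom_cring R "R Quot I" "(+>) I" by (rule rcos_ring_hom_cring) fact
  show ?thesis
  proof unfold_locales
    fix y assume y: "y \<in> carrier (R Quot I)"
    then obtain a where "a \<in> carrier R" "y = I +> a" unfolding FactRing_simps by auto
    then show "\<exists>a\<in>carrier R. \<exists>s\<in>carrier R. I +> s \<in> Units (R Quot I) \<and> y \<otimes>\<^bsub>R Quot I\<^esub> (I +> s) = I +> a"
      using S.Units_one_closed hom_one y by (intro bexI[of _ a] bexI[of _ \<one>]) auto
  qed
qed

section \<open>Localization at a prime ideal\<close>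

lemma (in cring) idealI_mult_closed:
  assumes "J \<subseteq> carrier R" "\<zero> \<in> J" "\<And>a b. a \<in> J \<Longrightarrow> b \<in> J \<Longrightarrow> a \<oplus> b \<in> J"
    and mult: "\<And>a x. a \<in> J \<Longrightarrow> x \<in> carrier R \<Longrightarrow> x \<otimes> a \<in> J"
  shows "ideal J R"
proof (rule idealI)
  show "ring R" by (rule ring_axioms)
  have "\<ominus> a \<in> J" if "a \<in> J" for a
    using mult[OF that, of "\<ominus> \<one>"] that assms(1) by (auto simp: l_minus subset_iff)
  then show "subgroup J (add_monoid R)"
    using assms by unfold_locales (auto simp: a_inv_def[symmetric] subset_iff)
  show "x \<otimes> a \<in> J" if "a \<in> J" "x \<in> carrier R" for a x by (rule mult[OF that])
  show "a \<otimes> x \<in> J" if "a \<in> J" "x \<in> carrier R" for a x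
    using mult[OF that] that assms(1) by (auto simp: m_comm subset_iff)
qed

locale prime_localization = primeideal P R for P and R (structure)
begin

abbreviation "L \<equiv> localization R P"
abbreviation "denoms \<equiv> carrier R - P"
abbreviation "fr \<equiv> loc_frac R P"
abbreviation "\<phi> a \<equiv> loc_frac R P a \<one>"

lemma one_denoms: "\<one> \<in> denoms"
  using I_notcarr one_imp_carrier by auto

lemma mult_denoms: "s \<in> denoms \<Longrightarrow> t \<in> denoms \<Longrightarrow> s \<otimes> t \<in> denoms"
  using I_prime by auto

lemma loc_rel_iff:
  "((a, s), (b, t)) \<in> loc_rel R P \<longleftrightarrow> a \<in> carrier R \<and> b \<in> carrier R \<and> s \<in> denoms \<and> t \<in> denoms \<and>
     (\<exists>u\<in>denoms. u \<otimes> (a \<otimes> t) = u \<otimes> (b \<otimes> s))"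
  unfolding loc_rel_def by auto

lemma loc_rel_equiv: "equiv (carrier R \<times> denoms) (loc_rel R P)"
proof (rule equivI)
  show "loc_rel R P \<subseteq> (carrier R \<times> denoms) \<times> (carrier R \<times> denoms)"
    unfolding loc_rel_def by auto
  show "refl_on (carrier R \<times> denoms) (loc_rel R P)"
    using one_denoms by (auto simp: refl_on_def loc_rel_iff)
  show "sym (loc_rel R P)"
  proof (rule symI, clarify)
    fix a s b t assume "((a, s), (b, t)) \<in> loc_rel R P"
    then show "((b, t), (a, s)) \<in> loc_rel R P" unfolding loc_rel_iff by metis
  qed
  show "trans (loc_rel R P)"
  proof (rule transI, clarify)
    fix a s b t c r assume "((a, s), (b, t)) \<in> loc_rel R P" "((b, t), (c, r)) \<in> loc_rel R P"
    then obtain u v where *: "a \<in> carrier R" "b \<in> carrier R" "c \<in> carrier R"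
      and d: "s \<in> denoms" "t \<in> denoms" "r \<in> denoms" "u \<in> denoms" "v \<in> denoms"
      and e: "u \<otimes> (a \<otimes> t) = u \<otimes> (b \<otimes> s)" "v \<otimes> (b \<otimes> r) = v \<otimes> (c \<otimes> t)"
      unfolding loc_rel_iff by auto
    have dc: "s \<in> carrier R" "t \<in> carrier R" "r \<in> carrier R" "u \<in> carrier R" "v \<in> carrier R" using d by auto
    have "(u \<otimes> v \<otimes> t) \<otimes> (a \<otimes> r) = (v \<otimes> r) \<otimes> (u \<otimes> (a \<otimes> t))" using * dc by (simp add: m_ac)
    also have "\<dots> = (u \<otimes> s) \<otimes> (v \<otimes> (b \<otimes> r))" unfolding e(1) using * dc by (simp add: m_ac)
    also have "\<dots> = (u \<otimes> v \<otimes> t) \<otimes> (c \<otimes> s)" unfolding e(2) using * dc by (simp add: m_ac)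
    finally show "((a, s), (c, r)) \<in> loc_rel R P"
      unfolding loc_rel_iff using * d mult_denoms by blast
  qed
qed

lemma frac_eq_iff:
  assumes "a \<in> carrier R" "b \<in> carrier R" "s \<in> denoms" "t \<in> denoms"
  shows "fr a s = fr b t \<longleftrightarrow> (\<exists>u\<in>denoms. u \<otimes> (a \<otimes> t) = u \<otimes> (b \<otimes> s))"
  unfolding loc_frac_def using assms by (subst eq_equiv_class_iff[OF loc_rel_equiv]) (auto simp: loc_rel_iff)

lemma fracI:
  assumes "a \<in> carrier R" "b \<in> carrier R" "s \<in> denoms" "t \<in> denoms" "a \<otimes> t = b \<otimes> s"
  shows "fr a s = fr b t"
  using assms one_denoms by (subst frac_eq_iff) auto

lemma carrier_localization: "carrier L = {fr a s | a s. a \<in> carrier R \<and> s \<in> denoms}"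
  by (auto simp: localization_def quotient_def loc_frac_def)

lemma mem_frac:
  assumes "(b, t) \<in> fr a s" "a \<in> carrier R" "s \<in> denoms"
  shows "b \<in> carrier R" "t \<in> denoms" "\<exists>u\<in>denoms. u \<otimes> (a \<otimes> t) = u \<otimes> (b \<otimes> s)"
  using assms by (auto simp: loc_frac_def loc_rel_iff)

lemma mem_frac_self: "a \<in> carrier R \<Longrightarrow> s \<in> denoms \<Longrightarrow> (a, s) \<in> fr a s"
  using one_denoms by (auto simp: loc_frac_def loc_rel_iff)

text \<open>The operations of the localization are unions over all representatives. Such a union collapses to one
  value as soon as the summand does not depend on the representatives.\<close>
lemma UN_frac:
  assumes "a \<in> carrier R" "b \<in> carrier R" "s \<in> denoms" "t \<in> denoms"
    and eq: "\<And>a' s' b' t' u v. a' \<in> carrier R \<Longrightarrow> b' \<in> carrier R \<Longrightarrow> s' \<in> denoms \<Longrightarrow> t' \<in> denoms \<Longrightarrow>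
      u \<in> denoms \<Longrightarrow> v \<in> denoms \<Longrightarrow> u \<otimes> (a \<otimes> s') = u \<otimes> (a' \<otimes> s) \<Longrightarrow> v \<otimes> (b \<otimes> t') = v \<otimes> (b' \<otimes> t) \<Longrightarrow>
      F a' s' b' t' = F a s b t"
  shows "(\<Union>(a', s')\<in>fr a s. \<Union>(b', t')\<in>fr b t. F a' s' b' t') = F a s b t"
proof (rule UN_constant_eq[OF mem_frac_self[OF assms(1,3)]], clarify)
  fix a' s' assume 1: "(a', s') \<in> fr a s"
  show "(\<Union>(b', t')\<in>fr b t. F a' s' b' t') = F a s b t"
  proof (rule UN_constant_eq[OF mem_frac_self[OF assms(2,4)]], clarify)
    fix b' t' assume 2: "(b', t') \<in> fr b t"
    note m = mem_frac[OF 1 assms(1,3)] mem_frac[OF 2 assms(2,4)]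
    then show "F a' s' b' t' = F a s b t" using eq[OF m(1,4,2,5)] by blast
  qed
qed

lemma frac_mult:
  assumes "a \<in> carrier R" "b \<in> carrier R" "s \<in> denoms" "t \<in> denoms"
  shows "fr a s \<otimes>\<^bsub>L\<^esub> fr b t = fr (a \<otimes> b) (s \<otimes> t)"
proof -
  have "fr a s \<otimes>\<^bsub>L\<^esub> fr b t = (\<Union>(a', s')\<in>fr a s. \<Union>(b', t')\<in>fr b t. fr (a' \<otimes> b') (s' \<otimes> t'))"
    by (simp add: localization_def)
  also have "\<dots> = fr (a \<otimes> b) (s \<otimes> t)"
  proof (rule UN_frac[OF assms])
    fix a' s' b' t' u v
    assume *: "a' \<in> carrier R" "b' \<in> carrier R" "s' \<in> denoms" "t' \<in> denoms" "u \<in> denoms" "v \<in> denoms"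
      "u \<otimes> (a \<otimes> s') = u \<otimes> (a' \<otimes> s)" "v \<otimes> (b \<otimes> t') = v \<otimes> (b' \<otimes> t)"
    have c: "u \<in> carrier R" "v \<in> carrier R" "s \<in> carrier R" "t \<in> carrier R" "s' \<in> carrier R" "t' \<in> carrier R"
      using * assms by auto
    have "(u \<otimes> v) \<otimes> ((a' \<otimes> b') \<otimes> (s \<otimes> t)) = (u \<otimes> (a' \<otimes> s)) \<otimes> (v \<otimes> (b' \<otimes> t))"
      using c *(1-6) assms by (simp add: m_ac)
    also have "\<dots> = (u \<otimes> v) \<otimes> ((a \<otimes> b) \<otimes> (s' \<otimes> t'))"
      unfolding *(7)[symmetric] *(8)[symmetric] using c *(1-6) assms by (simp add: m_ac)
    finally show "fr (a' \<otimes> b') (s' \<otimes> t') = fr (a \<otimes> b) (s \<otimes> t)"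
      using * assms mult_denoms by (subst frac_eq_iff) auto
  qed
  finally show ?thesis .
qed

lemma frac_add:
  assumes "a \<in> carrier R" "b \<in> carrier R" "s \<in> denoms" "t \<in> denoms"
  shows "fr a s \<oplus>\<^bsub>L\<^esub> fr b t = fr (a \<otimes> t \<oplus> b \<otimes> s) (s \<otimes> t)"
proof -
  have "fr a s \<oplus>\<^bsub>L\<^esub> fr b t = (\<Union>(a', s')\<in>fr a s. \<Union>(b', t')\<in>fr b t. fr (a' \<otimes> t' \<oplus> b' \<otimes> s') (s' \<otimes> t'))"
    by (simp add: localization_def)
  also have "\<dots> = fr (a \<otimes> t \<oplus> b \<otimes> s) (s \<otimes> t)"
  proof (rule UN_frac[OF assms])
    fix a' s' b' t' u v
    assume *: "a' \<in> carrier R" "b' \<in> carrier R" "s' \<in> denoms" "t' \<in> denoms" "u \<in> denoms" "v \<in> denoms"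
      "u \<otimes> (a \<otimes> s') = u \<otimes> (a' \<otimes> s)" "v \<otimes> (b \<otimes> t') = v \<otimes> (b' \<otimes> t)"
    have c: "u \<in> carrier R" "v \<in> carrier R" "s \<in> carrier R" "t \<in> carrier R" "s' \<in> carrier R" "t' \<in> carrier R"
      using * assms by auto
    have "(u \<otimes> v) \<otimes> ((a' \<otimes> t' \<oplus> b' \<otimes> s') \<otimes> (s \<otimes> t))
       = (v \<otimes> t' \<otimes> t) \<otimes> (u \<otimes> (a' \<otimes> s)) \<oplus> (u \<otimes> s' \<otimes> s) \<otimes> (v \<otimes> (b' \<otimes> t))"
      using c *(1-6) assms by (simp add: m_ac l_distr r_distr)
    also have "\<dots> = (u \<otimes> v) \<otimes> ((a \<otimes> t \<oplus> b \<otimes> s) \<otimes> (s' \<otimes> t'))"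
      unfolding *(7)[symmetric] *(8)[symmetric] using c *(1-6) assms by (simp add: m_ac l_distr r_distr)
    finally have "\<exists>u\<in>denoms. u \<otimes> ((a' \<otimes> t' \<oplus> b' \<otimes> s') \<otimes> (s \<otimes> t)) = u \<otimes> ((a \<otimes> t \<oplus> b \<otimes> s) \<otimes> (s' \<otimes> t'))"
      using * mult_denoms by blast
    then show "fr (a' \<otimes> t' \<oplus> b' \<otimes> s') (s' \<otimes> t') = fr (a \<otimes> t \<oplus> b \<otimes> s) (s \<otimes> t)"
      using * assms c mult_denoms by (subst frac_eq_iff) auto
  qed
  finally show ?thesis .
qed

lemma one_localization: "\<one>\<^bsub>L\<^esub> = \<phi> \<one>" and zero_localization: "\<zero>\<^bsub>L\<^esub> = \<phi> \<zero>"
  by (simp_all add: localization_def)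

lemma frac_closed: "a \<in> carrier R \<Longrightarrow> s \<in> denoms \<Longrightarrow> fr a s \<in> carrier L"
  by (auto simp: carrier_localization)

lemma fracE:
  assumes "y \<in> carrier L"
  obtains a s where "a \<in> carrier R" "s \<in> denoms" "y = fr a s"
  using assms by (auto simp: carrier_localization)

lemma denoms_carrier: "s \<in> denoms \<Longrightarrow> s \<in> carrier R"
  by simp

lemma localization_cring: "cring L"
proof (rule cringI)
  note simps = frac_mult frac_add frac_closed one_localization zero_localization one_denoms mult_denoms
  show "abelian_group L"
  proof (rule abelian_groupI)
    fix y z assume "y \<in> carrier L" "z \<in> carrier L"
    then show "y \<oplus>\<^bsub>L\<^esub> z \<in> carrier L"
      by (elim fracE) (simp add: simps del: Diff_iff add: denoms_carrier)
  next
    show "\<zero>\<^bsub>L\<^esub> \<in> carrier L" by (simp add: simps del: Diff_iff)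
  next
    fix x y z assume "x \<in> carrier L" "y \<in> carrier L" "z \<in> carrier L"
    then show "x \<oplus>\<^bsub>L\<^esub> y \<oplus>\<^bsub>L\<^esub> z = x \<oplus>\<^bsub>L\<^esub> (y \<oplus>\<^bsub>L\<^esub> z)"
      by (elim fracE) (simp add: simps denoms_carrier l_distr r_distr m_ac a_ac del: Diff_iff)
  next
    fix y z assume "y \<in> carrier L" "z \<in> carrier L"
    then show "y \<oplus>\<^bsub>L\<^esub> z = z \<oplus>\<^bsub>L\<^esub> y"
      by (elim fracE) (simp add: simps denoms_carrier m_ac a_ac del: Diff_iff)
  next
    fix y assume "y \<in> carrier L"
    then obtain a s where *: "a \<in> carrier R" "s \<in> denoms" "y = fr a s" by (elim fracE)
    then show "\<zero>\<^bsub>L\<^esub> \<oplus>\<^bsub>L\<^esub> y = y"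
      by (simp add: simps denoms_carrier m_ac a_ac del: Diff_iff)
    have "fr (\<ominus> a) s \<oplus>\<^bsub>L\<^esub> y = \<zero>\<^bsub>L\<^esub>"
      using * by (simp add: simps denoms_carrier del: Diff_iff, intro fracI)
        (simp_all add: denoms_carrier simps l_minus l_neg del: Diff_iff)
    then show "\<exists>z\<in>carrier L. z \<oplus>\<^bsub>L\<^esub> y = \<zero>\<^bsub>L\<^esub>"
      by (rule bexI) (rule frac_closed, use * in auto)
  qed
  show "Group.comm_monoid L"
  proof (rule comm_monoidI)
    fix y z assume "y \<in> carrier L" "z \<in> carrier L"
    then obtain a s b t where *: "a \<in> carrier R" "s \<in> denoms" "y = fr a s"
      "b \<in> carrier R" "t \<in> denoms" "z = fr b t"
      by (elim fracE) blast
    show "y \<otimes>\<^bsub>L\<^esub> z \<in> carrier L"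
      unfolding * frac_mult[OF *(1,4,2,5)] by (intro frac_closed mult_denoms m_closed *)
    show "y \<otimes>\<^bsub>L\<^esub> z = z \<otimes>\<^bsub>L\<^esub> y"
      unfolding * frac_mult[OF *(1,4,2,5)] frac_mult[OF *(4,1,5,2)]
      using * by (simp add: m_comm)
  next
    show "\<one>\<^bsub>L\<^esub> \<in> carrier L" by (simp add: simps del: Diff_iff)
  next
    fix x y z assume "x \<in> carrier L" "y \<in> carrier L" "z \<in> carrier L"
    then show "x \<otimes>\<^bsub>L\<^esub> y \<otimes>\<^bsub>L\<^esub> z = x \<otimes>\<^bsub>L\<^esub> (y \<otimes>\<^bsub>L\<^esub> z)"
      by (elim fracE) (simp add: simps denoms_carrier m_assoc del: Diff_iff)
  next
    fix y assume "y \<in> carrier L"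
    then obtain a s where *: "a \<in> carrier R" "s \<in> denoms" "y = fr a s" by (elim fracE)
    then show "\<one>\<^bsub>L\<^esub> \<otimes>\<^bsub>L\<^esub> y = y"
      by (simp add: simps denoms_carrier del: Diff_iff)
  qed
  fix x y z assume "x \<in> carrier L" "y \<in> carrier L" "z \<in> carrier L"
  then obtain a s b t c r where *: "a \<in> carrier R" "s \<in> denoms" "x = fr a s"
    "b \<in> carrier R" "t \<in> denoms" "y = fr b t" "c \<in> carrier R" "r \<in> denoms" "z = fr c r"
    by (elim fracE) blast
  then show "(x \<oplus>\<^bsub>L\<^esub> y) \<otimes>\<^bsub>L\<^esub> z = x \<otimes>\<^bsub>L\<^esub> z \<oplus>\<^bsub>L\<^esub> y \<otimes>\<^bsub>L\<^esub> z"
    by (simp add: simps denoms_carrier del: Diff_iff, intro fracI)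
      (simp_all add: denoms_carrier simps l_distr r_distr m_ac del: Diff_iff)
qed

lemma frac_unit: "s \<in> denoms \<Longrightarrow> t \<in> denoms \<Longrightarrow> fr s t \<in> Units L"
proof -
  assume st: "s \<in> denoms" "t \<in> denoms"
  interpret L: cring L by (rule localization_cring)
  have "fr s t \<otimes>\<^bsub>L\<^esub> fr t s = \<one>\<^bsub>L\<^esub>"
    using st by (simp add: frac_mult one_localization denoms_carrier del: Diff_iff, intro fracI)
      (simp_all add: denoms_carrier mult_denoms one_denoms m_comm del: Diff_iff)
  moreover from this have "fr t s \<otimes>\<^bsub>L\<^esub> fr s t = \<one>\<^bsub>L\<^esub>"
    using st frac_closed L.m_comm denoms_carrier by metis
  ultimately show ?thesis
    using st frac_closed denoms_carrier unfolding Units_def by blast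
qed

sublocale loc: localizing_hom R "localization R P" "\<lambda>a. loc_frac R P a \<one>"
proof -
  interpret L: cring L by (rule localization_cring)
  have hom: "ring_hom_cring R L \<phi>"
  proof (rule ring_hom_cringI)
    show "cring R" "cring L" by (rule cring_axioms L.cring_axioms)+
    show "\<phi> \<in> ring_hom R L"
      by (rule ring_hom_memI)
        (simp_all add: frac_closed one_denoms frac_mult frac_add one_localization del: Diff_iff)
  qed
  show "localizing_hom R L \<phi>"
  proof (intro localizing_hom.intro[OF hom] localizing_hom_axioms.intro)
    fix y assume "y \<in> carrier L"
    then obtain a s where *: "a \<in> carrier R" "s \<in> denoms" "y = fr a s" by (elim fracE)
    then have "y \<otimes>\<^bsub>L\<^esub> \<phi> s = \<phi> a"
      by (simp add: frac_mult one_denoms denoms_carrier del: Diff_iff, intro fracI)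
         (simp_all add: one_denoms denoms_carrier del: Diff_iff)
    then show "\<exists>a\<in>carrier R. \<exists>s\<in>carrier R. \<phi> s \<in> Units L \<and> y \<otimes>\<^bsub>L\<^esub> \<phi> s = \<phi> a"
      using * frac_unit one_denoms by (intro bexI[of _ a] bexI[of _ s]) auto
  qed
qed

lemma frac_ideal:
  assumes "ideal I R" shows "ideal {fr b s | b s. b \<in> I \<and> s \<in> denoms} L"
proof -
  interpret I: ideal I R by fact
  define K where "K = {fr b s | b s. b \<in> I \<and> s \<in> denoms}"
  have "ideal K L"
  proof (rule loc.S.idealI_mult_closed)
    show "K \<subseteq> carrier L" unfolding K_def using I.Icarr frac_closed by auto
    show "\<zero>\<^bsub>L\<^esub> \<in> K"
      unfolding K_def zero_localization using additive_subgroup.zero_closed[OF I.additive_subgroup_axioms] one_denoms by blast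
    fix y z assume "y \<in> K"
    then obtain b s where y: "y = fr b s" "b \<in> I" "s \<in> denoms" unfolding K_def by blast
    { assume "z \<in> K"
      then obtain c t where z: "z = fr c t" "c \<in> I" "t \<in> denoms" unfolding K_def by blast
      have "y \<oplus>\<^bsub>L\<^esub> z = fr (b \<otimes> t \<oplus> c \<otimes> s) (s \<otimes> t)"
        unfolding y z using y z I.Icarr by (intro frac_add) auto
      moreover have "b \<otimes> t \<oplus> c \<otimes> s \<in> I"
        using y z by (intro additive_subgroup.a_closed[OF I.additive_subgroup_axioms] I.I_r_closed) auto
      ultimately show "y \<oplus>\<^bsub>L\<^esub> z \<in> K" using mult_denoms[OF y(3) z(3)] unfolding K_def by blast }
    assume "z \<in> carrier L"
    then obtain c t where z: "z = fr c t" "c \<in> carrier R" "t \<in> denoms" by (elim fracE) blast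
    have "z \<otimes>\<^bsub>L\<^esub> y = fr (c \<otimes> b) (t \<otimes> s)"
      unfolding y z using y z I.Icarr by (intro frac_mult) auto
    moreover have "c \<otimes> b \<in> I" using y z by (intro I.I_l_closed) auto
    ultimately show "z \<otimes>\<^bsub>L\<^esub> y \<in> K" using mult_denoms[OF z(3) y(3)] unfolding K_def by blast
  qed
  then show ?thesis unfolding K_def .
qed

text \<open>Clearing denominators in an equation between fractions.\<close>
lemma extension_elim:
  assumes Y: "Y \<subseteq> carrier R" and a: "a \<in> carrier R" "\<phi> a \<in> Idl\<^bsub>L\<^esub> (\<phi> ` Y)"
  obtains t where "t \<in> denoms" "t \<otimes> a \<in> Idl Y"
proof -
  interpret I: ideal "Idl Y" R by (rule genideal_ideal[OF Y])
  define K where "K = {fr b s | b s. b \<in> Idl Y \<and> s \<in> denoms}"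
  have "ideal K L" unfolding K_def by (rule frac_ideal) (rule I.ideal_axioms)
  moreover have "\<phi> ` Y \<subseteq> K" unfolding K_def using genideal_self[OF Y] one_denoms by blast
  ultimately have "\<phi> a \<in> K" using loc.S.genideal_minimal a(2) by blast
  then obtain b s where b: "\<phi> a = fr b s" "b \<in> Idl Y" "s \<in> denoms" unfolding K_def by blast
  then obtain u where u: "u \<in> denoms" "u \<otimes> (a \<otimes> s) = u \<otimes> (b \<otimes> \<one>)"
    using frac_eq_iff[of a b \<one> s] a I.Icarr one_denoms by auto
  have "(u \<otimes> s) \<otimes> a = u \<otimes> (a \<otimes> s)" using u a b by (simp add: m_ac)
  also have "u \<otimes> (a \<otimes> s) = u \<otimes> b" using u(2) b I.Icarr by simp
  also have "u \<otimes> b \<in> Idl Y" using u b by (intro I.I_l_closed) auto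
  finally show thesis using that[OF mult_denoms[OF u(1) b(3)]] by blast
qed

lemma extension_mem:
  assumes Y: "Y \<subseteq> carrier R" and a: "a \<in> Idl Y"
  shows "\<phi> a \<in> Idl\<^bsub>L\<^esub> (\<phi> ` Y)"
proof -
  have hY: "\<phi> ` Y \<subseteq> carrier L" using Y frac_closed one_denoms by blast
  have "ideal (loc.contraction (Idl\<^bsub>L\<^esub> (\<phi> ` Y))) R"
    by (intro loc.contraction_ideal loc.S.genideal_ideal hY)
  moreover have "Y \<subseteq> loc.contraction (Idl\<^bsub>L\<^esub> (\<phi> ` Y))"
    using Y loc.S.genideal_self[OF hY] by blast
  ultimately show ?thesis using genideal_minimal a by blast
qed

text \<open>Multiplying by a denominator is harmless in both directions, so the defining conditions descend to the
  original ring; properness is kept because the sequence lies in the prime.\<close>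
lemma localization_regular_sequence:
  assumes reg: "regular_sequence R xs" and P: "set xs \<subseteq> P"
  shows "regular_sequence L (map \<phi> xs)"
proof -
  have xs: "set xs \<subseteq> carrier R" using reg by (simp add: regular_sequence_def)
  have tk: "set (take i xs) \<subseteq> carrier R" for i using xs by (auto dest: in_set_takeD)
  have set_take: "set (take i (map \<phi> xs)) = \<phi> ` set (take i xs)" for i by (simp add: take_map)
  have step: "y \<in> Idl\<^bsub>L\<^esub> (\<phi> ` set (take i xs))"
    if i: "i < length xs" and y: "y \<in> carrier L" "\<phi> (xs ! i) \<otimes>\<^bsub>L\<^esub> y \<in> Idl\<^bsub>L\<^esub> (\<phi> ` set (take i xs))" for i y
  proof -
    interpret I: ideal "Idl\<^bsub>L\<^esub> (\<phi> ` set (take i xs))" L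
      by (rule loc.S.genideal_ideal) (use tk[of i] frac_closed one_denoms in blast)
    have x: "xs ! i \<in> carrier R" using xs i by auto
    obtain a s where as: "a \<in> carrier R" "s \<in> denoms" "y = fr a s" using y(1) by (elim fracE)
    have sc: "s \<in> carrier R" using as by simp
    have ys: "y \<otimes>\<^bsub>L\<^esub> \<phi> s = \<phi> a"
      unfolding as(3) using as sc one_denoms
      by (simp add: frac_mult del: Diff_iff, intro fracI) (simp_all add: mult_denoms del: Diff_iff)
    have "\<phi> (xs ! i \<otimes> a) = \<phi> (xs ! i) \<otimes>\<^bsub>L\<^esub> y \<otimes>\<^bsub>L\<^esub> \<phi> s"
      using x as(1) y(1) sc by (simp add: loc.S.m_assoc ys)
    also have "\<dots> \<in> Idl\<^bsub>L\<^esub> (\<phi> ` set (take i xs))" using I.I_r_closed[OF y(2), of "\<phi> s"] sc by simp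
    finally obtain t where t: "t \<in> denoms" "t \<otimes> (xs ! i \<otimes> a) \<in> Idl (set (take i xs))"
      using extension_elim[OF tk, of "xs ! i \<otimes> a" i] x as by blast
    have tc: "t \<in> carrier R" using t by simp
    have "xs ! i \<otimes> (t \<otimes> a) \<in> Idl (set (take i xs))" using t(2) tc x as(1) by (simp add: m_lcomm)
    then have "t \<otimes> a \<in> Idl (set (take i xs))"
      using reg i tc as(1) unfolding regular_sequence_def by blast
    then have m: "\<phi> (t \<otimes> a) \<in> Idl\<^bsub>L\<^esub> (\<phi> ` set (take i xs))" by (rule extension_mem[OF tk])
    have ts: "t \<otimes> s \<in> denoms" by (rule mult_denoms[OF t(1) as(2)])
    have "fr \<one> (t \<otimes> s) \<otimes>\<^bsub>L\<^esub> \<phi> (t \<otimes> a) = fr (\<one> \<otimes> (t \<otimes> a)) (t \<otimes> s \<otimes> \<one>)"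
      using as(1) tc ts by (intro frac_mult one_denoms) auto
    also have "\<dots> = y"
      unfolding as(3) using as(1) sc tc by (intro fracI mult_denoms ts one_denoms as(2)) (simp_all add: m_ac)
    finally have "y = fr \<one> (t \<otimes> s) \<otimes>\<^bsub>L\<^esub> \<phi> (t \<otimes> a)" ..
    also have "\<dots> \<in> Idl\<^bsub>L\<^esub> (\<phi> ` set (take i xs))"
      by (rule I.I_l_closed[OF m]) (rule frac_closed[OF one_closed ts])
    finally show ?thesis .
  qed
  have proper: "Idl\<^bsub>L\<^esub> (\<phi> ` set xs) \<noteq> carrier L"
  proof
    assume "Idl\<^bsub>L\<^esub> (\<phi> ` set xs) = carrier L"
    then have "\<phi> \<one> \<in> Idl\<^bsub>L\<^esub> (\<phi> ` set xs)" by simp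
    then obtain t where "t \<in> denoms" "t \<otimes> \<one> \<in> Idl (set xs)"
      using extension_elim[OF xs] by blast
    moreover have "Idl (set xs) \<subseteq> P" by (rule genideal_minimal[OF _ P]) (rule ideal_axioms)
    ultimately show False by auto
  qed
  show ?thesis
    unfolding regular_sequence_def set_take using xs step proper by auto
qed

definition "local_ideal = {fr a s | a s. a \<in> P \<and> s \<in> denoms}"

lemma maximalideal_localization_iff: "maximalideal J L \<longleftrightarrow> J = local_ideal"
proof -
  have id: "ideal local_ideal L"
    unfolding local_ideal_def by (rule frac_ideal) (rule ideal_axioms)
  have proper: "\<one>\<^bsub>L\<^esub> \<notin> local_ideal"
  proof
    assume "\<one>\<^bsub>L\<^esub> \<in> local_ideal"
    then obtain a s where a: "\<phi> \<one> = fr a s" "a \<in> P" "s \<in> denoms"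
      unfolding local_ideal_def one_localization by blast
    then obtain u where u: "u \<in> denoms" "u \<otimes> (\<one> \<otimes> s) = u \<otimes> (a \<otimes> \<one>)"
      using frac_eq_iff[of \<one> a \<one> s] Icarr one_denoms by auto
    have "u \<otimes> a \<in> P" using u a by (intro I_l_closed) auto
    moreover have "u \<otimes> s \<in> denoms" by (rule mult_denoms[OF u(1) a(3)])
    moreover have "u \<otimes> s = u \<otimes> a" using u a Icarr by auto
    ultimately show False by simp
  qed
  have sub: "J \<subseteq> local_ideal" if J: "ideal J L" "J \<noteq> carrier L" for J
  proof
    interpret J: ideal J L by fact
    fix y assume y: "y \<in> J"
    then obtain a s where as: "a \<in> carrier R" "s \<in> denoms" "y = fr a s" using fracE[OF J.Icarr[OF y]] by blast
    have "a \<in> P"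
    proof (rule ccontr)
      assume "a \<notin> P"
      then have "y \<in> Units L" unfolding as(3) using as by (intro frac_unit) auto
      then have "inv\<^bsub>L\<^esub> y \<otimes>\<^bsub>L\<^esub> y = \<one>\<^bsub>L\<^esub>" "inv\<^bsub>L\<^esub> y \<in> carrier L" by auto
      then have "\<one>\<^bsub>L\<^esub> \<in> J" using J.I_l_closed[OF y] by metis
      then show False using J.one_imp_carrier J(2) by blast
    qed
    then show "y \<in> local_ideal" unfolding local_ideal_def using as by blast
  qed
  have max: "maximalideal local_ideal L"
  proof (rule maximalidealI[OF id])
    show "carrier L \<noteq> local_ideal" using proper by auto
    show "K = local_ideal \<or> K = carrier L" if "ideal K L" "local_ideal \<subseteq> K" "K \<subseteq> carrier L" for K
      using sub[OF that(1)] that(2) by blast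
  qed
  show ?thesis
  proof
    assume m: "maximalideal J L"
    then interpret J: maximalideal J L .
    have "J \<subseteq> local_ideal" using sub J.ideal_axioms J.I_notcarr by metis
    then show "J = local_ideal"
      using J.I_maximal[OF id] proper ideal.Icarr[OF id] by blast
  qed (use max in simp)
qed

end

text \<open>In the localization at \<open>M\<close>, the sequence gives \<open>d \<le> grade\<close>, the existence of chains gives
  \<open>grade \<le> dimension\<close>, and contraction gives \<open>dimension \<le> d\<close>.\<close>
lemma (in cring) cohen_macaulayI:
  assumes noeth: "noetherian_ring R" and dim: "krull_dim R \<le> enat d"
    and reg: "\<And>M. maximalideal M R \<Longrightarrow> \<exists>xs. regular_sequence R xs \<and> set xs \<subseteq> M \<and> length xs = d"
  shows "cohen_macaulay R"
  unfolding cohen_macaulay_def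
proof (intro conjI allI impI)
  show "cring R" "noetherian_ring R" by (rule cring_axioms noeth)+
  fix M assume M: "maximalideal M R"
  interpret prime_localization M R
    using maximalideal_prime[OF M] by (simp add: prime_localization_def)
  obtain xs where xs: "regular_sequence R xs" "set xs \<subseteq> M" "length xs = d" using reg M by blast
  have reg: "regular_sequence L (map \<phi> xs)" by (rule localization_regular_sequence[OF xs(1,2)])
  have "set (map \<phi> xs) \<subseteq> local_ideal"
    unfolding local_ideal_def using xs(2) one_denoms by auto
  then have "enat d \<le> grade L local_ideal"
    unfolding grade_def using reg xs(3) by (intro Sup_upper) (auto intro!: exI[of _ "map \<phi> xs"])
  moreover have "grade L local_ideal \<le> krull_dim L"
    unfolding grade_def by (rule Sup_least) (auto intro: loc.S.length_regular_sequence_le_krull_dim)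
  moreover have "krull_dim L \<le> enat d" using loc.krull_dim_mono dim by (rule order_trans)
  ultimately have "grade L local_ideal = krull_dim L" by simp
  then show "cohen_macaulay_local L"
    unfolding cohen_macaulay_local_def
    using localization_cring loc.noetherian[OF noeth] maximalideal_localization_iff by blast
qed

section \<open>Monomials and the reverse lexicographic order\<close>

abbreviation lookup where "lookup \<equiv> Poly_Mapping.lookup"
abbreviation keys where "keys \<equiv> Poly_Mapping.keys"
abbreviation single where "single \<equiv> Poly_Mapping.single"

lemma keys_add_nat: "keys (s + t) = keys s \<union> keys (t :: 'a \<Rightarrow>\<^sub>0 nat)"
  by (auto simp: in_keys_iff lookup_add)

lemma mon_degree_eq_sum: "finite A \<Longrightarrow> keys t \<subseteq> A \<Longrightarrow> mon_degree t = (\<Sum>i\<in>A. lookup t i)"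
  unfolding mon_degree_def by (intro sum.mono_neutral_left) (auto simp: in_keys_iff)

lemma mon_degree_add [simp]: "mon_degree (s + t) = mon_degree s + mon_degree t"
proof -
  let ?A = "keys s \<union> keys t"
  have "mon_degree u = (\<Sum>i\<in>?A. lookup u i)" if "keys u \<subseteq> ?A" for u
    using that by (intro mon_degree_eq_sum) auto
  then show ?thesis by (simp add: keys_add_nat lookup_add sum.distrib)
qed

lemma mon_degree_single [simp]: "mon_degree (single i k) = k"
  by (simp add: mon_degree_def)

lemma mon_degree_zero [simp]: "mon_degree 0 = 0"
  by (simp add: mon_degree_def)

lemma lookup_le_mon_degree: "lookup t i \<le> mon_degree t"
proof (cases "i \<in> keys t")
  case True
  then show ?thesis unfolding mon_degree_def by (intro member_le_sum) auto
qed (simp add: in_keys_iff)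

lemma finite_monomials_degree_le: "finite {t. keys t \<subseteq> {1..N} \<and> mon_degree t \<le> d}"
proof -
  let ?r = "\<lambda>t. restrict (lookup t) {1..N}"
  have "inj_on ?r {t. keys t \<subseteq> {1..N} \<and> mon_degree t \<le> d}"
  proof (rule inj_onI, rule poly_mapping_eqI)
    fix s t :: "nat \<Rightarrow>\<^sub>0 nat" and i
    assume *: "s \<in> {t. keys t \<subseteq> {1..N} \<and> mon_degree t \<le> d}" "t \<in> {t. keys t \<subseteq> {1..N} \<and> mon_degree t \<le> d}"
      "?r s = ?r t"
    show "lookup s i = lookup t i"
    proof (cases "i \<in> {1..N}")
      case True
      then show ?thesis using fun_cong[OF *(3), of i] by simp
    next
      case False
      then have "i \<notin> keys s" "i \<notin> keys t" using * by blast+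
      then show ?thesis by (simp add: in_keys_iff)
    qed
  qed
  moreover have "?r ` {t. keys t \<subseteq> {1..N} \<and> mon_degree t \<le> d} \<subseteq> {1..N} \<rightarrow>\<^sub>E {..d}"
    using lookup_le_mon_degree le_trans by (fastforce simp: PiE_iff)
  moreover have "finite ({1..N} \<rightarrow>\<^sub>E {..d})" by (intro finite_PiE) auto
  ultimately show ?thesis using inj_on_finite by blast
qed

lemma revlex_irrefl: "\<not> revlex_less t t"
  by (simp add: revlex_less_def)

lemma revlex_trans:
  assumes "revlex_less s t" "revlex_less t u" shows "revlex_less s u"
proof -
  consider "mon_degree s < mon_degree u" | "mon_degree s = mon_degree t" "mon_degree t = mon_degree u"
    using assms unfolding revlex_less_def by linarith
  then show ?thesis
  proof cases
    case 2
    then obtain i j where i: "lookup s i > lookup t i" "\<forall>k>i. lookup s k = lookup t k"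
      and j: "lookup t j > lookup u j" "\<forall>k>j. lookup t k = lookup u k"
      using assms unfolding revlex_less_def by auto
    have "lookup s (max i j) > lookup u (max i j)"
      using i j by (cases i j rule: linorder_cases) (auto simp: max_def)
    moreover have "\<forall>k>max i j. lookup s k = lookup u k" using i j by auto
    ultimately show ?thesis using 2 unfolding revlex_less_def by auto
  qed (simp add: revlex_less_def)
qed

lemma revlex_total:
  assumes "s \<noteq> t" shows "revlex_less s t \<or> revlex_less t s"
proof (cases "mon_degree s = mon_degree t")
  case True
  \<comment> \<open>The order is decided at the last position where the exponents differ.\<close>
  define D where "D = {i. lookup s i \<noteq> lookup t i}"
  have "D \<subseteq> keys s \<union> keys t" by (auto simp: D_def in_keys_iff)
  then have fin: "finite D" by (rule finite_subset) simp
  have ne: "D \<noteq> {}" using assms by (auto simp: D_def poly_mapping_eq_iff fun_eq_iff)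
  have "lookup s (Max D) \<noteq> lookup t (Max D)" using Max_in[OF fin ne] by (simp add: D_def)
  moreover have "lookup s j = lookup t j" if "j > Max D" for j
    using Max_ge[OF fin, of j] that by (force simp: D_def)
  ultimately show ?thesis using True unfolding revlex_less_def by (metis linorder_neqE_nat)
qed (auto simp: revlex_less_def)

lemma revlex_add: "revlex_less (u + s) (u + t) \<longleftrightarrow> revlex_less s t"
  by (simp add: revlex_less_def lookup_add)

text \<open>In finitely many variables only finitely many monomials lie below a given one, so the order is
  well-founded there.\<close>
lemma revlex_induct [consumes 1, case_names less]:
  assumes "keys t \<subseteq> {1..N}"
    and step: "\<And>t. keys t \<subseteq> {1..N} \<Longrightarrow> (\<And>s. keys s \<subseteq> {1..N} \<Longrightarrow> revlex_less s t \<Longrightarrow> P s) \<Longrightarrow> P t"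
  shows "P t"
  using assms(1)
proof (induction "card {s. keys s \<subseteq> {1..N} \<and> revlex_less s t}" arbitrary: t rule: less_induct)
  case less
  let ?B = "\<lambda>t. {s. keys s \<subseteq> {1..N} \<and> revlex_less s t}"
  have fin: "finite (?B t)"
    by (rule finite_subset[OF _ finite_monomials_degree_le[of N "mon_degree t"]]) (auto simp: revlex_less_def)
  show ?case
  proof (rule step[OF less.prems])
    fix s assume s: "keys s \<subseteq> {1..N}" "revlex_less s t"
    have "?B s \<subset> ?B t" using s revlex_trans revlex_irrefl by blast
    then have "card (?B s) < card (?B t)" by (rule psubset_card_mono[OF fin])
    then show "P s" using less.hyps s(1) by blast
  qed
qed

section \<open>Polynomial rings\<close>

definition polys :: "nat set \<Rightarrow> 'k::field mpoly set" where
  "polys V = {p. \<forall>t\<in>keys p. keys t \<subseteq> V}"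

lemma mpoly_ring_simps:
  "carrier (mpoly_ring N) = polys {1..N}"
  "monoid.mult (mpoly_ring N) = (*)" "monoid.one (mpoly_ring N) = 1"
  "ring.zero (mpoly_ring N) = 0" "ring.add (mpoly_ring N) = (+)"
  by (auto simp: mpoly_ring_def polys_def)

lemma polys_add: "p \<in> polys V \<Longrightarrow> q \<in> polys V \<Longrightarrow> p + q \<in> polys V"
  using Poly_Mapping.keys_add[of p q] by (auto simp: polys_def)

lemma polys_uminus: "p \<in> polys V \<Longrightarrow> - p \<in> polys V"
  by (auto simp: polys_def in_keys_iff)

lemma polys_diff: "p \<in> polys V \<Longrightarrow> q \<in> polys V \<Longrightarrow> p - q \<in> polys V"
  using polys_add[of p V "- q"] polys_uminus[of q V] by simp

lemma polys_mult: "p \<in> polys V \<Longrightarrow> q \<in> polys V \<Longrightarrow> p * q \<in> polys V"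
proof -
  assume pq: "p \<in> polys V" "q \<in> polys V"
  show ?thesis unfolding polys_def
  proof (rule CollectI, rule ballI)
    fix t assume "t \<in> keys (p * q)"
    then obtain r s where "t = r + s" "r \<in> keys p" "s \<in> keys q"
      using Poly_Mapping.keys_mult[of p q] by blast
    then show "keys t \<subseteq> V" using pq by (simp add: polys_def keys_add_nat)
  qed
qed

lemma polys_zero: "0 \<in> polys V" and polys_one: "1 \<in> polys V"
  by (auto simp: polys_def)

lemma polys_single: "keys t \<subseteq> V \<Longrightarrow> single t c \<in> polys V"
  by (auto simp: polys_def)

lemma polys_sum: "(\<And>i. i \<in> A \<Longrightarrow> f i \<in> polys V) \<Longrightarrow> sum f A \<in> polys V"
  by (induction A rule: infinite_finite_induct) (auto intro: polys_zero polys_add)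

lemma polys_power: "p \<in> polys V \<Longrightarrow> p ^ n \<in> polys V"
  by (induction n) (auto intro: polys_one polys_mult)

lemma polys_mono: "V \<subseteq> W \<Longrightarrow> polys V \<subseteq> polys W"
  by (auto simp: polys_def)

lemmas polys_closed = polys_zero polys_one polys_add polys_uminus polys_diff polys_mult polys_sum polys_power

lemma poly_eq_sum_single: "(p :: 'k::field mpoly) = (\<Sum>t\<in>keys p. single t (lookup p t))"
  by (rule poly_mapping_eqI) (simp add: lookup_sum lookup_single when_def in_keys_iff)

text \<open>The main induction principle: polynomials are sums of terms, and only terms that occur in \<open>p\<close> have to be
  considered.\<close>
lemma poly_induct_add [case_names single add zero]:
  fixes p :: "'k::field mpoly"
  assumes "\<And>t c. t \<in> keys p \<Longrightarrow> P (single t c)" "\<And>p q. P p \<Longrightarrow> P q \<Longrightarrow> P (p + q)" "P 0"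
  shows "P p"
proof -
  have "P (\<Sum>t\<in>A. single t (lookup p t))" if "finite A" "A \<subseteq> keys p" for A
    using that by (induction A rule: finite_induct) (auto intro: assms)
  from this[of "keys p"] show ?thesis using poly_eq_sum_single[of p] by simp
qed

lemma lookup_single_mult: "lookup (single t c * p) (t + s) = c * lookup p (s :: nat \<Rightarrow>\<^sub>0 nat)"
  by (simp add: lookup_mult lookup_single when_mult mult.commute)

lemma single_eq_0_iff: "single t c = 0 \<longleftrightarrow> c = 0"
  by (metis lookup_single_eq lookup_zero single_zero)

lemma keys_single_mult:
  assumes "c \<noteq> (0 :: 'k::field)" shows "keys (single t c * p) = (+) t ` keys (p :: 'k mpoly)"
proof
  show "keys (single t c * p) \<subseteq> (+) t ` keys p"
    using Poly_Mapping.keys_mult[of "single t c" p] by (auto split: if_splits)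
  show "(+) t ` keys p \<subseteq> keys (single t c * p)"
    using assms by (auto simp: in_keys_iff lookup_single_mult)
qed

lemma mpoly_ring_cring: "cring (mpoly_ring N :: 'k::field mpoly ring)"
proof (rule cringI)
  show "abelian_group (mpoly_ring N :: 'k mpoly ring)"
    by (rule abelian_groupI)
       (auto simp: mpoly_ring_simps algebra_simps intro: polys_closed bexI[of _ "- x" for x])
  show "Group.comm_monoid (mpoly_ring N :: 'k mpoly ring)"
    by (rule comm_monoidI) (auto simp: mpoly_ring_simps algebra_simps intro: polys_closed)
qed (simp add: mpoly_ring_simps algebra_simps)

lemma
  assumes "ideal J (mpoly_ring N :: 'k::field mpoly ring)"
  shows mpoly_ideal_subset: "J \<subseteq> polys {1..N}"
    and mpoly_ideal_zero: "0 \<in> J"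
    and mpoly_ideal_add: "a \<in> J \<Longrightarrow> b \<in> J \<Longrightarrow> a + b \<in> J"
    and mpoly_ideal_mult: "x \<in> polys {1..N} \<Longrightarrow> a \<in> J \<Longrightarrow> x * a \<in> J"
    and mpoly_ideal_diff: "a \<in> J \<Longrightarrow> b \<in> J \<Longrightarrow> a - b \<in> J"
proof -
  interpret ideal J "mpoly_ring N :: 'k mpoly ring" by fact
  show "J \<subseteq> polys {1..N}" using a_subset by (simp add: mpoly_ring_simps)
  show "0 \<in> J" using additive_subgroup.zero_closed[OF additive_subgroup_axioms] unfolding mpoly_ring_simps .
  show add: "a + b \<in> J" if "a \<in> J" "b \<in> J" for a b using additive_subgroup.a_closed[OF additive_subgroup_axioms that] by (simp add: mpoly_ring_simps)
  show mult: "x * a \<in> J" if "x \<in> polys {1..N}" "a \<in> J" for x a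
    using I_l_closed[of a x] that by (simp add: mpoly_ring_simps)
  show "a - b \<in> J" if "a \<in> J" "b \<in> J"
    using add[OF that(1) mult[of "- 1", OF polys_uminus[OF polys_one] that(2)]] by simp
qed

lemma mpoly_idealI:
  assumes "J \<subseteq> polys {1..N}" "0 \<in> J" "\<And>a b. a \<in> J \<Longrightarrow> b \<in> J \<Longrightarrow> a + b \<in> J"
    and "\<And>x a. x \<in> polys {1..N} \<Longrightarrow> a \<in> J \<Longrightarrow> x * a \<in> J"
  shows "ideal J (mpoly_ring N :: 'k::field mpoly ring)"
proof -
  interpret cring "mpoly_ring N :: 'k mpoly ring" by (rule mpoly_ring_cring)
  show ?thesis by (rule idealI_mult_closed) (use assms in \<open>simp_all add: mpoly_ring_simps\<close>)
qed

section \<open>Leading exponents\<close>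

definition lead :: "'k::field mpoly \<Rightarrow> nat \<Rightarrow>\<^sub>0 nat" where
  "lead p = (THE t. t \<in> keys p \<and> (\<forall>s\<in>keys p. s \<noteq> t \<longrightarrow> revlex_less s t))"

lemma initial_monomial_lead: "initial_monomial revlex_less p = monomial (lead p)"
  by (simp add: initial_monomial_def lead_def)

lemma lead_eqI:
  assumes "t \<in> keys p" "\<And>s. s \<in> keys p \<Longrightarrow> s \<noteq> t \<Longrightarrow> revlex_less s t" shows "lead p = t"
  unfolding lead_def
proof (rule the_equality)
  show "t \<in> keys p \<and> (\<forall>s\<in>keys p. s \<noteq> t \<longrightarrow> revlex_less s t)" using assms by blast
  fix u assume u: "u \<in> keys p \<and> (\<forall>s\<in>keys p. s \<noteq> u \<longrightarrow> revlex_less s u)"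
  show "u = t"
  proof (rule ccontr)
    assume "u \<noteq> t"
    then have "revlex_less u t" "revlex_less t u" using u assms by auto
    then show False using revlex_trans revlex_irrefl by blast
  qed
qed

lemma lead_works:
  assumes "p \<noteq> 0"
  shows "lead p \<in> keys p" and "s \<in> keys p \<Longrightarrow> s \<noteq> lead p \<Longrightarrow> revlex_less s (lead p)"
proof -
  have "\<exists>t\<in>A. \<forall>s\<in>A. s \<noteq> t \<longrightarrow> revlex_less s t" if "finite A" "A \<noteq> {}" for A
    using that
  proof (induction A rule: finite_ne_induct)
    case (insert a A)
    then obtain t where t: "t \<in> A" "\<forall>s\<in>A. s \<noteq> t \<longrightarrow> revlex_less s t" by blast
    show ?case
    proof (cases "revlex_less a t")
      case True
      then show ?thesis using t by (intro bexI[of _ t]) auto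
    next
      case False
      then have "revlex_less t a" using revlex_total[of a t] t(1) insert.hyps by auto
      then have "\<forall>s\<in>insert a A. s \<noteq> a \<longrightarrow> revlex_less s a" using t revlex_trans by (metis insert_iff)
      then show ?thesis by blast
    qed
  qed simp
  moreover have "keys p \<noteq> {}" using assms by simp
  ultimately obtain t where t: "t \<in> keys p" "\<forall>s\<in>keys p. s \<noteq> t \<longrightarrow> revlex_less s t"
    using finite_keys by blast
  then have "lead p = t" by (intro lead_eqI) auto
  then show "lead p \<in> keys p" "s \<in> keys p \<Longrightarrow> s \<noteq> lead p \<Longrightarrow> revlex_less s (lead p)" using t by auto
qed

text \<open>A coefficient of a product to which only one pair of exponents contributes.\<close>
lemma lookup_mult_extreme:
  fixes p q :: "'k::field mpoly"
  assumes ext: "\<And>s t. s \<in> keys p \<Longrightarrow> t \<in> keys q \<Longrightarrow> s + t = a + b \<Longrightarrow> s = a \<and> t = b"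
  shows "lookup (p * q) (a + b) = lookup p a * lookup q b"
proof -
  have *: "lookup (single s (lookup p s) * q) (a + b) = (if s = a then lookup p a * lookup q b else 0)"
    if s: "s \<in> keys p" for s
  proof (cases "s = a")
    case False
    have "a + b \<notin> keys (single s (lookup p s) * q)"
      using ext[OF s] False s by (auto simp: keys_single_mult in_keys_iff)
    then show ?thesis using False by (simp add: in_keys_iff)
  qed (simp add: lookup_single_mult)
  have "p * q = (\<Sum>s\<in>keys p. single s (lookup p s) * q)"
    by (subst poly_eq_sum_single[of p]) (simp add: sum_distrib_right)
  then have "lookup (p * q) (a + b) = (\<Sum>s\<in>keys p. if s = a then lookup p a * lookup q b else 0)"
    by (simp add: lookup_sum * cong: sum.cong)
  then show ?thesis by (simp add: in_keys_iff)
qed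

lemma lead_mult:
  fixes p q :: "'k::field mpoly"
  assumes "p \<noteq> 0" "q \<noteq> 0" shows "lead (p * q) = lead p + lead q"
proof (rule lead_eqI)
  have less: "s + t = lead p + lead q \<and> s = lead p \<and> t = lead q \<or> revlex_less (s + t) (lead p + lead q)"
    if "s \<in> keys p" "t \<in> keys q" for s t
  proof (cases "t = lead q")
    case True
    then show ?thesis using lead_works(2)[OF assms(1) that(1)] revlex_add[of "lead q" s "lead p"]
      by (auto simp: add.commute)
  next
    case False
    then have "revlex_less (s + t) (s + lead q)"
      using lead_works(2)[OF assms(2) that(2)] by (simp add: revlex_add)
    moreover have "s = lead p \<or> revlex_less (s + lead q) (lead p + lead q)"
      using lead_works(2)[OF assms(1) that(1)] revlex_add[of "lead q" s "lead p"] by (auto simp: add.commute)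
    ultimately show ?thesis using revlex_trans by blast
  qed
  have "lookup (p * q) (lead p + lead q) = lookup p (lead p) * lookup q (lead q)"
    by (rule lookup_mult_extreme) (use less revlex_irrefl in metis)
  then show "lead p + lead q \<in> keys (p * q)"
    using lead_works(1)[OF assms(1)] lead_works(1)[OF assms(2)] by (simp add: in_keys_iff)
  fix r assume r: "r \<in> keys (p * q)" "r \<noteq> lead p + lead q"
  then show "revlex_less r (lead p + lead q)"
    using Poly_Mapping.keys_mult[of p q] less by blast
qed

lemma lead_one: "lead (1 :: 'k::field mpoly) = 0"
  by (rule lead_eqI) auto

lemma unit_mpoly_lead:
  fixes p :: "'k::field mpoly" assumes "p dvd 1" shows "lead p = 0"
proof -
  obtain q where q: "1 = p * q" using assms by (rule dvdE)
  then have "p \<noteq> 0" "q \<noteq> 0" by auto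
  then have "lead p + lead q = 0" using lead_mult lead_one q by metis
  then have "mon_degree (lead p) = 0" by (metis add_is_0 mon_degree_add mon_degree_zero)
  then show ?thesis using lookup_le_mon_degree[of "lead p"] by (intro poly_mapping_eqI) auto
qed

text \<open>Modulo \<open>1 + z\<close> the element \<open>z\<close> is \<open>-1\<close>, so \<open>1 + z\<close> would be a unit if it divided a power of \<open>z\<close>.\<close>
lemma not_dvd_power_pred:
  fixes z :: "'k::field mpoly"
  assumes z: "z \<noteq> 0" "lead z \<noteq> 0" shows "\<not> (1 + z) dvd z ^ k"
proof
  assume "(1 + z) dvd z ^ k"
  then have "(1 + z) dvd 1"
  proof (induction k)
    case (Suc k)
    have "z ^ k = (1 + z) * z ^ k - z ^ Suc k" by (simp add: algebra_simps)
    then show ?case using Suc by (metis dvd_diff dvd_triv_left)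
  qed simp
  then have "lead (1 + z) = 0" by (rule unit_mpoly_lead)
  have deg: "mon_degree (lead z) > 0"
    using z lookup_le_mon_degree[of "lead z"] by (metis le_zero_eq lookup_zero not_gr_zero poly_mapping_eqI)
  have "lead (1 + z) = lead z"
  proof (rule lead_eqI)
    show "lead z \<in> keys (1 + z)"
      using lead_works(1)[OF z(1)] z(2) by (simp add: in_keys_iff lookup_add lookup_one when_def)
    fix s assume s: "s \<in> keys (1 + z)" "s \<noteq> lead z"
    then have "s = 0 \<or> s \<in> keys z" using Poly_Mapping.keys_add[of 1 z] by auto
    then show "revlex_less s (lead z)" using lead_works(2)[OF z(1) _ s(2)] deg by (auto simp: revlex_less_def)
  qed
  then show False using \<open>lead (1 + z) = 0\<close> z by simp
qed

lemma lead_single: "c \<noteq> 0 \<Longrightarrow> lead (single t c) = t"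
  by (rule lead_eqI) auto

lemma lead_diff_less:
  assumes "p \<noteq> 0" "q \<noteq> 0" "lead p = lead q" "lookup p (lead p) = lookup q (lead q)" "p - q \<noteq> 0"
  shows "revlex_less (lead (p - q)) (lead p)"
proof -
  have k: "lead (p - q) \<in> keys (p - q)" by (rule lead_works(1)[OF assms(5)])
  have "lead (p - q) \<noteq> lead p" using k assms(3,4) by (auto simp: in_keys_iff lookup_minus)
  moreover have "lead (p - q) \<in> keys p \<union> keys q" using k by (auto simp: in_keys_iff lookup_minus)
  ultimately show ?thesis using lead_works(2) assms(1-3) by (metis Un_iff)
qed

section \<open>The Hilbert basis theorem\<close>

lemma subseq_incseq:
  fixes f :: "nat \<Rightarrow> nat" obtains r where "strict_mono r" "incseq (f \<circ> r)"
proof -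
  obtain r where r: "strict_mono r" "monoseq (\<lambda>n. f (r n))" using seq_monosub by blast
  show thesis
  proof (cases "incseq (\<lambda>n. f (r n))")
    case True then show thesis using that r by (simp add: comp_def)
  next
    case False
    then have dec: "decseq (\<lambda>n. f (r n))" using r by (simp add: monoseq_iff)
    define n0 where "n0 = (ARG_MIN (\<lambda>n. f (r n)) n. True)"
    have min: "f (r n0) \<le> f (r n)" for n
      unfolding n0_def by (rule arg_min_nat_le) simp
    have "f (r (n0 + n)) = f (r n0)" for n
      using min[of "n0 + n"] dec by (simp add: decseq_def antisym)
    then have "incseq (f \<circ> (\<lambda>n. r (n0 + n)))" by (simp add: incseq_def)
    moreover have "strict_mono (\<lambda>n. r (n0 + n))" using r(1) by (simp add: strict_mono_def)
    ultimately show thesis by (rule that[rotated])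
  qed
qed

lemma subseq_incseq_all:
  fixes f :: "nat \<Rightarrow> nat \<Rightarrow>\<^sub>0 nat"
  assumes "finite V" obtains r where "strict_mono r" "\<And>k. k \<in> V \<Longrightarrow> incseq (\<lambda>n. lookup (f (r n)) k)"
  using assms
proof (induction V arbitrary: thesis rule: finite_induct)
  case empty
  show ?case by (rule empty[of id]) (auto simp: strict_mono_def)
next
  case (insert k V)
  obtain r where r: "strict_mono r" "\<And>k. k \<in> V \<Longrightarrow> incseq (\<lambda>n. lookup (f (r n)) k)"
    using insert.IH by blast
  obtain r' where r': "strict_mono r'" "incseq ((\<lambda>n. lookup (f (r n)) k) \<circ> r')"
    by (rule subseq_incseq)
  show ?case
  proof (rule insert.prems[of "r \<circ> r'"])
    show "strict_mono (r \<circ> r')" using r r' by (simp add: strict_mono_o)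
    fix l assume "l \<in> insert k V"
    then show "incseq (\<lambda>n. lookup (f ((r \<circ> r') n)) l)"
      using r(2)[of l] r'
      by (auto simp: incseq_def comp_def strict_mono_less_eq)
  qed
qed

text \<open>Dickson's lemma: after passing to a subsequence all exponents are weakly increasing.\<close>
lemma dickson:
  fixes f :: "nat \<Rightarrow> nat \<Rightarrow>\<^sub>0 nat"
  assumes "\<And>n. keys (f n) \<subseteq> {1..N}" obtains i j u where "i < j" "f j = u + f i"
proof -
  obtain r where r: "strict_mono r" "\<And>k. k \<in> {1..N} \<Longrightarrow> incseq (\<lambda>n. lookup (f (r n)) k)"
    by (rule subseq_incseq_all[of "{1..N}" f]) auto
  have "lookup (f (r 0)) k \<le> lookup (f (r 1)) k" for k
  proof (cases "k \<in> {1..N}")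
    case False
    then have "k \<notin> keys (f (r 0))" using assms by blast
    then show ?thesis by (simp add: in_keys_iff)
  qed (use r(2)[of k] in \<open>auto simp: incseq_def\<close>)
  then have "f (r 1) = (f (r 1) - f (r 0)) + f (r 0)"
    by (intro poly_mapping_eqI) (simp add: lookup_add lookup_minus)
  moreover have "r 0 < r 1" using r(1) by (simp add: strict_mono_less)
  ultimately show thesis using that by blast
qed

text \<open>If \<open>J\<close> were not finitely generated, choosing successively elements outside the ideal of the earlier ones, with
  smallest leading exponent, would give a sequence to which Dickson's lemma applies: a multiple of an earlier
  element cancels the leading term of a later one and produces a smaller choice.\<close>
theorem mpoly_ring_noetherian: "noetherian_ring (mpoly_ring N :: 'k::field mpoly ring)"
proof -
  let ?R = "mpoly_ring N :: 'k mpoly ring"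
  interpret cring ?R by (rule mpoly_ring_cring)
  show ?thesis
  proof (rule noetherian_ringI)
    fix J assume J: "ideal J ?R"
    show "\<exists>A\<subseteq>carrier ?R. finite A \<and> J = Idl\<^bsub>?R\<^esub> A"
    proof (rule ccontr)
      assume nf: "\<not> ?thesis"
      define good where "good A p \<longleftrightarrow> p \<in> J - Idl\<^bsub>?R\<^esub> A \<and>
        (\<forall>q\<in>J - Idl\<^bsub>?R\<^esub> A. \<not> revlex_less (lead q) (lead p))" for A p
      have idA: "ideal (Idl\<^bsub>?R\<^esub> A) ?R" "A \<subseteq> Idl\<^bsub>?R\<^esub> A" if "A \<subseteq> J" for A
        using that mpoly_ideal_subset[OF J] genideal_ideal genideal_self
        by (auto simp: mpoly_ring_simps)
      have ex: "\<exists>p. good A p" if A: "finite A" "A \<subseteq> J" for A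
      proof -
        have "Idl\<^bsub>?R\<^esub> A \<subseteq> J" by (rule genideal_minimal[OF J A(2)])
        moreover have "Idl\<^bsub>?R\<^esub> A \<noteq> J"
          using nf A mpoly_ideal_subset[OF J] by (auto simp: mpoly_ring_simps)
        ultimately obtain p where p: "p \<in> J - Idl\<^bsub>?R\<^esub> A" by auto
        have lk: "keys (lead q) \<subseteq> {1..N}" if "q \<in> J - Idl\<^bsub>?R\<^esub> A" for q
        proof -
          have "q \<noteq> 0" using that mpoly_ideal_zero[OF idA(1)[OF A(2)]] by auto
          then show ?thesis using lead_works(1) that mpoly_ideal_subset[OF J] by (auto simp: polys_def)
        qed
        have "\<forall>q. q \<in> J - Idl\<^bsub>?R\<^esub> A \<longrightarrow> lead q = t \<longrightarrow> (\<exists>p. good A p)" if "keys t \<subseteq> {1..N}" for t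
          using that
        proof (induction t rule: revlex_induct)
          case (less t)
          then show ?case using lk unfolding good_def by metis
        qed
        then show ?thesis using lk[OF p] p by blast
      qed
      \<comment> \<open>The sequence f n picks from the complement of the ideal of its predecessors.\<close>
      define pick where "pick A = (SOME p. good A p)" for A
      define F where "F = rec_nat {} (\<lambda>_ A. insert (pick A) A)"
      have F: "F 0 = {}" "F (Suc n) = insert (pick (F n)) (F n)" for n by (simp_all add: F_def)
      have FJ: "finite (F n) \<and> F n \<subseteq> J" for n
      proof (induction n)
        case (Suc n)
        then have "good (F n) (pick (F n))" unfolding pick_def using ex by (metis someI_ex)
        then show ?case using Suc by (auto simp: F good_def)
      qed (simp add: F)
      define f where "f n = pick (F n)" for n
      have good: "good (F n) (f n)" for n unfolding f_def pick_def using FJ ex by (metis someI_ex)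
      have mono: "f i \<in> F j" if "i < j" for i j
        using that by (induction j) (auto simp: F f_def less_Suc_eq)
      have fJ: "f n \<in> J" "f n \<notin> Idl\<^bsub>?R\<^esub> (F n)" for n using good by (auto simp: good_def)
      have nz: "f n \<noteq> 0" for n
        using fJ(2) mpoly_ideal_zero[OF idA(1)] FJ by metis
      have "keys (lead (f n)) \<subseteq> {1..N}" for n
        using lead_works(1)[OF nz] fJ(1) mpoly_ideal_subset[OF J] by (fastforce simp: polys_def)
      then obtain i j u where ij: "i < j" "lead (f j) = u + lead (f i)"
        using dickson[of "\<lambda>n. lead (f n)" N] by blast
      define c where "c = lookup (f j) (lead (f j)) / lookup (f i) (lead (f i))"
      have c0: "lookup (f k) (lead (f k)) \<noteq> 0" for k using lead_works(1)[OF nz] by (simp add: in_keys_iff)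
      then have c: "c \<noteq> 0" by (simp add: c_def)
      have "keys (lead (f j)) \<subseteq> {1..N}"
        using lead_works(1)[OF nz] fJ(1) mpoly_ideal_subset[OF J] by (fastforce simp: polys_def)
      then have u: "single u c \<in> polys {1..N}"
        unfolding ij(2) by (intro polys_single) (simp add: keys_add_nat)
      let ?g = "single u c * f i"
      have gF: "?g \<in> Idl\<^bsub>?R\<^esub> (F j)"
        using mpoly_ideal_mult[OF idA(1) u] idA(2) mono[OF ij(1)] FJ by blast
      have gJ: "?g \<in> J" by (rule mpoly_ideal_mult[OF J u fJ(1)])
      have g: "lead ?g = lead (f j)" "?g \<noteq> 0"
        using c nz ij(2) by (simp_all add: lead_mult lead_single single_eq_0_iff)
      have "f j - ?g \<notin> Idl\<^bsub>?R\<^esub> (F j)"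
      proof
        assume "f j - ?g \<in> Idl\<^bsub>?R\<^esub> (F j)"
        then have "f j - ?g + ?g \<in> Idl\<^bsub>?R\<^esub> (F j)"
          using mpoly_ideal_add[OF idA(1)] gF FJ by blast
        then show False using fJ(2) by simp
      qed
      moreover have "f j - ?g \<in> J" by (rule mpoly_ideal_diff[OF J fJ(1) gJ])
      moreover have "revlex_less (lead (f j - ?g)) (lead (f j))"
      proof (rule lead_diff_less[OF nz g(2) g(1)[symmetric]])
        show "lookup (f j) (lead (f j)) = lookup ?g (lead ?g)"
        proof -
          have "lookup ?g (lead ?g) = c * lookup (f i) (lead (f i))"
            unfolding g(1) ij(2) by (rule lookup_single_mult)
          then show ?thesis using c0[of i] by (simp add: c_def)
        qed
        show "f j - ?g \<noteq> 0"
          using calculation(1) mpoly_ideal_zero[OF idA(1)] FJ by metis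
      qed
      ultimately show False using good[of j] unfolding good_def by blast
    qed
  qed
qed

section \<open>Moving factors apart\<close>

abbreviation expo :: "nat \<Rightarrow> nat \<Rightarrow>\<^sub>0 nat" where "expo i \<equiv> single i 1"

text \<open>The analogue for exponent vectors of comparing the first elements of two multisets.\<close>
lemma expo_exchange:
  assumes "expo a + t = expo b + (u :: nat \<Rightarrow>\<^sub>0 nat)"
  shows "a = b \<and> t = u \<or> (\<exists>w. t = expo b + w \<and> u = expo a + w)"
proof (cases "a = b")
  case False
  have l: "lookup (expo a + t) k = lookup (expo b + u) k" for k using assms by simp
  have "t = expo b + (t - expo b)"
  proof (rule poly_mapping_eqI)
    fix k show "lookup t k = lookup (expo b + (t - expo b)) k"
      using l[of k] False by (auto simp: lookup_add lookup_minus lookup_single when_def split: if_splits)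
  qed
  moreover have "u = expo a + (t - expo b)"
  proof (rule poly_mapping_eqI)
    fix k show "lookup u k = lookup (expo a + (t - expo b)) k"
      using l[of k] False by (auto simp: lookup_add lookup_minus lookup_single when_def split: if_splits)
  qed
  ultimately show ?thesis by blast
qed (use assms in simp)

text \<open>\<open>Rd p q\<close> means that the outer pair \<open>x\<^sub>p x\<^sub>q\<close> may replace inner pairs of the same index sum. The last two
  assumptions are what interval cliques and connectedness of the graphs provide.\<close>
locale spread_relation =
  fixes N :: nat and Rd :: "nat \<Rightarrow> nat \<Rightarrow> bool"
  assumes Rd_bounds: "Rd p q \<Longrightarrow> 1 \<le> p \<and> p + 2 \<le> q \<and> q \<le> N"
    and Rd_sub: "Rd p q \<Longrightarrow> p \<le> p' \<Longrightarrow> q' \<le> q \<Longrightarrow> p' + 2 \<le> q' \<Longrightarrow> Rd p' q'"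
    and Rd_adjacent: "1 \<le> p \<Longrightarrow> p + 2 \<le> N \<Longrightarrow> Rd p (p + 2)"
begin

definition movable :: "nat \<Rightarrow> nat \<Rightarrow> bool" where
  "movable b c \<longleftrightarrow> 2 \<le> b \<and> b \<le> c \<and> Rd (b - 1) (c + 1)"

definition step :: "(nat \<Rightarrow>\<^sub>0 nat) \<Rightarrow> (nat \<Rightarrow>\<^sub>0 nat) \<Rightarrow> bool" where
  "step t t' \<longleftrightarrow> (\<exists>b c u. movable b c \<and> t = expo b + (expo c + u) \<and> t' = expo (b - 1) + (expo (c + 1) + u))"

lemma movable_bounds: "movable b c \<Longrightarrow> 2 \<le> b \<and> b \<le> c \<and> c + 1 \<le> N"
  using Rd_bounds by (auto simp: movable_def)

lemma movable_sub: "movable b c \<Longrightarrow> b \<le> b' \<Longrightarrow> b' \<le> c' \<Longrightarrow> c' \<le> c \<Longrightarrow> movable b' c'"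
  unfolding movable_def using Rd_sub[of "b - 1" "c + 1" "b' - 1" "c' + 1"] by auto

lemma stepI: "movable b c \<Longrightarrow> t = expo b + (expo c + u) \<Longrightarrow> t' = expo (b - 1) + (expo (c + 1) + u) \<Longrightarrow> step t t'"
  by (auto simp: step_def)

lemma step_add: "step t t' \<Longrightarrow> step (u + t) (u + t')"
  unfolding step_def by (metis (no_types, lifting) add.left_commute)

lemma step_keys:
  assumes "step t t'" "keys t \<subseteq> {1..N}" shows "keys t' \<subseteq> {1..N}"
proof -
  obtain b c u where *: "movable b c" "t = expo b + (expo c + u)" "t' = expo (b - 1) + (expo (c + 1) + u)"
    using assms(1) by (auto simp: step_def)
  then show ?thesis using movable_bounds[OF *(1)] assms(2) by (auto simp: keys_add_nat)
qed

lemma step_revlex: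
  assumes "step t t'" shows "revlex_less t' t"
proof -
  obtain b c u where *: "movable b c" "t = expo b + (expo c + u)" "t' = expo (b - 1) + (expo (c + 1) + u)"
    using assms by (auto simp: step_def)
  have bc: "2 \<le> b" "b \<le> c" using movable_bounds[OF *(1)] by auto
  have "lookup t' (c + 1) > lookup t (c + 1)"
    using bc by (simp add: * lookup_add lookup_single when_def)
  moreover have "lookup t' j = lookup t j" if "j > c + 1" for j
    using bc that by (simp add: * lookup_add lookup_single when_def)
  moreover have "mon_degree t' = mon_degree t" by (simp add: *)
  ultimately show ?thesis unfolding revlex_less_def by blast
qed

text \<open>Moves of disjoint pairs of chips commute. If the pairs share one chip, three chips \<open>b \<le> c \<le> d\<close> are involved,
  and \<open>Rd\<close> being closed under subintervals provides the moves that join the two results. If the pairs are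
  \<open>(b, c)\<close> and \<open>(b, d)\<close>, or \<open>(b, d)\<close> and \<open>(c, d)\<close>, one result moves to the other; if they are \<open>(b, c)\<close> and
  \<open>(c, d)\<close>, both move to \<open>b - 1, c, d + 1\<close>.\<close>
lemma step_locally_confluent:
  assumes "step t x" "step t y"
  shows "\<exists>z. step\<^sup>=\<^sup>= x z \<and> step\<^sup>=\<^sup>= y z"
proof -
  obtain b c u where x: "movable b c" "t = expo b + (expo c + u)" "x = expo (b - 1) + (expo (c + 1) + u)"
    using assms(1) by (auto simp: step_def)
  obtain b' c' u' where y: "movable b' c'" "t = expo b' + (expo c' + u')" "y = expo (b' - 1) + (expo (c' + 1) + u')"
    using assms(2) by (auto simp: step_def)
  note bc = movable_bounds[OF x(1)] movable_bounds[OF y(1)]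
  have same_left: "step\<^sup>=\<^sup>= (expo (b - 1) + (expo (c + 1) + (expo d + w))) (expo (b - 1) + (expo (d + 1) + (expo c + w)))"
    if "movable b d" "2 \<le> b" "b \<le> c" "c \<le> d" for b c d w
  proof (cases "c = d")
    case False
    then have "movable (c + 1) d" using that by (intro movable_sub[OF that(1)]) auto
    then have "step (expo (b - 1) + (expo (c + 1) + (expo d + w))) (expo (b - 1) + (expo (d + 1) + (expo c + w)))"
      by (rule stepI[of _ _ _ "expo (b - 1) + w"]) (simp_all add: ac_simps)
    then show ?thesis by simp
  qed (simp add: ac_simps)
  have same_right: "step\<^sup>=\<^sup>= (expo (d - 1) + (expo (c + 1) + (expo b + w))) (expo (b - 1) + (expo (c + 1) + (expo d + w)))"
    if "movable b c" "2 \<le> b" "b \<le> d" "d \<le> c" for b c d w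
  proof (cases "b = d")
    case False
    then have "movable b (d - 1)" using that by (intro movable_sub[OF that(1)]) auto
    then have "step (expo (d - 1) + (expo (c + 1) + (expo b + w))) (expo (b - 1) + (expo (c + 1) + (expo d + w)))"
      by (rule stepI[of _ _ _ "expo (c + 1) + w"]) (use that False in \<open>simp_all add: ac_simps\<close>)
    then show ?thesis by simp
  qed (simp add: ac_simps)
  have chain: "\<exists>z. step\<^sup>=\<^sup>= (expo (b - 1) + (expo (c + 1) + (expo d + w))) z \<and> step\<^sup>=\<^sup>= (expo (c - 1) + (expo (d + 1) + (expo b + w))) z"
    if m: "movable b c" "movable c d" and l: "2 \<le> b" "b \<le> c" "c \<le> d" for b c d w
  proof (intro exI conjI)
    let ?z = "expo (b - 1) + (expo c + (expo (d + 1) + w))"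
    show "step\<^sup>=\<^sup>= (expo (b - 1) + (expo (c + 1) + (expo d + w))) ?z"
    proof (cases "c = d")
      case False
      then have "movable (c + 1) d" using l by (intro movable_sub[OF m(2)]) auto
      then have "step (expo (b - 1) + (expo (c + 1) + (expo d + w))) ?z"
        by (rule stepI[of _ _ _ "expo (b - 1) + w"]) (simp_all add: ac_simps)
      then show ?thesis by simp
    qed (simp add: ac_simps)
    show "step\<^sup>=\<^sup>= (expo (c - 1) + (expo (d + 1) + (expo b + w))) ?z"
    proof (cases "b = c")
      case False
      then have "movable b (c - 1)" using l by (intro movable_sub[OF m(1)]) auto
      then have "step (expo (c - 1) + (expo (d + 1) + (expo b + w))) ?z"
        by (rule stepI[of _ _ _ "expo (d + 1) + w"]) (use l False in \<open>simp_all add: ac_simps\<close>)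
      then show ?thesis by simp
    qed (simp add: ac_simps)
  qed
  have eq: "expo b + (expo c + u) = expo b' + (expo c' + u')" using x y by simp
  from expo_exchange[OF eq] show ?thesis
  proof
    assume a: "b = b' \<and> expo c + u = expo c' + u'"
    from expo_exchange[OF conjunct2[OF a]] show ?thesis
    proof
      assume "c = c' \<and> u = u'" then show ?thesis using a x y by auto
    next
      assume "\<exists>w. u = expo c' + w \<and> u' = expo c + w"
      then obtain w where w: "u = expo c' + w" "u' = expo c + w" by blast
      show ?thesis
      proof (cases "c \<le> c'")
        case True
        then have "step\<^sup>=\<^sup>= x y" unfolding x(3) y(3) w using a same_left[of b c' c w] y bc by simp
        then show ?thesis by blast
      next
        case False
        then have "step\<^sup>=\<^sup>= y x" unfolding x(3) y(3) w using a same_left[of b c c' w] x bc by simp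
        then show ?thesis by blast
      qed
    qed
  next
    assume "\<exists>v. expo c + u = expo b' + v \<and> expo c' + u' = expo b + v"
    then obtain v where v: "expo c + u = expo b' + v" "expo c' + u' = expo b + v" by blast
    from expo_exchange[OF v(1)] expo_exchange[OF v(2)] consider
      (1) "c = b'" "u = v" "c' = b" "u' = v"
      | (2) w where "c = b'" "u = v" "u' = expo b + w" "v = expo c' + w"
      | (3) w where "u = expo b' + w" "v = expo c + w" "c' = b" "u' = v"
      | (4) w w' where "u = expo b' + w" "v = expo c + w" "u' = expo b + w'" "v = expo c' + w'"
      by blast
    then show ?thesis
    proof cases
      case 1
      then have "x = y" using x y bc by (simp add: ac_simps)
      then show ?thesis by auto
    next
      case 2
      then show ?thesis unfolding x(3) y(3) using chain[of b c c' w] x y bc by simp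
    next
      case 3
      then show ?thesis unfolding x(3) y(3) using chain[of b' b c w] x y bc by fastforce
    next
      case 4
      then have "expo c + w = expo c' + w'" by simp
      from expo_exchange[OF this] show ?thesis
      proof
        assume cw: "c = c' \<and> w = w'"
        show ?thesis
        proof (cases "b \<le> b'")
          case True
          then have "step\<^sup>=\<^sup>= y x" unfolding x(3) y(3) 4 using cw same_right[of b c b' w] x bc by simp
          then show ?thesis by blast
        next
          case False
          then have "step\<^sup>=\<^sup>= x y" unfolding x(3) y(3) 4 using cw same_right[of b' c b w] y bc by simp
          then show ?thesis by blast
        qed
      next
        assume "\<exists>r. w = expo c' + r \<and> w' = expo c + r"
        then obtain r where r: "w = expo c' + r" "w' = expo c + r" by blast
        let ?z = "expo (b - 1) + (expo (c + 1) + (expo (b' - 1) + (expo (c' + 1) + r)))"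
        have "step x ?z" unfolding x(3) 4 r
          by (rule stepI[OF y(1), of _ "expo (b - 1) + (expo (c + 1) + r)"]) (simp_all add: ac_simps)
        moreover have "step y ?z" unfolding y(3) 4 r
          by (rule stepI[OF x(1), of _ "expo (b' - 1) + (expo (c' + 1) + r)"]) (simp_all add: ac_simps)
        ultimately show ?thesis by auto
      qed
    qed
  qed
qed

definition standard :: "(nat \<Rightarrow>\<^sub>0 nat) \<Rightarrow> bool" where
  "standard t \<longleftrightarrow> (\<nexists>t'. step t t')"

lemma steps_keys: "step\<^sup>*\<^sup>* t t' \<Longrightarrow> keys t \<subseteq> {1..N} \<Longrightarrow> keys t' \<subseteq> {1..N}"
  by (induction rule: rtranclp_induct) (use step_keys in blast)+

lemma steps_revlex: "step\<^sup>*\<^sup>* t t' \<Longrightarrow> t' = t \<or> revlex_less t' t"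
  by (induction rule: rtranclp_induct) (use step_revlex revlex_trans in blast)+

lemma steps_add: "step\<^sup>*\<^sup>* t t' \<Longrightarrow> step\<^sup>*\<^sup>* (u + t) (u + t')"
  by (induction rule: rtranclp_induct) (auto intro: step_add rtranclp.rtrancl_into_rtrancl)

lemma ex_normal_form: "keys t \<subseteq> {1..N} \<Longrightarrow> \<exists>s. step\<^sup>*\<^sup>* t s \<and> standard s"
proof (induction t rule: revlex_induct)
  case (less t)
  show ?case
  proof (cases "standard t")
    case False
    then obtain t' where t': "step t t'" by (auto simp: standard_def)
    then obtain s where "step\<^sup>*\<^sup>* t' s" "standard s"
      using less step_keys step_revlex by blast
    then show ?thesis using t' by (meson converse_rtranclp_into_rtranclp)
  qed auto
qed

text \<open>Newman's lemma, by induction along the reverse lexicographic order.\<close>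
lemma normal_form_unique:
  "keys t \<subseteq> {1..N} \<Longrightarrow> step\<^sup>*\<^sup>* t s \<Longrightarrow> standard s \<Longrightarrow> step\<^sup>*\<^sup>* t s' \<Longrightarrow> standard s' \<Longrightarrow> s = s'"
proof (induction t arbitrary: s s' rule: revlex_induct)
  case (less t)
  show ?case
  proof (cases "standard t")
    case True
    have "t = r" if "step\<^sup>*\<^sup>* t r" for r
      by (rule converse_rtranclpE[OF that]) (use True in \<open>auto simp: standard_def\<close>)
    then show ?thesis using less.prems(1,3) by metis
  next
    case False
    then have "t \<noteq> s" "t \<noteq> s'" using less.prems by auto
    then obtain x y where x: "step t x" "step\<^sup>*\<^sup>* x s" and y: "step t y" "step\<^sup>*\<^sup>* y s'"
      using converse_rtranclpE[OF less.prems(1)] converse_rtranclpE[OF less.prems(3)] by metis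
    obtain z where z: "step\<^sup>=\<^sup>= x z" "step\<^sup>=\<^sup>= y z" using step_locally_confluent x(1) y(1) by blast
    have xz: "step\<^sup>*\<^sup>* x z" "step\<^sup>*\<^sup>* y z" using z by auto
    have kx: "keys x \<subseteq> {1..N}" "keys y \<subseteq> {1..N}" using step_keys x y less.hyps by blast+
    obtain r where r: "step\<^sup>*\<^sup>* z r" "standard r" using ex_normal_form steps_keys xz kx by blast
    have "s = r"
      by (rule less.IH[OF kx(1) step_revlex[OF x(1)] x(2) less.prems(2) rtranclp_trans[OF xz(1) r(1)] r(2)])
    moreover have "s' = r"
      by (rule less.IH[OF kx(2) step_revlex[OF y(1)] y(2) less.prems(4) rtranclp_trans[OF xz(2) r(1)] r(2)])
    ultimately show ?thesis by simp
  qed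
qed

definition nform :: "(nat \<Rightarrow>\<^sub>0 nat) \<Rightarrow> (nat \<Rightarrow>\<^sub>0 nat)" where
  "nform t = (SOME s. step\<^sup>*\<^sup>* t s \<and> standard s)"

lemma nform:
  assumes "keys t \<subseteq> {1..N}"
  shows "step\<^sup>*\<^sup>* t (nform t)" "standard (nform t)" "keys (nform t) \<subseteq> {1..N}"
    "nform t = t \<or> revlex_less (nform t) t"
proof -
  have *: "step\<^sup>*\<^sup>* t (nform t) \<and> standard (nform t)"
    unfolding nform_def by (rule someI_ex[OF ex_normal_form[OF assms]])
  show 1: "step\<^sup>*\<^sup>* t (nform t)" by (rule conjunct1[OF *])
  show "standard (nform t)" by (rule conjunct2[OF *])
  show "keys (nform t) \<subseteq> {1..N}" "nform t = t \<or> revlex_less (nform t) t"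
    using steps_keys[OF 1 assms] steps_revlex[OF 1] by auto
qed

lemma nform_eqI: "keys t \<subseteq> {1..N} \<Longrightarrow> step\<^sup>*\<^sup>* t s \<Longrightarrow> standard s \<Longrightarrow> nform t = s"
  by (rule normal_form_unique[OF _ nform(1,2)])

lemma nform_standard: "keys t \<subseteq> {1..N} \<Longrightarrow> standard t \<Longrightarrow> nform t = t"
  by (rule nform_eqI) auto

lemma nform_steps: "keys t \<subseteq> {1..N} \<Longrightarrow> step\<^sup>*\<^sup>* t t' \<Longrightarrow> nform t = nform t'"
  using nform(1,2)[OF steps_keys[of t t']] by (intro nform_eqI) (auto intro: rtranclp_trans)

lemma nform_add:
  assumes "keys t \<subseteq> {1..N}" "keys u \<subseteq> {1..N}" shows "nform (u + t) = nform (u + nform t)"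
  using assms nform by (intro nform_steps steps_add) (auto simp: keys_add_nat)

text \<open>A move needs chips strictly between \<open>1\<close> and \<open>N\<close>, so factors \<open>x\<^sub>1\<close> and \<open>x\<^sub>N\<close> never take part in one.\<close>
lemma standard_ends:
  assumes "standard s" "keys t \<subseteq> {1, N}" shows "standard (t + s)"
  unfolding standard_def
proof
  assume "\<exists>t'. step (t + s) t'"
  then obtain b c u where *: "movable b c" "t + s = expo b + (expo c + u)" by (auto simp: step_def)
  have bc: "b \<notin> keys t" "c \<notin> keys t" using movable_bounds[OF *(1)] assms(2) by auto
  have "s = expo b + (expo c + (u - t))"
  proof (rule poly_mapping_eqI)
    fix k
    have "lookup (t + s) k = lookup (expo b + (expo c + u)) k" using * by simp
    then show "lookup s k = lookup (expo b + (expo c + (u - t))) k"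
      using bc by (auto simp: lookup_add lookup_minus lookup_single when_def in_keys_iff split: if_splits)
  qed
  then show False using assms(1) *(1) unfolding standard_def step_def by blast
qed

lemma standard_squarefree_inside:
  assumes "standard t" "2 \<le> i" "i + 1 \<le> N" shows "lookup t i \<le> 1"
proof (rule ccontr)
  assume *: "\<not> ?thesis"
  have "t = expo i + (expo i + (t - (expo i + expo i)))"
    by (rule poly_mapping_eqI) (use * in \<open>auto simp: lookup_add lookup_minus lookup_single when_def\<close>)
  moreover have "movable i i" using assms Rd_adjacent[of "i - 1"] by (simp add: movable_def)
  ultimately show False using assms(1) unfolding standard_def step_def by blast
qed

lemma finite_standard: "finite {t. keys t \<subseteq> {1..N} \<and> standard t \<and> mon_degree t \<le> d}"
  by (rule finite_subset[OF _ finite_monomials_degree_le[of N d]]) auto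

text \<open>A standard monomial is determined by its support and its exponents at \<open>1\<close> and \<open>N\<close>, since all other
  exponents are at most \<open>1\<close>.\<close>
lemma card_standard_le:
  "card {t. keys t \<subseteq> {1..N} \<and> standard t \<and> mon_degree t \<le> d} \<le> 2 ^ N * (d + 1)\<^sup>2"
proof -
  let ?S = "{t. keys t \<subseteq> {1..N} \<and> standard t \<and> mon_degree t \<le> d}"
  let ?f = "\<lambda>t. (keys t, lookup t 1, lookup t N)"
  have "inj_on ?f ?S"
  proof (rule inj_onI, rule poly_mapping_eqI)
    fix s t :: "nat \<Rightarrow>\<^sub>0 nat" and i assume *: "s \<in> ?S" "t \<in> ?S" "?f s = ?f t"
    show "lookup s i = lookup t i"
    proof (cases "i \<in> keys s \<and> i \<noteq> 1 \<and> i \<noteq> N")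
      case True
      then have "i \<in> {1..N}" "i \<in> keys t" using * by blast+
      then have "2 \<le> i" "i + 1 \<le> N" using True by auto
      then have "lookup s i \<le> 1" "lookup t i \<le> 1"
        using * standard_squarefree_inside[of _ i] by auto
      then show ?thesis using True \<open>i \<in> keys t\<close> by (auto simp: in_keys_iff)
    next
      case False
      then show ?thesis using * by (auto simp: in_keys_iff)
    qed
  qed
  moreover have "?f ` ?S \<subseteq> Pow {1..N} \<times> ({..d} \<times> {..d})"
    using lookup_le_mon_degree le_trans by blast
  ultimately have "card ?S \<le> card (Pow {1..N} \<times> ({..d} \<times> {..d}))"
    by (rule card_inj_on_le) simp
  then show ?thesis by (simp add: card_cartesian_product card_Pow power2_eq_square)
qed

section \<open>The linear normal form and the Groebner basis\<close>

definition NF :: "'k::field mpoly \<Rightarrow> 'k mpoly" where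
  "NF p = (\<Sum>t\<in>keys p. single (nform t) (lookup p t))"

lemma NF_superset:
  "finite A \<Longrightarrow> keys p \<subseteq> A \<Longrightarrow> NF p = (\<Sum>t\<in>A. single (nform t) (lookup p t))"
  unfolding NF_def by (intro sum.mono_neutral_left) (auto simp: in_keys_iff)

lemma NF_zero [simp]: "NF 0 = 0"
  by (simp add: NF_def)

lemma NF_single: "NF (single t c) = single (nform t) c"
  by (simp add: NF_superset[of "{t}"])

lemma NF_add: "NF (p + q) = NF p + NF q"
proof -
  let ?A = "keys p \<union> keys q"
  have "NF r = (\<Sum>t\<in>?A. single (nform t) (lookup r t))" if "keys r \<subseteq> ?A" for r :: "'a mpoly"
    by (rule NF_superset) (use that in auto)
  then show ?thesis
    using Poly_Mapping.keys_add[of p q] by (simp add: lookup_add single_add sum.distrib)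
qed

lemma NF_uminus: "NF (- p) = - NF p"
  using NF_add[of p "- p"] by (simp add: eq_neg_iff_add_eq_0 add.commute)

lemma NF_diff: "NF (p - q) = NF p - NF q"
  using NF_add[of p "- q"] by (simp add: NF_uminus)

lemma NF_sum: "NF (sum f A) = (\<Sum>i\<in>A. NF (f i))"
  by (induction A rule: infinite_finite_induct) (auto simp: NF_add)

lemma NF_polys: "p \<in> polys {1..N} \<Longrightarrow> NF p \<in> polys {1..N}"
  unfolding NF_def by (intro polys_sum polys_single nform(3)) (simp add: polys_def)

lemma NF_single_mult:
  assumes "keys u \<subseteq> {1..N}" "p \<in> polys {1..N}"
  shows "NF (single u c * p) = NF (single u c * NF p)"
proof (induction p rule: poly_induct_add)
  case (single t d)
  then have "keys t \<subseteq> {1..N}" using assms(2) by (simp add: polys_def)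
  then show ?case using nform_add[of t u] assms(1) by (simp add: NF_single mult_single)
qed (simp_all add: NF_add distrib_left)

definition spread_binomial :: "nat \<Rightarrow> nat \<Rightarrow> 'k::field mpoly" where
  "spread_binomial p q = mvar (p + 1) * mvar (q - 1) - mvar p * mvar q"

definition spread_binomials :: "'k::field mpoly set" where
  "spread_binomials = {spread_binomial p q | p q. Rd p q}"

definition spread_ideal :: "'k::field mpoly set" where
  "spread_ideal = Idl\<^bsub>mpoly_ring N\<^esub> spread_binomials"

lemma spread_binomial_eq:
  "spread_binomial p q = single (expo (p + 1) + expo (q - 1)) 1 - single (expo p + expo q) 1"
  by (simp add: spread_binomial_def mvar_def monomial_def mult_single)

lemma spread_binomials_polys: "spread_binomials \<subseteq> polys {1..N}"
  using Rd_bounds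
  by (fastforce simp: spread_binomials_def spread_binomial_eq keys_add_nat intro!: polys_diff polys_single)

lemma spread_ideal: "ideal spread_ideal (mpoly_ring N :: 'k::field mpoly ring)"
    "spread_binomials \<subseteq> (spread_ideal :: 'k::field mpoly set)"
proof -
  interpret cring "mpoly_ring N :: 'k mpoly ring" by (rule mpoly_ring_cring)
  show "ideal spread_ideal (mpoly_ring N :: 'k::field mpoly ring)"
    "spread_binomials \<subseteq> (spread_ideal :: 'k::field mpoly set)"
    using genideal_ideal genideal_self spread_binomials_polys
    by (simp_all add: spread_ideal_def mpoly_ring_simps)
qed

lemma spread_binomialI:
  assumes "movable b c" shows "single (expo b + expo c) 1 - single (expo (b - 1) + expo (c + 1)) 1 \<in> spread_binomials"
proof -
  have "single (expo b + expo c) 1 - single (expo (b - 1) + expo (c + 1)) 1 = spread_binomial (b - 1) (c + 1)"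
    using movable_bounds[OF assms] by (simp add: spread_binomial_eq)
  then show ?thesis using assms unfolding movable_def spread_binomials_def by blast
qed

text \<open>Reducing one factor first does not change the normal form of a product; hence a product with an element
  of normal form \<open>0\<close> again has normal form \<open>0\<close>.\<close>
lemma NF_kernel_ideal: "ideal {p \<in> polys {1..N}. NF p = 0} (mpoly_ring N :: 'k::field mpoly ring)"
proof (rule mpoly_idealI)
  fix x a :: "'k mpoly" assume x: "x \<in> polys {1..N}" and a: "a \<in> {p \<in> polys {1..N}. NF p = 0}"
  have "NF (x * a) = 0"
  proof (induction x rule: poly_induct_add)
    case (single t c)
    then have "keys t \<subseteq> {1..N}" using x by (simp add: polys_def)
    then show ?case using NF_single_mult[of t a c] a by simp
  qed (simp_all add: NF_add distrib_right)
  then show "x * a \<in> {p \<in> polys {1..N}. NF p = 0}" using x a by (simp add: polys_mult)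
qed (auto simp: NF_add polys_closed)

lemma spread_binomial_NF:
  assumes "Rd p q" shows "NF (spread_binomial p q) = 0"
proof -
  have pq: "1 \<le> p" "p + 2 \<le> q" "q \<le> N" using Rd_bounds[OF assms] by auto
  have "movable (p + 1) (q - 1)" using pq assms by (simp add: movable_def)
  then have "step (expo (p + 1) + expo (q - 1)) (expo p + expo q)"
    by (rule stepI[of _ _ _ 0]) (use pq in simp_all)
  then have "nform (expo (p + 1) + expo (q - 1)) = nform (expo p + expo q)"
    using pq by (intro nform_steps) (auto simp: keys_add_nat)
  then show ?thesis by (simp add: spread_binomial_eq NF_diff NF_single)
qed

lemma single_diff_steps_mem:
  assumes "step\<^sup>*\<^sup>* t t'" "keys t \<subseteq> {1..N}"
  shows "single t c - single t' c \<in> (spread_ideal :: 'k::field mpoly set)"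
  using assms
proof (induction rule: rtranclp_induct)
  case base
  show ?case using mpoly_ideal_zero[OF spread_ideal(1)] by simp
next
  case (step x y)
  obtain a b u where *: "movable a b" "x = expo a + (expo b + u)" "y = expo (a - 1) + (expo (b + 1) + u)"
    using step.hyps(2) by (auto simp: step_def)
  have "keys x \<subseteq> {1..N}" by (rule steps_keys[OF step.hyps(1) step.prems])
  then have u: "single u c \<in> polys {1..N}" by (intro polys_single) (simp add: * keys_add_nat)
  have "single u c * (single (expo a + expo b) 1 - single (expo (a - 1) + expo (b + 1)) 1) \<in> (spread_ideal :: 'k::field mpoly set)"
    using spread_binomialI[OF *(1)] spread_ideal(2) by (intro mpoly_ideal_mult[OF spread_ideal(1) u]) blast
  then have "single x c - single y c \<in> spread_ideal"
    by (simp add: * mult_single right_diff_distrib ac_simps)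
  then have "(single t c - single x c) + (single x c - single y c) \<in> spread_ideal"
    using step by (intro mpoly_ideal_add[OF spread_ideal(1)]) auto
  then show ?case by simp
qed

lemma diff_NF_mem:
  assumes "p \<in> polys {1..N}" shows "p - NF p \<in> spread_ideal"
proof (induction p rule: poly_induct_add)
  case (single t c)
  then have "keys t \<subseteq> {1..N}" using assms by (simp add: polys_def)
  then show ?case unfolding NF_single using nform(1) by (intro single_diff_steps_mem)
next
  case (add p q)
  then have "(p - NF p) + (q - NF q) \<in> spread_ideal" by (rule mpoly_ideal_add[OF spread_ideal(1)])
  then show ?case by (simp add: NF_add algebra_simps)
qed (use mpoly_ideal_zero[OF spread_ideal(1)] in simp)

text \<open>Every move changes a term by a multiple of a generator, so \<open>p - NF p\<close> is in the ideal; conversely the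
  kernel of \<open>NF\<close> is an ideal that contains the generators.\<close>
theorem mem_spread_ideal_iff:
  "p \<in> spread_ideal \<longleftrightarrow> p \<in> polys {1..N} \<and> NF p = 0" for p :: "'k::field mpoly"
proof
  assume "p \<in> polys {1..N} \<and> NF p = 0"
  then show "p \<in> spread_ideal" using diff_NF_mem[of p] by simp
next
  interpret cring "mpoly_ring N :: 'k mpoly ring" by (rule mpoly_ring_cring)
  have "spread_ideal \<subseteq> {p \<in> polys {1..N}. NF p = (0 :: 'k mpoly)}"
    unfolding spread_ideal_def
    by (rule genideal_minimal[OF NF_kernel_ideal])
       (use spread_binomials_polys spread_binomial_NF in \<open>auto simp: spread_binomials_def\<close>)
  then show "p \<in> spread_ideal \<Longrightarrow> p \<in> polys {1..N} \<and> NF p = 0" by blast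
qed

lemma lead_spread_binomial:
  assumes "Rd p q"
  shows "lead (spread_binomial p q :: 'k::field mpoly) = expo (p + 1) + expo (q - 1)"
    "(spread_binomial p q :: 'k::field mpoly) \<noteq> 0" "homogeneous 2 (spread_binomial p q :: 'k::field mpoly)"
proof -
  have pq: "1 \<le> p" "p + 2 \<le> q" "q \<le> N" using Rd_bounds[OF assms] by auto
  have "movable (p + 1) (q - 1)" using pq assms by (simp add: movable_def)
  then have "step (expo (p + 1) + expo (q - 1)) (expo p + expo q)"
    by (rule stepI[of _ _ _ 0]) (use pq in simp_all)
  then have less: "revlex_less (expo p + expo q) (expo (p + 1) + expo (q - 1))" by (rule step_revlex)
  then have ne: "expo p + expo q \<noteq> expo (p + 1) + expo (q - 1)" using revlex_irrefl by metis
  have "keys (spread_binomial p q :: 'k mpoly) \<subseteq> {expo (p + 1) + expo (q - 1), expo p + expo q}"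
    by (auto simp: spread_binomial_eq in_keys_iff lookup_minus lookup_single when_def split: if_splits)
  moreover have "expo (p + 1) + expo (q - 1) \<in> keys (spread_binomial p q :: 'k mpoly)"
    using ne by (auto simp: spread_binomial_eq in_keys_iff lookup_minus lookup_single when_def)
  ultimately show "lead (spread_binomial p q :: 'k mpoly) = expo (p + 1) + expo (q - 1)"
    "(spread_binomial p q :: 'k::field mpoly) \<noteq> 0" "homogeneous 2 (spread_binomial p q :: 'k::field mpoly)"
    using less by (auto intro!: lead_eqI simp: homogeneous_def)
qed

text \<open>If the leading monomial were standard, no other term could cancel it in \<open>NF p\<close>: normal forms of smaller
  monomials are smaller.\<close>
lemma lead_not_standard:
  assumes "p \<in> spread_ideal" "p \<noteq> (0 :: 'k::field mpoly)" shows "\<not> standard (lead p)"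
proof
  assume st: "standard (lead p)"
  have p: "p \<in> polys {1..N}" "NF p = 0" using assms(1) by (auto simp: mem_spread_ideal_iff)
  have k: "keys t \<subseteq> {1..N}" if "t \<in> keys p" for t using p that by (simp add: polys_def)
  have lk: "lead p \<in> keys p" by (rule lead_works(1)[OF assms(2)])
  have "nform t \<noteq> lead p" if "t \<in> keys p" "t \<noteq> lead p" for t
    using nform(4)[OF k[OF that(1)]] lead_works(2)[OF assms(2) that] revlex_trans revlex_irrefl that(2) by metis
  then have "lookup (NF p) (lead p) = (\<Sum>t\<in>keys p. if t = lead p then lookup p t else 0)"
    unfolding NF_def lookup_sum using nform_standard[OF k[OF lk] st]
    by (intro sum.cong) (auto simp: lookup_single when_def)
  also have "\<dots> = lookup p (lead p)" using lk by simp
  finally show False using p(2) lk by (simp add: in_keys_iff)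
qed

theorem spread_ideal_groebner:
  "groebner_basis revlex_less N (spread_ideal :: 'k::field mpoly set) spread_binomials"
proof -
  let ?R = "mpoly_ring N :: 'k mpoly ring"
  let ?B = "spread_binomials :: 'k mpoly set" and ?J = "spread_ideal :: 'k mpoly set"
  let ?L = "Idl\<^bsub>?R\<^esub> (initial_monomial revlex_less ` ?B)"
  interpret cring ?R by (rule mpoly_ring_cring)
  have "?B \<subseteq> (\<lambda>(p, q). spread_binomial p q) ` ({1..N} \<times> {1..N})"
    using Rd_bounds unfolding spread_binomials_def by fastforce
  then have fin: "finite ?B" by (rule finite_subset) simp
  have sub: "?B \<subseteq> ?J - {0}"
    using spread_ideal(2) lead_spread_binomial(2) by (auto simp: spread_binomials_def)
  have leads: "initial_monomial revlex_less ` (?J - {0}) \<subseteq> carrier ?R"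
  proof
    fix y assume "y \<in> initial_monomial revlex_less ` (?J - {0})"
    then obtain p where p: "p \<in> ?J" "p \<noteq> 0" "y = monomial (lead p)" by (auto simp: initial_monomial_lead)
    have "keys (lead p) \<subseteq> {1..N}"
      using p(1) lead_works(1)[OF p(2)] by (simp add: mem_spread_ideal_iff polys_def)
    then show "y \<in> carrier ?R" unfolding p(3) monomial_def mpoly_ring_simps by (rule polys_single)
  qed
  have leadsB: "initial_monomial revlex_less ` ?B \<subseteq> carrier ?R" using leads sub by blast
  have idB: "ideal (?L) ?R" by (rule genideal_ideal[OF leadsB])
  have "initial_monomial revlex_less ` (?J - {0}) \<subseteq> ?L"
  proof
    fix y assume "y \<in> initial_monomial revlex_less ` (?J - {0})"
    then obtain p where p: "p \<in> ?J" "p \<noteq> 0" "y = monomial (lead p)" by (auto simp: initial_monomial_lead)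
    have kp: "keys (lead p) \<subseteq> {1..N}"
      using p(1) lead_works(1)[OF p(2)] by (simp add: mem_spread_ideal_iff polys_def)
    obtain t' where "step (lead p) t'" using lead_not_standard[OF p(1,2)] by (auto simp: standard_def)
    then obtain b c u where *: "movable b c" "lead p = expo b + (expo c + u)" by (auto simp: step_def)
    have bc: "2 \<le> b" "b \<le> c" using movable_bounds[OF *(1)] by auto
    have rd: "Rd (b - 1) (c + 1)" using *(1) by (simp add: movable_def)
    have "single u 1 * monomial (expo b + expo c) \<in> ?L"
    proof (rule mpoly_ideal_mult[OF idB])
      show "single u (1 :: 'k) \<in> polys {1..N}" using kp by (intro polys_single) (simp add: * keys_add_nat)
      have "initial_monomial revlex_less (spread_binomial (b - 1) (c + 1) :: 'k mpoly) = monomial (expo b + expo c)"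
        unfolding initial_monomial_lead lead_spread_binomial(1)[OF rd] using bc by simp
      moreover have "initial_monomial revlex_less (spread_binomial (b - 1) (c + 1)) \<in> initial_monomial revlex_less ` ?B"
        unfolding spread_binomials_def using rd by blast
      ultimately have "monomial (expo b + expo c) \<in> initial_monomial revlex_less ` ?B" by simp
      then show "monomial (expo b + expo c) \<in> ?L"
        using genideal_self[OF leadsB] by blast
    qed
    then show "y \<in> ?L"
      unfolding p(3) *(2) by (simp add: monomial_def mult_single ac_simps)
  qed
  then have "initial_ideal revlex_less N ?J \<subseteq> ?L"
    unfolding initial_ideal_def by (rule genideal_minimal[OF idB])
  moreover have "?L \<subseteq> initial_ideal revlex_less N ?J"
    unfolding initial_ideal_def
    by (rule genideal_minimal[OF genideal_ideal[OF leads]]) (use sub genideal_self[OF leads] in blast)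
  ultimately show ?thesis unfolding groebner_basis_def using fin sub by blast
qed

lemma spread_ideal_quadratic_groebner:
  "has_quadratic_groebner_basis revlex_less N (spread_ideal :: 'k::field mpoly set)"
  unfolding has_quadratic_groebner_basis_def
  using spread_ideal_groebner lead_spread_binomial(3) unfolding spread_binomials_def by blast

text \<open>Repeated moves push an inner pair outwards until it reaches \<open>p, q\<close>; all moves on the way are available
  because \<open>Rd\<close> is closed under subintervals.\<close>
lemma steps_to_outer:
  assumes "Rd p q" "p \<le> a" "a \<le> b" "a + b = p + q"
  shows "step\<^sup>*\<^sup>* (expo a + expo b) (expo p + expo q)"
  using assms
proof (induction "a - p" arbitrary: a b)
  case 0
  then have "a = p" "b = q" by auto
  then show ?case by simp
next
  case (Suc d)
  have pq: "1 \<le> p" "p + 2 \<le> q" "q \<le> N" using Rd_bounds[OF Suc.prems(1)] by auto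
  have "Rd (a - 1) (b + 1)" using Suc by (intro Rd_sub[OF Suc.prems(1)]) auto
  then have "movable a b" using Suc pq by (simp add: movable_def)
  then have "step (expo a + expo b) (expo (a - 1) + expo (b + 1))" by (rule stepI[of _ _ _ 0]) auto
  moreover have "step\<^sup>*\<^sup>* (expo (a - 1) + expo (b + 1)) (expo p + expo q)"
    using Suc by (intro Suc.hyps(1)) auto
  ultimately show ?case by (rule converse_rtranclp_into_rtranclp)
qed

lemma outer_binomial_mem:
  assumes "Rd p q" "p \<le> a" "p \<le> b" "a + b = p + q"
  shows "mvar p * mvar q - mvar a * mvar b \<in> (spread_ideal :: 'k::field mpoly set)"
proof -
  have *: "mvar p * mvar q - mvar a * mvar b \<in> (spread_ideal :: 'k mpoly set)"
    if ab: "p \<le> a" "a \<le> b" "a + b = p + q" for a b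
  proof -
    have pq: "1 \<le> p" "p + 2 \<le> q" "q \<le> N" using Rd_bounds[OF assms(1)] by auto
    have "single (expo a + expo b) 1 - single (expo p + expo q) 1 \<in> (spread_ideal :: 'k mpoly set)"
      using pq ab by (intro single_diff_steps_mem steps_to_outer assms(1)) (auto simp: keys_add_nat)
    then have "mvar a * mvar b - mvar p * mvar q \<in> (spread_ideal :: 'k mpoly set)"
      by (simp add: mvar_def monomial_def mult_single)
    from mpoly_ideal_diff[OF spread_ideal(1) mpoly_ideal_zero[OF spread_ideal(1)] this]
    show ?thesis by simp
  qed
  show ?thesis
    using *[of a b] *[of b a] assms by (cases "a \<le> b") (auto simp: mult.commute add.commute)
qed

text \<open>This is the freeness of the quotient over \<open>K[x\<^sub>1, x\<^sub>N]\<close>: products of a monomial in \<open>x\<^sub>1, x\<^sub>N\<close> with a standard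
  monomial stay standard.\<close>
lemma NF_mult_ends:
  assumes f: "f \<in> polys {1, N}" and p: "p \<in> polys {1..N}" and N: "1 \<le> N"
  shows "NF (f * p) = f * NF p"
proof (induction f rule: poly_induct_add)
  case (single t c)
  then have t: "keys t \<subseteq> {1, N}" using f by (simp add: polys_def)
  then have t': "keys t \<subseteq> {1..N}" using N by auto
  show ?case
  proof (induction p rule: poly_induct_add)
    case (single s d)
    then have s: "keys s \<subseteq> {1..N}" using p by (simp add: polys_def)
    have "nform (t + s) = nform (t + nform s)" by (rule nform_add[OF s t'])
    also have "\<dots> = t + nform s"
      using standard_ends[OF nform(2)[OF s] t] nform(3)[OF s] t'
      by (intro nform_standard) (auto simp: keys_add_nat)
    finally show ?case by (simp add: NF_single mult_single)
  qed (simp_all add: NF_add distrib_left)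
qed (simp_all add: NF_add distrib_right)

end

section \<open>Expansion in one variable\<close>

lemma mvar_polys: "i \<in> V \<Longrightarrow> mvar i \<in> polys V"
  unfolding mvar_def monomial_def by (rule polys_single) simp

lemma mvar_power: "mvar i ^ k = single (single i k) 1"
  by (induction k) (simp_all add: mvar_def monomial_def mult_single single_add[symmetric])

lemma polys_insert_expansion:
  assumes "p \<in> polys (insert v T)"
  obtains d c where "\<And>k. c k \<in> polys T" "p = (\<Sum>k\<le>d. c k * mvar v ^ k)"
proof -
  have "\<exists>d c. (\<forall>k. c k \<in> polys T) \<and> p = (\<Sum>k\<le>d. c k * mvar v ^ k)"
  proof (induction p rule: poly_induct_add)
    case (single t a)
    then have t: "keys t \<subseteq> insert v T" using assms by (simp add: polys_def)
    define d where "d = lookup t v"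
    define s where "s = t - single v d"
    have ts: "t = s + single v d"
      by (rule poly_mapping_eqI) (simp add: s_def d_def lookup_add lookup_minus lookup_single when_def)
    have "keys s \<subseteq> keys t - {v}"
      by (auto simp: s_def d_def in_keys_iff lookup_minus lookup_single when_def)
    then have "keys s \<subseteq> T" using t by blast
    then have "\<forall>k. (if k = d then single s a else 0) \<in> polys T" by (simp add: polys_single polys_zero)
    moreover have "single t a = (\<Sum>k\<le>d. (if k = d then single s a else 0) * mvar v ^ k)"
      by (simp add: ts mvar_power mult_single if_distrib[of "\<lambda>x. x * _"] cong: if_cong)
    ultimately show ?case by (intro exI conjI)
  next
    case (add p q)
    then obtain d c d' c' where 1: "\<forall>k. c k \<in> polys T" "p = (\<Sum>k\<le>d. c k * mvar v ^ k)"
      "\<forall>k. c' k \<in> polys T" "q = (\<Sum>k\<le>d'. c' k * mvar v ^ k)" by blast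
    let ?c = "\<lambda>k. (if k \<le> d then c k else 0) + (if k \<le> d' then c' k else 0)"
    have pad: "(\<Sum>k\<le>e. f k * mvar v ^ k) = (\<Sum>k\<le>max d d'. (if k \<le> e then f k else 0) * mvar v ^ k)"
      if "e \<le> max d d'" for f and e :: nat
      using that by (intro sum.mono_neutral_cong_left) auto
    have "p + q = (\<Sum>k\<le>max d d'. ?c k * mvar v ^ k)"
      unfolding 1 pad[of d c, OF max.cobounded1] pad[of d' c', OF max.cobounded2]
      by (simp add: distrib_right sum.distrib)
    moreover have "\<forall>k. ?c k \<in> polys T" using 1 by (auto intro: polys_closed)
    ultimately show ?case by (intro exI[of _ "max d d'"] exI[of _ ?c] conjI)
  next
    case zero
    show ?case by (intro exI[of _ 0] exI[of _ "\<lambda>_. 0"]) (simp add: polys_zero)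
  qed
  then show thesis using that by blast
qed

section \<open>Zariski's lemma\<close>

text \<open>Maximality is stated as the existence of inverses modulo \<open>M\<close>, the form in which it passes from an ideal of a
  quotient ring to its preimage.\<close>
locale maximal_ideal_polys =
  fixes N :: nat and M :: "'k::field mpoly set"
  assumes M: "ideal M (mpoly_ring N)" and one: "1 \<notin> M"
    and inverse: "u \<in> polys {1..N} \<Longrightarrow> u \<notin> M \<Longrightarrow> \<exists>w\<in>polys {1..N}. u * w - 1 \<in> M"
begin

abbreviation "S \<equiv> polys {1..N} :: 'k mpoly set"

lemma M_zero: "0 \<in> M" and M_add: "a \<in> M \<Longrightarrow> b \<in> M \<Longrightarrow> a + b \<in> M"
  and M_mult: "x \<in> S \<Longrightarrow> a \<in> M \<Longrightarrow> x * a \<in> M" and M_diff: "a \<in> M \<Longrightarrow> b \<in> M \<Longrightarrow> a - b \<in> M"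
  by (fact mpoly_ideal_zero[OF M] mpoly_ideal_add[OF M] mpoly_ideal_mult[OF M]
      mpoly_ideal_diff[OF M])+

definition lspan :: "nat set \<Rightarrow> 'k mpoly set \<Rightarrow> 'k mpoly set" where
  "lspan T B = {\<Sum>b\<in>B. c b * b | c. \<forall>b\<in>B. c b \<in> polys T}"

lemma lspan_zero: "0 \<in> lspan T B"
  unfolding lspan_def by (intro CollectI exI[of _ "\<lambda>_. 0"]) (simp add: polys_zero)

lemma lspan_add: "p \<in> lspan T B \<Longrightarrow> q \<in> lspan T B \<Longrightarrow> p + q \<in> lspan T B"
proof -
  assume "p \<in> lspan T B" "q \<in> lspan T B"
  then obtain c c' where *: "p = (\<Sum>b\<in>B. c b * b)" "\<forall>b\<in>B. c b \<in> polys T"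
    "q = (\<Sum>b\<in>B. c' b * b)" "\<forall>b\<in>B. c' b \<in> polys T" unfolding lspan_def by blast
  show ?thesis unfolding lspan_def
    by (intro CollectI exI[of _ "\<lambda>b. c b + c' b"]) (simp add: * polys_add distrib_right sum.distrib)
qed

lemma lspan_mult: "a \<in> polys T \<Longrightarrow> p \<in> lspan T B \<Longrightarrow> a * p \<in> lspan T B"
proof -
  assume a: "a \<in> polys T" and "p \<in> lspan T B"
  then obtain c where *: "p = (\<Sum>b\<in>B. c b * b)" "\<forall>b\<in>B. c b \<in> polys T" unfolding lspan_def by blast
  show ?thesis unfolding lspan_def
    by (intro CollectI exI[of _ "\<lambda>b. a * c b"]) (simp add: * a polys_mult sum_distrib_left mult.assoc)
qed

lemma lspan_base: "finite B \<Longrightarrow> b \<in> B \<Longrightarrow> b \<in> lspan T B"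
  unfolding lspan_def
  by (intro CollectI exI[of _ "\<lambda>x. if x = b then 1 else 0"])
     (simp add: polys_zero polys_one if_distrib[of "\<lambda>x. x * _"] cong: if_cong)

text \<open>Let \<open>C = polys T\<close>, which embeds into the residue field. If the residue field were a finite module over
  \<open>C[1/eta]\<close>, every nonzero element of \<open>C\<close> would divide a product of a fixed element with a power of \<open>eta\<close>. This
  fails for \<open>1 + z\<close>, where \<open>z\<close> is a nonconstant multiple of all these denominators. Linear independence over \<open>C\<close>
  replaces the choice of a basis over the fraction field.\<close>
lemma not_almost_finite:
  assumes T: "T \<subseteq> {1..N}" "i \<in> T" and inj: "polys T \<inter> M \<subseteq> {0}"
    and B: "finite B" "1 \<in> B" "B \<subseteq> S" and eta: "eta \<in> polys T" "eta \<noteq> 0"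
    and fin: "\<And>p. p \<in> S \<Longrightarrow> \<exists>j. \<exists>q\<in>lspan T B. eta ^ j * p - q \<in> M"
  shows False
proof -
  have TS: "polys T \<subseteq> S" by (rule polys_mono[OF T(1)])
  define indep where "indep D \<longleftrightarrow> (\<forall>c. (\<forall>b\<in>D. c b \<in> polys T) \<longrightarrow> (\<Sum>b\<in>D. c b * b) \<in> M \<longrightarrow> (\<forall>b\<in>D. c b = 0))"
    for D
  define F where "F = {D. D \<subseteq> B \<and> 1 \<in> D \<and> indep D}"
  have "{1} \<in> F" using B inj by (auto simp: indep_def F_def)
  moreover have "finite F" using B by (simp add: F_def)
  ultimately obtain D where D': "D \<in> F" and "\<forall>D'\<in>F. D \<le> D' \<longrightarrow> D = D'"
    using finite_has_maximal[of F] by (metis empty_iff)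
  then have max: "D = D'" if "D' \<subseteq> B" "1 \<in> D'" "indep D'" "D \<subseteq> D'" for D'
    using that by (simp add: F_def)
  have D: "D \<subseteq> B" "1 \<in> D" "indep D" using D' by (simp_all add: F_def)
  have finD: "finite D" and DB: "D \<subseteq> B" and D1: "1 \<in> D" using D B finite_subset by auto
  have "\<exists>a\<in>polys T - {0}. \<exists>q\<in>lspan T D. a * b - q \<in> M" if b: "b \<in> B" for b
  proof (cases "b \<in> D")
    case True
    then show ?thesis
      using lspan_base[OF finD True] M_zero by (intro bexI[of _ 1] bexI[of _ b]) (auto simp: polys_one)
  next
    case False
    then have "\<not> indep (insert b D)" using max[of "insert b D"] D b by blast
    then obtain c where c: "\<forall>x\<in>insert b D. c x \<in> polys T" "(\<Sum>x\<in>insert b D. c x * x) \<in> M" "\<exists>x\<in>insert b D. c x \<noteq> 0"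
      unfolding indep_def by blast
    have eq: "(\<Sum>x\<in>insert b D. c x * x) = c b * b + (\<Sum>x\<in>D. c x * x)" using finD False by simp
    have "c b \<noteq> 0"
    proof
      assume "c b = 0"
      then have "(\<Sum>x\<in>D. c x * x) \<in> M" using c(2) eq by simp
      then have "\<forall>x\<in>D. c x = 0" using D c(1) by (auto simp: indep_def)
      then show False using c(3) \<open>c b = 0\<close> by auto
    qed
    moreover have "(\<Sum>x\<in>D. (- c x) * x) \<in> lspan T D"
      unfolding lspan_def using c(1) by (intro CollectI exI[of _ "\<lambda>x. - c x"]) (auto intro: polys_uminus)
    ultimately show ?thesis
      using c(1,2) unfolding eq
      by (intro bexI[of _ "c b"] bexI[of _ "\<Sum>x\<in>D. (- c x) * x"]) (simp_all add: sum_negf)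
  qed
  then obtain \<delta> Q where \<delta>: "\<And>b. b \<in> B \<Longrightarrow> \<delta> b \<in> polys T" "\<And>b. b \<in> B \<Longrightarrow> \<delta> b \<noteq> 0"
    "\<And>b. b \<in> B \<Longrightarrow> Q b \<in> lspan T D" "\<And>b. b \<in> B \<Longrightarrow> \<delta> b * b - Q b \<in> M"
    by (metis DiffE insertCI)
  define d where "d = (\<Prod>b\<in>B. \<delta> b)"
  have prod_polys: "(\<Prod>b\<in>A. \<delta> b) \<in> polys T" if "A \<subseteq> B" for A
    using that by (induction A rule: infinite_finite_induct) (auto intro: polys_one polys_mult \<delta>)
  have d: "d \<in> polys T" "d \<noteq> 0" using prod_polys[of B] \<delta>(2) B by (auto simp: d_def)
  have dB: "\<exists>q\<in>lspan T D. d * b - q \<in> M" if b: "b \<in> B" for b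
  proof -
    let ?r = "\<Prod>b\<in>B - {b}. \<delta> b"
    have d_eq: "d = ?r * \<delta> b" unfolding d_def using prod.remove[OF B(1) b, of \<delta>] by (simp add: mult.commute)
    have r: "?r \<in> polys T" by (rule prod_polys) auto
    have "?r * (\<delta> b * b - Q b) \<in> M" by (rule M_mult) (use r TS \<delta>(4)[OF b] in auto)
    then have "d * b - ?r * Q b \<in> M" unfolding d_eq by (simp add: algebra_simps)
    then show ?thesis using lspan_mult[OF r \<delta>(3)[OF b]] by blast
  qed
  have dspan: "\<exists>q'\<in>lspan T D. d * q - q' \<in> M" if "q \<in> lspan T B" for q
  proof -
    obtain c where c: "q = (\<Sum>b\<in>B. c b * b)" "\<forall>b\<in>B. c b \<in> polys T" using \<open>q \<in> lspan T B\<close> unfolding lspan_def by blast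
    have "\<exists>q'\<in>lspan T D. d * (\<Sum>b\<in>A. c b * b) - q' \<in> M" if "finite A" "A \<subseteq> B" for A
      using that
    proof (induction A rule: finite_induct)
      case empty
      show ?case using lspan_zero M_zero by (intro bexI[of _ 0]) auto
    next
      case (insert b A)
      then obtain q1 where q1: "q1 \<in> lspan T D" "d * (\<Sum>b\<in>A. c b * b) - q1 \<in> M" by auto
      obtain q2 where q2: "q2 \<in> lspan T D" "d * b - q2 \<in> M" using dB insert.prems by auto
      have cb: "c b \<in> polys T" using c insert.prems by auto
      have "(d * (\<Sum>b\<in>A. c b * b) - q1) + c b * (d * b - q2) \<in> M"
        using cb TS q1 q2 by (intro M_add M_mult) auto
      then have "d * (\<Sum>b\<in>insert b A. c b * b) - (q1 + c b * q2) \<in> M"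
        using insert.hyps by (simp add: algebra_simps)
      then show ?case using lspan_add[OF q1(1) lspan_mult[OF cb q2(1)]] by blast
    qed
    from this[OF B(1)] show ?thesis using c by simp
  qed
  \<comment> \<open>The factor x_i makes z nonconstant even if d and eta are constants.\<close>
  define z where "z = mvar i * (d * eta)"
  have zT: "z \<in> polys T" unfolding z_def using d eta T by (intro polys_mult mvar_polys) auto
  have mv: "mvar i \<noteq> (0 :: 'k mpoly)" by (simp add: mvar_def monomial_def single_eq_0_iff)
  have z0: "z \<noteq> 0" unfolding z_def using d eta mv by simp
  have lead_mv: "lead (mvar i :: 'k mpoly) = single i 1"
    by (rule lead_eqI) (auto simp: mvar_def monomial_def)
  have "lead z = single i 1 + lead (d * eta)"
    unfolding z_def using lead_mult[of "mvar i" "d * eta"] mv lead_mv d eta by simp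
  then have "mon_degree (lead z) \<noteq> 0" by simp
  then have zl: "lead z \<noteq> 0" by auto
  \<comment> \<open>The inverse of u modulo M is almost a combination of the elements of D; comparing the coefficients of 1 shows that u
    divides d * eta ^ j, hence a power of z.\<close>
  define u where "u = 1 + z"
  have uT: "u \<in> polys T" unfolding u_def by (intro polys_add polys_one zT)
  have "u \<noteq> 0" unfolding u_def
  proof (intro notI)
    assume "1 + z = 0"
    then have "z = - 1" by (simp add: eq_neg_iff_add_eq_0 add.commute)
    then have "z dvd 1" by (metis dvd_minus_iff dvd_refl minus_dvd_iff)
    then show False using unit_mpoly_lead zl by blast
  qed
  then have "u \<notin> M" using inj uT by blast
  then obtain w where w: "w \<in> S" "u * w - 1 \<in> M" using inverse uT TS by blast
  obtain j q where q: "q \<in> lspan T B" "eta ^ j * w - q \<in> M" using fin[OF w(1)] by blast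
  obtain q' where q': "q' \<in> lspan T D" "d * q - q' \<in> M" using dspan[OF q(1)] by blast
  obtain c where c: "q' = (\<Sum>b\<in>D. c b * b)" "\<forall>b\<in>D. c b \<in> polys T" using q'(1) unfolding lspan_def by blast
  have mem: "d * eta ^ j \<in> S" "u * d \<in> S" "u \<in> S"
    using d eta uT TS by (auto intro!: polys_closed)
  have "u * (d * q - q') + (u * d) * (eta ^ j * w - q) - (d * eta ^ j) * (u * w - 1) \<in> M"
    by (rule M_diff[OF M_add[OF M_mult[OF mem(3) q'(2)] M_mult[OF mem(2) q(2)]] M_mult[OF mem(1) w(2)]])
  then have m: "d * eta ^ j - u * q' \<in> M" by (simp add: algebra_simps)
  define g where "g b = (if b = 1 then d * eta ^ j else 0) - u * c b" for b
  have "(\<Sum>b\<in>D. g b * b) = d * eta ^ j - u * q'"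
    unfolding c(1) g_def using finD D1
    by (simp add: left_diff_distrib sum_subtractf sum_distrib_left mult.assoc if_distrib[of "\<lambda>x. x * _"] cong: if_cong)
  then have "(\<Sum>b\<in>D. g b * b) \<in> M" using m by simp
  moreover have "\<forall>b\<in>D. g b \<in> polys T" using c(2) uT d eta by (auto intro!: polys_closed simp: g_def)
  ultimately have "g 1 = 0" using D(3) D1 unfolding indep_def by blast
  then have "d * eta ^ j = u * c 1" by (simp add: g_def)
  then have "u dvd d * eta ^ j" by simp
  moreover have "d * eta ^ j dvd z ^ Suc j"
  proof -
    have "z ^ Suc j = (d * eta ^ j) * (mvar i ^ Suc j * d ^ j * eta)"
      unfolding z_def by (simp add: power_mult_distrib algebra_simps)
    then show ?thesis by simp
  qed
  ultimately have "u dvd z ^ Suc j" by (rule dvd_trans)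
  then show False using not_dvd_power_pred[OF z0 zl] unfolding u_def by blast
qed

text \<open>A nonzero member of \<open>M\<close> in one more variable, expanded in powers of that variable; the exponent
  \<open>d\<close> is positive because \<open>M\<close> has no nonzero member without the variable.\<close>
lemma algebraic_relation:
  assumes T: "T \<subseteq> {1..N}" and inj: "polys T \<inter> M \<subseteq> {0}" and dep: "\<not> polys (insert v T) \<inter> M \<subseteq> {0}"
  obtains d c where "1 \<le> d" "\<forall>k. c k \<in> polys T" "c d \<noteq> 0" "(\<Sum>k\<le>d. c k * mvar v ^ k) \<in> M"
proof -
  obtain p where p: "p \<in> polys (insert v T)" "p \<in> M" "p \<noteq> 0" using dep by blast
  obtain e c where c: "\<And>k. c k \<in> polys T" "p = (\<Sum>k\<le>e. c k * mvar v ^ k)"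
    using polys_insert_expansion[OF p(1)] by blast
  define K where "K = {k. k \<le> e \<and> c k \<noteq> 0}"
  have K: "finite K" "K \<noteq> {}" using c(2) p(3) by (auto simp: K_def intro!: sum.neutral)
  define d where "d = Max K"
  have d: "d \<le> e" "c d \<noteq> 0" using Max_in[OF K] by (auto simp: d_def K_def)
  have top: "c k = 0" if "k \<le> e" "d < k" for k
  proof (rule ccontr)
    assume "c k \<noteq> 0"
    then have "k \<in> K" using that(1) by (simp add: K_def)
    then show False using Max_ge[OF K(1), of k] that(2) by (simp add: d_def)
  qed
  have pd: "p = (\<Sum>k\<le>d. c k * mvar v ^ k)"
    unfolding c(2) using d(1) top by (intro sum.mono_neutral_right) auto
  have "d \<noteq> 0"
  proof
    assume "d = 0"
    then have "p = c 0" using pd by simp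
    then show False using inj c(1) p by blast
  qed
  then show thesis using that[of d c] c(1) d(2) p(2) pd by simp
qed

text \<open>Otherwise \<open>x\<^sub>i\<close> belongs to a maximal set \<open>T\<close> of variables that are algebraically independent modulo \<open>M\<close>. Every other
  variable then satisfies an equation over \<open>polys T\<close>, and after inverting the product \<open>eta\<close> of the leading
  coefficients these equations reduce all monomials to the finitely many with small exponents, contrary to
  \<open>not_almost_finite\<close>.\<close>
theorem ex_univariate_member:
  assumes i: "i \<in> {1..N}" obtains f where "f \<in> polys {i}" "f \<in> M" "f \<noteq> 0"
proof (rule ccontr)
  assume no: "\<not> thesis"
  define F where "F = {T. T \<subseteq> {1..N} \<and> i \<in> T \<and> polys T \<inter> M \<subseteq> {0}}"
  have "{i} \<in> F" using no that i by (auto simp: F_def)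
  moreover have "finite F" by (simp add: F_def)
  ultimately obtain T where "T \<in> F" and max: "\<forall>T'\<in>F. T \<le> T' \<longrightarrow> T = T'"
    using finite_has_maximal[of F] by (metis empty_iff)
  then have T: "T \<subseteq> {1..N}" "i \<in> T" "polys T \<inter> M \<subseteq> {0}" by (simp_all add: F_def)
  define W where "W = {1..N} - T"
  have finW: "finite W" by (simp add: W_def)
  have dep: "\<not> polys (insert v T) \<inter> M \<subseteq> {0}" if "v \<in> W" for v
  proof
    assume "polys (insert v T) \<inter> M \<subseteq> {0}"
    then have "insert v T \<in> F" using T that by (auto simp: F_def W_def)
    then have "T = insert v T" using max by blast
    then show False using that by (auto simp: W_def)
  qed
  have "\<forall>v\<in>W. \<exists>d c. 1 \<le> d \<and> (\<forall>k. c k \<in> polys T) \<and> c d \<noteq> 0 \<and> (\<Sum>k\<le>d. c k * mvar v ^ k) \<in> M"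
  proof
    fix v assume v: "v \<in> W"
    obtain d c where "1 \<le> d" "\<forall>k. c k \<in> polys T" "c d \<noteq> 0" "(\<Sum>k\<le>d. c k * mvar v ^ k) \<in> M"
      using algebraic_relation[OF T(1,3) dep[OF v]] .
    then show "\<exists>d c. 1 \<le> d \<and> (\<forall>k. c k \<in> polys T) \<and> c d \<noteq> 0 \<and> (\<Sum>k\<le>d. c k * mvar v ^ k) \<in> M"
      by blast
  qed
  from bchoice[OF this] obtain d where "\<forall>v\<in>W. \<exists>c. 1 \<le> d v \<and> (\<forall>k. c k \<in> polys T) \<and> c (d v) \<noteq> 0 \<and>
      (\<Sum>k\<le>d v. c k * mvar v ^ k) \<in> M" ..
  from bchoice[OF this] obtain c where *: "\<forall>v\<in>W. 1 \<le> d v \<and> (\<forall>k. c v k \<in> polys T) \<and> c v (d v) \<noteq> 0 \<and>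
      (\<Sum>k\<le>d v. c v k * mvar v ^ k) \<in> M" ..
  have dc: "\<And>v. v \<in> W \<Longrightarrow> 1 \<le> d v" "\<And>v k. v \<in> W \<Longrightarrow> c v k \<in> polys T"
    "\<And>v. v \<in> W \<Longrightarrow> c v (d v) \<noteq> 0" "\<And>v. v \<in> W \<Longrightarrow> (\<Sum>k\<le>d v. c v k * mvar v ^ k) \<in> M"
    using * by blast+
  define eta where "eta = (\<Prod>v\<in>W. c v (d v))"
  have prod_polys: "(\<Prod>v\<in>A. c v (d v)) \<in> polys T" if "A \<subseteq> W" for A
    using that by (induction A rule: infinite_finite_induct) (auto intro: polys_one polys_mult dc(2))
  have eta: "eta \<in> polys T" "eta \<noteq> 0" using prod_polys[of W] dc(3) finW by (auto simp: eta_def)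
  have TS: "polys T \<subseteq> S" by (rule polys_mono[OF T(1)])
  \<comment> \<open>The exponents that cannot be reduced by any of the equations.\<close>
  define E where "E = {t. keys t \<subseteq> W \<and> (\<forall>v\<in>W. lookup t v < d v)}"
  define B :: "'k mpoly set" where "B = (\<lambda>t. single t 1) ` E"
  have "E \<subseteq> {t. keys t \<subseteq> {1..N} \<and> mon_degree t \<le> (\<Sum>v\<in>W. d v)}"
  proof
    fix t assume t: "t \<in> E"
    then have "mon_degree t = (\<Sum>v\<in>W. lookup t v)" using finW by (intro mon_degree_eq_sum) (auto simp: E_def)
    also have "\<dots> \<le> (\<Sum>v\<in>W. d v)" using t by (intro sum_mono) (simp add: E_def less_imp_le)
    finally show "t \<in> {t. keys t \<subseteq> {1..N} \<and> mon_degree t \<le> (\<Sum>v\<in>W. d v)}"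
      using t by (auto simp: E_def W_def)
  qed
  then have "finite E" using finite_monomials_degree_le finite_subset by blast
  then have finB: "finite B" by (simp add: B_def)
  have "0 \<in> E" using dc(1) by (fastforce simp: E_def)
  then have B1: "1 \<in> B" unfolding B_def by (metis image_eqI single_one)
  have BS: "B \<subseteq> S" unfolding B_def E_def W_def by (auto intro!: polys_single)
  \<comment> \<open>A is closed under sums and under multiplication by every variable, so it is all of S.\<close>
  define A where "A = {p \<in> S. \<exists>j. \<exists>q\<in>lspan T B. eta ^ j * p - q \<in> M}"
  have AI: "p \<in> A" if "p \<in> S" "q \<in> lspan T B" "eta ^ j * p - q \<in> M" for p q j
    using that by (auto simp: A_def)
  have AE: "p \<in> S \<and> (\<exists>j. \<exists>q\<in>lspan T B. eta ^ j * p - q \<in> M)" if "p \<in> A" for p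
    using that by (simp add: A_def)
  have A_zero: "0 \<in> A" by (rule AI[of 0 0 0]) (simp_all add: lspan_zero M_zero polys_zero)
  have etaS: "eta ^ j \<in> S" "eta ^ j \<in> polys T" for j using eta TS by (auto intro: polys_power)
  have A_add: "p + p' \<in> A" if pA: "p \<in> A" "p' \<in> A" for p p'
  proof -
    obtain j q j' q' where *: "p \<in> S" "p' \<in> S" "q \<in> lspan T B" "eta ^ j * p - q \<in> M"
      "q' \<in> lspan T B" "eta ^ j' * p' - q' \<in> M"
      using AE[OF pA(1)] AE[OF pA(2)] by blast
    have "eta ^ j' * (eta ^ j * p - q) + eta ^ j * (eta ^ j' * p' - q') \<in> M"
      by (rule M_add[OF M_mult[OF etaS(1) *(4)] M_mult[OF etaS(1) *(6)]])
    then have "eta ^ (j + j') * (p + p') - (eta ^ j' * q + eta ^ j * q') \<in> M"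
      by (simp add: power_add algebra_simps)
    then show ?thesis
      by (rule AI[OF polys_add[OF *(1,2)] lspan_add[OF lspan_mult[OF etaS(2) *(3)] lspan_mult[OF etaS(2) *(5)]]])
  qed
  have A_mult: "a * p \<in> A" if a: "a \<in> polys T" and p: "p \<in> A" for a p
  proof -
    obtain j q where *: "p \<in> S" "q \<in> lspan T B" "eta ^ j * p - q \<in> M" using AE[OF p] by blast
    have aS: "a \<in> S" using a TS by blast
    have "a * (eta ^ j * p - q) \<in> M" by (rule M_mult[OF aS *(3)])
    then have "eta ^ j * (a * p) - a * q \<in> M" by (simp add: algebra_simps)
    then show ?thesis by (rule AI[OF polys_mult[OF aS *(1)] lspan_mult[OF a *(2)]])
  qed
  have A_cong: "p \<in> A" if p: "p \<in> S" and q: "q \<in> A" "eta ^ j * p - q \<in> M" for p q j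
  proof -
    obtain k r where *: "r \<in> lspan T B" "eta ^ k * q - r \<in> M" using AE[OF q(1)] by blast
    have "eta ^ k * (eta ^ j * p - q) + (eta ^ k * q - r) \<in> M"
      by (rule M_add[OF M_mult[OF etaS(1) q(2)] *(2)])
    then have "eta ^ (k + j) * p - r \<in> M" by (simp add: power_add algebra_simps)
    then show ?thesis by (rule AI[OF p *(1)])
  qed
  have A_B: "b \<in> A" if "b \<in> B" for b
    using AI[of b b 0] that BS lspan_base[OF finB that] M_zero by auto
  have A_sum: "sum f I \<in> A" if "\<And>i. i \<in> I \<Longrightarrow> f i \<in> A" for f :: "nat \<Rightarrow> 'k mpoly" and I
    using that by (induction I rule: infinite_finite_induct) (auto intro: A_zero A_add)
  have A_sumB: "sum f I \<in> A" if "\<And>i. i \<in> I \<Longrightarrow> f i \<in> A" for f :: "'k mpoly \<Rightarrow> 'k mpoly" and I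
    using that by (induction I rule: infinite_finite_induct) (auto intro: A_zero A_add)
  have mvB: "mvar v * b \<in> A" if v: "v \<in> W" and b: "b \<in> B" for v b
  proof -
    obtain t where t: "t \<in> E" "b = single t 1" using b by (auto simp: B_def)
    have vb: "mvar v * b = single (single v 1 + t) 1" by (simp add: t mvar_def monomial_def mult_single)
    have vS: "mvar v * b \<in> S"
      using v b BS by (intro polys_mult mvar_polys) (auto simp: W_def)
    show ?thesis
    proof (cases "Suc (lookup t v) < d v")
      case True
      have "single v 1 + t \<in> E"
        using t v True by (auto simp: E_def keys_add_nat lookup_add lookup_single when_def)
      then show ?thesis unfolding vb by (intro A_B) (simp add: B_def)
    next
      case False
      then have dv: "d v = Suc (lookup t v)" using t v by (auto simp: E_def)
      define s where "s = t - single v (lookup t v)"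
      have ts: "t = s + single v (lookup t v)"
        by (rule poly_mapping_eqI) (simp add: s_def lookup_add lookup_minus lookup_single when_def)
      have sE: "s + single v k \<in> E" if "k < d v" for k
      proof -
        have "keys (s + single v k) \<subseteq> insert v (keys t)"
          by (auto simp: s_def in_keys_iff lookup_add lookup_minus lookup_single when_def split: if_splits)
        then have "keys (s + single v k) \<subseteq> W" using t v by (auto simp: E_def)
        moreover have "lookup (s + single v k) x < d x" if "x \<in> W" for x
          using that \<open>k < d v\<close> t by (auto simp: E_def s_def lookup_add lookup_minus lookup_single when_def)
        ultimately show ?thesis by (simp add: E_def)
      qed
      have sS: "single s 1 \<in> S"
        using sE[of 0] dv by (intro polys_single) (auto simp: E_def W_def)
      have vb': "mvar v * b = mvar v ^ d v * single s 1"
        unfolding vb mvar_power dv by (subst ts) (simp add: mult_single ac_simps single_add[symmetric])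
      let ?r = "\<Prod>v\<in>W - {v}. c v (d v)"
      have rT: "?r \<in> polys T" by (rule prod_polys) auto
      have eta_eq: "eta = c v (d v) * ?r" unfolding eta_def by (rule prod.remove[OF finW v])
      let ?q = "\<Sum>k<d v. (- ?r * c v k) * (mvar v ^ k * single s 1)"
      have "?q \<in> A"
      proof (rule A_sum)
        fix k assume "k \<in> {..<d v}"
        then have "mvar v ^ k * single s 1 \<in> B"
          unfolding B_def mvar_power using sE[of k] by (auto simp: mult_single add.commute)
        then show "(- ?r * c v k) * (mvar v ^ k * single s 1) \<in> A"
          using rT dc(2)[OF v] by (intro A_mult A_B polys_mult polys_uminus)
      qed
      moreover have "eta ^ 1 * (mvar v * b) - ?q \<in> M"
      proof -
        have "(?r * single s 1) * (\<Sum>k\<le>d v. c v k * mvar v ^ k) \<in> M"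
          by (rule M_mult[OF polys_mult[OF subsetD[OF TS rT] sS] dc(4)[OF v]])
        moreover have "(?r * single s 1) * (\<Sum>k\<le>d v. c v k * mvar v ^ k) = eta ^ 1 * (mvar v * b) - ?q"
          unfolding vb' eta_eq lessThan_Suc_atMost[symmetric] sum.lessThan_Suc
          by (simp add: sum_distrib_left sum_negf algebra_simps)
        ultimately show ?thesis by simp
      qed
      ultimately show ?thesis by (rule A_cong[OF vS])
    qed
  qed
  have A_var: "mvar v * p \<in> A" if v: "v \<in> {1..N}" and p: "p \<in> A" for v p
  proof (cases "v \<in> T")
    case True
    then show ?thesis by (intro A_mult mvar_polys p)
  next
    case False
    then have vW: "v \<in> W" using v by (simp add: W_def)
    obtain j q where *: "p \<in> S" "q \<in> lspan T B" "eta ^ j * p - q \<in> M" using AE[OF p] by blast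
    obtain a where a: "q = (\<Sum>b\<in>B. a b * b)" "\<forall>b\<in>B. a b \<in> polys T" using *(2) unfolding lspan_def by blast
    have vS: "mvar v \<in> S" using v by (rule mvar_polys)
    have "mvar v * q = (\<Sum>b\<in>B. a b * (mvar v * b))" unfolding a by (simp add: sum_distrib_left ac_simps)
    then have "mvar v * q \<in> A" using a(2) mvB[OF vW] A_mult by (simp add: A_sumB)
    moreover have "mvar v * (eta ^ j * p - q) \<in> M" by (rule M_mult[OF vS *(3)])
    then have "eta ^ j * (mvar v * p) - mvar v * q \<in> M" by (simp add: algebra_simps)
    ultimately show ?thesis by (rule A_cong[OF polys_mult[OF vS *(1)]])
  qed
  have A_mon: "single t 1 \<in> A" if "keys t \<subseteq> {1..N}" for t
    using that
  proof (induction "mon_degree t" arbitrary: t)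
    case 0
    then have "t = 0" using lookup_le_mon_degree[of t] by (intro poly_mapping_eqI) auto
    then show ?case using A_B[OF B1] by simp
  next
    case (Suc n)
    then have "t \<noteq> 0" by auto
    then obtain v where v: "v \<in> keys t" by (metis ex_in_conv keys_eq_empty)
    define s where "s = t - single v 1"
    have ts: "t = single v 1 + s"
      by (rule poly_mapping_eqI) (use v in \<open>auto simp: s_def in_keys_iff lookup_add lookup_minus lookup_single when_def\<close>)
    have "mon_degree t = Suc (mon_degree s)" by (simp add: ts)
    moreover have "keys s \<subseteq> {1..N}" using Suc.prems by (simp add: ts keys_add_nat)
    ultimately have "single s 1 \<in> A" using Suc by simp
    then have "mvar v * single s 1 \<in> A" using v Suc.prems by (intro A_var) auto
    then show ?case by (simp add: ts mvar_def monomial_def mult_single)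
  qed
  have "p \<in> A" if "p \<in> S" for p
  proof (induction p rule: poly_induct_add)
    case (single t a)
    then have "single 0 a * single t 1 \<in> A"
      using \<open>p \<in> S\<close> by (intro A_mult A_mon polys_single) (auto simp: polys_def)
    then show ?case by (simp add: mult_single)
  qed (auto intro: A_add A_zero)
  then have "\<exists>j. \<exists>q\<in>lspan T B. eta ^ j * p - q \<in> M" if "p \<in> S" for p using AE that by blast
  then show False by (rule not_almost_finite[OF T(1,2,3) finB B1 BS eta])
qed

end

section \<open>Growth bounds the dimension\<close>

text \<open>More unknowns than equations; one step of Gaussian elimination in the induction.\<close>
lemma homogeneous_system_nontrivial:
  fixes v :: "'x \<Rightarrow> 'y \<Rightarrow> 'k::field"
  assumes "finite Y" "finite U" "card Y < card U"
  shows "\<exists>c. (\<exists>x\<in>U. c x \<noteq> 0) \<and> (\<forall>y\<in>Y. (\<Sum>x\<in>U. c x * v x y) = 0)"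
  using assms
proof (induction Y arbitrary: U v rule: finite_induct)
  case empty
  then have "U \<noteq> {}" by auto
  then show ?case by (intro exI[of _ "\<lambda>_. 1"]) auto
next
  case (insert y Y)
  show ?case
  proof (cases "\<forall>x\<in>U. v x y = 0")
    case True
    have "card Y < card U" using insert.hyps insert.prems(2) by simp
    from insert.IH[OF insert.prems(1) this, of v]
    obtain c where "\<exists>x\<in>U. c x \<noteq> 0" "\<forall>y\<in>Y. (\<Sum>x\<in>U. c x * v x y) = 0" by blast
    then show ?thesis using True by (intro exI[of _ c]) simp
  next
    case False
    then obtain x0 where x0: "x0 \<in> U" "v x0 y \<noteq> 0" by blast
    define w where "w x y' = v x y' - v x y / v x0 y * v x0 y'" for x y'
    have "card Y < card (U - {x0})" using insert.hyps insert.prems x0 by simp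
    from insert.IH[OF _ this, of w] insert.prems(1)
    obtain c where c: "\<exists>x\<in>U - {x0}. c x \<noteq> 0" "\<forall>y'\<in>Y. (\<Sum>x\<in>U - {x0}. c x * w x y') = 0" by auto
    \<comment> \<open>The eliminated unknown is determined by equation y.\<close>
    define c' where "c' x = (if x = x0 then - (\<Sum>x\<in>U - {x0}. c x * (v x y / v x0 y)) else c x)" for x
    have "(\<Sum>x\<in>U. c' x * v x y') = (\<Sum>x\<in>U - {x0}. c x * w x y')" for y'
    proof -
      have "(\<Sum>x\<in>U. c' x * v x y') = c' x0 * v x0 y' + (\<Sum>x\<in>U - {x0}. c' x * v x y')"
        by (rule sum.remove[OF insert.prems(1) x0(1)])
      also have "(\<Sum>x\<in>U - {x0}. c' x * v x y') = (\<Sum>x\<in>U - {x0}. c x * v x y')"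
        by (intro sum.cong) (auto simp: c'_def)
      also have "c' x0 * v x0 y' + (\<Sum>x\<in>U - {x0}. c x * v x y') = (\<Sum>x\<in>U - {x0}. c x * w x y')"
        by (simp add: c'_def w_def right_diff_distrib sum_subtractf sum_distrib_right mult.assoc)
      finally show ?thesis .
    qed
    \<comment> \<open>In the modified system the unknown x0 no longer occurs.\<close>
    note sum_c' = this
    have "(\<Sum>x\<in>U. c' x * v x y') = 0" if "y' \<in> insert y Y" for y'
    proof (cases "y' = y")
      case True
      have "w x y = 0" for x using x0 by (simp add: w_def)
      then show ?thesis unfolding sum_c' True by simp
    next
      case False
      then show ?thesis unfolding sum_c' using c(2) that by blast
    qed
    moreover have "\<exists>x\<in>U. c' x \<noteq> 0" using c(1) by (auto simp: c'_def)
    ultimately show ?thesis by blast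
  qed
qed

definition lin_indep_mod :: "'k::field mpoly set \<Rightarrow> ('x \<Rightarrow> 'k mpoly) \<Rightarrow> 'x set \<Rightarrow> bool" where
  "lin_indep_mod P w U \<longleftrightarrow> (\<forall>c. (\<Sum>x\<in>U. single 0 (c x) * w x) \<in> P \<longrightarrow> (\<forall>x\<in>U. c x = 0))"

lemma
  assumes "primeideal P (mpoly_ring N :: 'k::field mpoly ring)"
  shows mpoly_prime_ideal: "ideal P (mpoly_ring N)"
    and mpoly_primeD: "a \<in> polys {1..N} \<Longrightarrow> b \<in> polys {1..N} \<Longrightarrow> a * b \<in> P \<Longrightarrow> a \<in> P \<or> b \<in> P"
    and mpoly_prime_one: "1 \<notin> P"
    and mpoly_prime_power: "a \<in> polys {1..N} \<Longrightarrow> a \<notin> P \<Longrightarrow> a ^ n \<notin> P"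
proof -
  interpret primeideal P "mpoly_ring N :: 'k mpoly ring" by fact
  show "ideal P (mpoly_ring N)" by (rule ideal_axioms)
  show prime: "a \<in> P \<or> b \<in> P" if "a \<in> polys {1..N}" "b \<in> polys {1..N}" "a * b \<in> P" for a b
    using I_prime[of a b] that by (simp add: mpoly_ring_simps)
  show one: "1 \<notin> P"
    using one_imp_carrier I_notcarr by (auto simp: mpoly_ring_simps)
  show "a ^ n \<notin> P" if a: "a \<in> polys {1..N}" "a \<notin> P"
  proof (induction n)
    case (Suc n)
    then show ?case using prime[OF a(1) polys_power[OF a(1)]] a(2) by auto
  qed (use one in simp)
qed

lemma lin_indep_mod_one:
  assumes "primeideal P (mpoly_ring N :: 'k::field mpoly ring)"
  shows "lin_indep_mod P (\<lambda>_. 1) {()}"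
  unfolding lin_indep_mod_def
proof (intro allI impI ballI)
  fix c :: "unit \<Rightarrow> 'k" and x assume s: "(\<Sum>x\<in>{()}. single 0 (c x) * 1) \<in> P"
  show "c x = 0"
  proof (rule ccontr)
    assume "c x \<noteq> 0"
    then have "single 0 (1 / c x) * single 0 (c x) = (1 :: 'k mpoly)" by (simp add: mult_single)
    moreover have "single 0 (1 / c x) * single 0 (c x) \<in> P"
      using s by (intro mpoly_ideal_mult[OF mpoly_prime_ideal[OF assms]] polys_single) (auto simp: unit_eq)
    ultimately show False using mpoly_prime_one[OF assms] by simp
  qed
qed

text \<open>Going down from \<open>Q\<close> to a smaller prime \<open>P\<close> adds one algebraically independent element: in a relation modulo
  \<open>P\<close> the lowest power of \<open>z\<close> can be cancelled, and modulo \<open>Q\<close> only its coefficient is left.\<close>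
lemma lin_indep_mod_powers:
  assumes P: "primeideal P (mpoly_ring N :: 'k::field mpoly ring)" and Q: "ideal Q (mpoly_ring N)" "P \<subseteq> Q"
    and z: "z \<in> Q" "z \<notin> P" and w: "\<And>x. x \<in> U \<Longrightarrow> w x \<in> polys {1..N}" and U: "finite U"
    and ind: "lin_indep_mod Q w U"
  shows "lin_indep_mod P (\<lambda>(i, x). z ^ i * w x) ({..d::nat} \<times> U)"
  unfolding lin_indep_mod_def
proof (intro allI impI, rule ccontr)
  fix c assume s: "(\<Sum>y\<in>{..d} \<times> U. single 0 (c y) * (case y of (i, x) \<Rightarrow> z ^ i * w x)) \<in> P"
    and n: "\<not> (\<forall>y\<in>{..d} \<times> U. c y = 0)"
  have zS: "z \<in> polys {1..N}" using z(1) mpoly_ideal_subset[OF Q(1)] by blast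
  define a where "a i = (\<Sum>x\<in>U. single 0 (c (i, x)) * w x)" for i
  have aS: "a i \<in> polys {1..N}" for i
    unfolding a_def by (intro polys_sum polys_mult polys_single w) auto
  \<comment> \<open>The lowest power of z with a nonzero coefficient.\<close>
  define i0 where "i0 = (LEAST i. i \<le> d \<and> (\<exists>x\<in>U. c (i, x) \<noteq> 0))"
  have "\<exists>i. i \<le> d \<and> (\<exists>x\<in>U. c (i, x) \<noteq> 0)" using n by auto
  from LeastI_ex[OF this] have i0: "i0 \<le> d" "\<exists>x\<in>U. c (i0, x) \<noteq> 0" unfolding i0_def by auto
  have a0: "a i = 0" if "i < i0" for i
  proof -
    have "\<not> (i \<le> d \<and> (\<exists>x\<in>U. c (i, x) \<noteq> 0))" using that unfolding i0_def by (rule not_less_Least)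
    then show ?thesis using that i0(1) unfolding a_def by (intro sum.neutral) auto
  qed
  have "(\<Sum>y\<in>{..d} \<times> U. single 0 (c y) * (case y of (i, x) \<Rightarrow> z ^ i * w x)) = (\<Sum>i\<le>d. z ^ i * a i)"
    unfolding a_def by (simp add: sum_distrib_left sum.cartesian_product case_prod_unfold ac_simps)
  also have "\<dots> = (\<Sum>i\<in>{i0..d}. z ^ i * a i)"
    by (rule sum.mono_neutral_right) (use a0 in auto)
  also have "\<dots> = (\<Sum>i\<in>{i0..d}. z ^ i0 * (z ^ (i - i0) * a i))"
    by (intro sum.cong) (auto simp: power_add[symmetric] mult.assoc[symmetric])
  also have "\<dots> = z ^ i0 * (\<Sum>i\<in>{i0..d}. z ^ (i - i0) * a i)" by (simp add: sum_distrib_left)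
  finally have "z ^ i0 * (\<Sum>i\<in>{i0..d}. z ^ (i - i0) * a i) \<in> P" using s by simp
  moreover have tS: "(\<Sum>i\<in>{i0..d}. z ^ (i - i0) * a i) \<in> polys {1..N}"
    using zS aS by (intro polys_sum polys_mult polys_power) auto
  ultimately have "(\<Sum>i\<in>{i0..d}. z ^ (i - i0) * a i) \<in> P"
    using mpoly_primeD[OF P polys_power[OF zS]] mpoly_prime_power[OF P zS z(2)] by blast
  then have q: "(\<Sum>i\<in>{i0..d}. z ^ (i - i0) * a i) \<in> Q" using Q(2) by blast
  have "(\<Sum>i\<in>{Suc i0..d}. z ^ (i - i0) * a i) = (\<Sum>i\<in>{Suc i0..d}. (z ^ (i - Suc i0) * a i) * z)"
    by (intro sum.cong) (auto simp: Suc_diff_Suc[symmetric] Suc_le_eq)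
  also have "\<dots> = (\<Sum>i\<in>{Suc i0..d}. z ^ (i - Suc i0) * a i) * z" by (simp add: sum_distrib_right)
  also have "\<dots> \<in> Q"
    using zS aS z(1) by (intro mpoly_ideal_mult[OF Q(1)] polys_sum polys_mult polys_power) auto
  finally have tail: "(\<Sum>i\<in>{Suc i0..d}. z ^ (i - i0) * a i) \<in> Q" .
  have "(\<Sum>i\<in>{i0..d}. z ^ (i - i0) * a i) = a i0 + (\<Sum>i\<in>{Suc i0..d}. z ^ (i - i0) * a i)"
    using i0(1) by (simp add: sum.atLeast_Suc_atMost)
  then have "a i0 = (\<Sum>i\<in>{i0..d}. z ^ (i - i0) * a i) - (\<Sum>i\<in>{Suc i0..d}. z ^ (i - i0) * a i)" by simp
  also have "\<dots> \<in> Q" by (rule mpoly_ideal_diff[OF Q(1) q tail])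
  finally have "(\<Sum>x\<in>U. single 0 (c (i0, x)) * w x) \<in> Q" by (simp add: a_def)
  then have "\<forall>x\<in>U. c (i0, x) = 0"
    using ind[unfolded lin_indep_mod_def, THEN spec, of "\<lambda>x. c (i0, x)"] by blast
  then show False using i0(2) by blast
qed

definition degree_le :: "nat \<Rightarrow> 'k::field mpoly \<Rightarrow> bool" where
  "degree_le e p \<longleftrightarrow> (\<forall>t\<in>keys p. mon_degree t \<le> e)"

lemma degree_le_mult: "degree_le e p \<Longrightarrow> degree_le f q \<Longrightarrow> degree_le (e + f) (p * q)"
  using Poly_Mapping.keys_mult[of p q] by (fastforce simp: degree_le_def intro: add_mono)

lemma degree_le_power: "degree_le e p \<Longrightarrow> degree_le (e * n) (p ^ n)"
proof (induction n)
  case (Suc n)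
  then show ?case using degree_le_mult[of e p "e * n" "p ^ n"] by simp
qed (simp add: degree_le_def)

lemma degree_le_mono: "degree_le e p \<Longrightarrow> e \<le> f \<Longrightarrow> degree_le f p"
  by (auto simp: degree_le_def)

lemma ex_degree_le: "\<exists>e. degree_le e p"
  unfolding degree_le_def by (intro exI[of _ "Max (mon_degree ` keys p)"]) auto

context spread_relation
begin

lemma step_mon_degree: "step t t' \<Longrightarrow> mon_degree t' = mon_degree t"
  by (auto simp: step_def)

lemma nform_mon_degree: "keys t \<subseteq> {1..N} \<Longrightarrow> mon_degree (nform t) = mon_degree t"
proof -
  assume t: "keys t \<subseteq> {1..N}"
  have "mon_degree s = mon_degree t" if "step\<^sup>*\<^sup>* t s" for s
    using that by (induction rule: rtranclp_induct) (auto dest: step_mon_degree)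
  then show ?thesis using nform(1)[OF t] by blast
qed

lemma keys_NF: "keys (NF p) \<subseteq> nform ` keys p"
proof
  fix s assume "s \<in> keys (NF p)"
  then have "(\<Sum>t\<in>keys p. lookup (single (nform t) (lookup p t)) s) \<noteq> 0"
    by (simp add: NF_def lookup_sum in_keys_iff)
  then obtain t where "t \<in> keys p" "lookup (single (nform t) (lookup p t)) s \<noteq> 0"
    by (meson sum.neutral)
  then show "s \<in> nform ` keys p" by (auto simp: lookup_single when_def split: if_splits)
qed

lemma lookup_scalar_mult: "lookup (single 0 c * p) t = c * lookup p (t :: nat \<Rightarrow>\<^sub>0 nat)"
  using lookup_single_mult[of 0 c p t] by simp

lemma NF_scalar_mult: "NF (single 0 c * p) = single 0 c * NF p"
proof (induction p rule: poly_induct_add)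
  case (single t d)
  show ?case by (simp add: NF_single mult_single)
qed (simp_all add: NF_add distrib_left)

text \<open>Normal forms of polynomials of degree at most \<open>e\<close> live in the span of the standard monomials of degree at
  most \<open>e\<close>, whose number is bounded by \<open>card_standard_le\<close>.\<close>
lemma too_many_dependent:
  fixes w :: "'x \<Rightarrow> 'k::field mpoly"
  assumes w: "\<And>x. x \<in> U \<Longrightarrow> w x \<in> polys {1..N}" "\<And>x. x \<in> U \<Longrightarrow> degree_le e (w x)"
    and U: "finite U" "2 ^ N * (e + 1)\<^sup>2 < card U"
  shows "\<not> lin_indep_mod spread_ideal w U"
proof
  assume ind: "lin_indep_mod spread_ideal w U"
  let ?Y = "{t. keys t \<subseteq> {1..N} \<and> standard t \<and> mon_degree t \<le> e}"
  have "card ?Y < card U" using card_standard_le[of e] U(2) by linarith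
  from homogeneous_system_nontrivial[OF finite_standard U(1) this, of "\<lambda>x y. lookup (NF (w x)) y"]
  obtain c where c: "\<exists>x\<in>U. c x \<noteq> 0" "\<forall>y\<in>?Y. (\<Sum>x\<in>U. c x * lookup (NF (w x)) y) = 0" by blast
  let ?p = "\<Sum>x\<in>U. single 0 (c x) * w x"
  have lk: "lookup (NF ?p) y = (\<Sum>x\<in>U. c x * lookup (NF (w x)) y)" for y
    by (simp add: NF_sum NF_scalar_mult lookup_sum lookup_scalar_mult)
  have out: "lookup (NF (w x)) y = 0" if "x \<in> U" "y \<notin> ?Y" for x y
  proof (rule ccontr)
    assume "lookup (NF (w x)) y \<noteq> 0"
    then obtain t where t: "t \<in> keys (w x)" "y = nform t" using keys_NF[of "w x"] by (auto simp: in_keys_iff)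
    have "keys t \<subseteq> {1..N}" "mon_degree t \<le> e" using w[OF that(1)] t(1) by (auto simp: polys_def degree_le_def)
    then have "y \<in> ?Y" using t(2) nform[of t] nform_mon_degree[of t] by simp
    then show False using that by blast
  qed
  have "NF ?p = 0"
  proof (rule poly_mapping_eqI)
    fix y
    show "lookup (NF ?p) y = lookup 0 y"
      unfolding lk by (cases "y \<in> ?Y") (use c(2) out in \<open>auto intro!: sum.neutral\<close>)
  qed
  moreover have "?p \<in> polys {1..N}" by (intro polys_sum polys_mult polys_single w(1)) auto
  ultimately have "?p \<in> spread_ideal" by (simp add: mem_spread_ideal_iff)
  then show False using ind c(1) unfolding lin_indep_mod_def by blast
qed

text \<open>Elements \<open>z\<^sub>0, z\<^sub>1, z\<^sub>2\<close> witnessing the three inclusions have \<open>(d + 1)\<^sup>3\<close> monomials with exponents at most \<open>d\<close>,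
  all linearly independent modulo the ideal, while their degrees grow only linearly in \<open>d\<close>.\<close>
theorem no_long_prime_chain:
  assumes P: "\<And>i. i \<le> 3 \<Longrightarrow> primeideal (P i) (mpoly_ring N :: 'k::field mpoly ring)"
    and sub: "spread_ideal \<subseteq> P 0" and strict: "\<And>i. i < 3 \<Longrightarrow> P i \<subset> P (Suc i)"
  shows False
proof -
  have "\<forall>i<3. \<exists>z. z \<in> P (Suc i) \<and> z \<notin> P i" using strict by blast
  then obtain z where z: "\<And>i. i < 3 \<Longrightarrow> z i \<in> P (Suc i)" "\<And>i. i < 3 \<Longrightarrow> z i \<notin> P i" by metis
  note id = mpoly_prime_ideal[OF P]
  have zS: "z i \<in> polys {1..N}" if "i < 3" for i
    using z(1)[OF that] mpoly_ideal_subset[OF id[of "Suc i"]] that by auto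
  obtain e0 e1 e2 where e: "degree_le e0 (z 0)" "degree_le e1 (z 1)" "degree_le e2 (z 2)" using ex_degree_le by metis
  \<comment> \<open>A common degree bound; it is positive so that 3 * E * d + 1 is at most 3 * E * (d + 1).\<close>
  define E where "E = Suc (max e0 (max e1 e2))"
  have dE: "degree_le E (z 0)" "degree_le E (z 1)" "degree_le E (z 2)"
    using e by (auto intro: degree_le_mono simp: E_def)
  \<comment> \<open>Chosen so that 2 ^ N * (3 * E * (d + 1)) ^ 2 = d * (d + 1) ^ 2 is less than (d + 1) ^ 3.\<close>
  define d where "d = 2 ^ N * 9 * E\<^sup>2"
  define w2 where "w2 = (\<lambda>(i::nat, x::unit). z 2 ^ i * (1 :: 'k mpoly))"
  define w1 where "w1 = (\<lambda>(i::nat, x). z 1 ^ i * w2 x)"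
  define w0 where "w0 = (\<lambda>(i::nat, x). z 0 ^ i * w1 x)"
  let ?X2 = "{..d} \<times> {()}" and ?X1 = "{..d} \<times> ({..d} \<times> {()})" and ?X0 = "{..d} \<times> ({..d} \<times> ({..d} \<times> {()}))"
  have w2S: "w2 x \<in> polys {1..N}" for x
    unfolding w2_def case_prod_unfold by (intro polys_mult polys_power polys_one zS) simp
  have w1S: "w1 x \<in> polys {1..N}" for x
    unfolding w1_def case_prod_unfold by (intro polys_mult polys_power w2S zS) simp
  have w0S: "w0 x \<in> polys {1..N}" for x
    unfolding w0_def case_prod_unfold by (intro polys_mult polys_power w1S zS) simp
  have "lin_indep_mod (P 2) w2 ?X2"
    unfolding w2_def using strict[of 2] z[of 2]
    by (intro lin_indep_mod_powers[OF P id[of 3]] lin_indep_mod_one[OF P[of 3]] polys_one) (auto simp: eval_nat_numeral)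
  then have "lin_indep_mod (P 1) w1 ?X1"
    unfolding w1_def using strict[of 1] z[of 1]
    by (intro lin_indep_mod_powers[OF P id[of 2]] w2S) (auto simp: eval_nat_numeral)
  then have "lin_indep_mod (P 0) w0 ?X0"
    unfolding w0_def using strict[of 0] z[of 0]
    by (intro lin_indep_mod_powers[OF P id[of 1]] w1S) auto
  then have "lin_indep_mod spread_ideal w0 ?X0" using sub unfolding lin_indep_mod_def by blast
  moreover have "\<not> lin_indep_mod spread_ideal w0 ?X0"
  proof (rule too_many_dependent)
    show "w0 x \<in> polys {1..N}" for x by (rule w0S)
    show "degree_le (3 * E * d) (w0 x)" if x: "x \<in> ?X0" for x
    proof -
      obtain i j k where ijk: "x = (i, j, k, ())" "i \<le> d" "j \<le> d" "k \<le> d" using x by auto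
      have "degree_le (E * i + (E * j + (E * k + 0))) (w0 x)"
        unfolding w0_def w1_def w2_def ijk(1) prod.case
        by (intro degree_le_mult degree_le_power dE) (simp add: degree_le_def)
      moreover have "E * i + (E * j + (E * k + 0)) \<le> 3 * E * d"
      proof -
        have "E * i \<le> E * d" "E * j \<le> E * d" "E * k \<le> E * d"
          using ijk by (intro mult_le_mono2; simp)+
        moreover have "3 * E * d = E * d + (E * d + E * d)" by simp
        ultimately show ?thesis by linarith
      qed
      ultimately show ?thesis by (rule degree_le_mono)
    qed
    show "finite ?X0" by simp
    have "3 * E * d + 1 \<le> 3 * E * (d + 1)" by (simp add: E_def)
    then have "(3 * E * d + 1)\<^sup>2 \<le> (3 * E * (d + 1))\<^sup>2" by (rule power_mono) simp
    then have "2 ^ N * (3 * E * d + 1)\<^sup>2 \<le> 2 ^ N * (3 * E * (d + 1))\<^sup>2" by (rule mult_le_mono2)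
    also have "\<dots> = 2 ^ N * 9 * E\<^sup>2 * (d + 1)\<^sup>2" by (simp only: power_mult_distrib) simp
    also have "\<dots> = d * (d + 1)\<^sup>2" by (simp only: d_def)
    also have "\<dots> < (d + 1) * (d + 1)\<^sup>2" by (intro mult_strict_right_mono) auto
    also have "\<dots> = card ?X0" by (simp add: card_cartesian_product power2_eq_square)
    finally show "2 ^ N * (3 * E * d + 1)\<^sup>2 < card ?X0" .
  qed
  ultimately show False by blast
qed

end

section \<open>Regular sequences of polynomials in different variables\<close>

lemma exponents_single_var_eq:
  "keys s \<subseteq> {i} \<Longrightarrow> keys t \<subseteq> {i} \<Longrightarrow> lookup s i = lookup t i \<Longrightarrow> s = (t :: nat \<Rightarrow>\<^sub>0 nat)"
proof (rule poly_mapping_eqI)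
  fix k assume *: "keys s \<subseteq> {i}" "keys t \<subseteq> {i}" "lookup s i = lookup t i"
  show "lookup s k = lookup t k"
  proof (cases "k = i")
    case False
    then have "k \<notin> keys s" "k \<notin> keys t" using * by blast+
    then show ?thesis by (simp add: in_keys_iff)
  qed (use * in simp)
qed

lemma ex_max_var_exponent:
  fixes p :: "'k::field mpoly"
  assumes "p \<noteq> 0" obtains t where "t \<in> keys p" "\<And>s. s \<in> keys p \<Longrightarrow> lookup s i \<le> lookup t i"
proof -
  let ?A = "(\<lambda>t. lookup t i) ` keys p"
  have A: "finite ?A" "?A \<noteq> {}" using assms by auto
  have "Max ?A \<in> ?A" by (rule Max_in[OF A])
  then obtain t where t: "t \<in> keys p" "lookup t i = Max ?A" by (metis imageE)
  have "lookup s i \<le> lookup t i" if "s \<in> keys p" for s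
    using Max_ge[OF A(1), of "lookup s i"] that t(2) by auto
  then show thesis using that t(1) by blast
qed

text \<open>Division with remainder by a polynomial in the single variable \<open>x\<^sub>i\<close>, with respect to the degree in \<open>x\<^sub>i\<close>; its
  leading coefficient is a nonzero constant.\<close>
lemma univariate_division:
  fixes f :: "'k::field mpoly"
  assumes f: "f \<in> polys {i}" and a: "a \<in> keys f" "\<And>s. s \<in> keys f \<Longrightarrow> lookup s i \<le> lookup a i"
    and i: "i \<in> V" and p: "p \<in> polys V"
  shows "\<exists>q\<in>polys V. \<exists>r\<in>polys V. p = f * q + r \<and> (\<forall>t\<in>keys r. lookup t i < lookup a i)"
proof -
  let ?P = "\<lambda>p. \<exists>q\<in>polys V. \<exists>r\<in>polys V. p = f * q + r \<and> (\<forall>t\<in>keys r. lookup t i < lookup a i)"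
  have add: "?P (p + p')" if pp: "?P p" "?P p'" for p p'
  proof -
    obtain q r q' r' where *: "q \<in> polys V" "r \<in> polys V" "p = f * q + r" "\<forall>t\<in>keys r. lookup t i < lookup a i"
      "q' \<in> polys V" "r' \<in> polys V" "p' = f * q' + r'" "\<forall>t\<in>keys r'. lookup t i < lookup a i"
      using pp by blast
    have "\<forall>t\<in>keys (r + r'). lookup t i < lookup a i"
      using Poly_Mapping.keys_add[of r r'] *(4,8) by blast
    moreover have "p + p' = f * (q + q') + (r + r')" unfolding *(3,7) by (simp add: algebra_simps)
    ultimately show ?thesis using polys_add[OF *(1,5)] polys_add[OF *(2,6)] by blast
  qed
  have zero: "?P 0" by (rule bexI[of _ 0], rule bexI[of _ 0]) (simp_all add: polys_zero)
  have ka: "keys a \<subseteq> {i}" using f a(1) by (simp add: polys_def)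
  have fV: "f \<in> polys V" using f polys_mono[of "{i}" V] i by blast
  have mon: "?P (single t c)" if "keys t \<subseteq> V" for t c
    using that
  proof (induction "lookup t i" arbitrary: t c rule: less_induct)
    case less
    show ?case
    proof (cases "lookup t i < lookup a i")
      case True
      have "single t c \<in> polys V" using less.prems by (rule polys_single)
      moreover have "\<forall>s\<in>keys (single t c). lookup s i < lookup a i" using True by auto
      ultimately show ?thesis using polys_zero by (intro bexI[of _ 0] bexI[of _ "single t c"]) auto
    next
      case False
      define s where "s = t - a"
      have ts: "t = a + s"
      proof (rule poly_mapping_eqI)
        fix k show "lookup t k = lookup (a + s) k"
        proof (cases "k = i")
          case True
          then show ?thesis using False by (simp add: s_def lookup_add lookup_minus)
        next
          case False
          then have "k \<notin> keys a" using ka by blast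
          then show ?thesis by (simp add: s_def lookup_add lookup_minus in_keys_iff)
        qed
      qed
      define l where "l = lookup f a"
      have l: "l \<noteq> 0" using a(1) by (simp add: l_def in_keys_iff)
      define f' where "f' = f - single a l"
      have kf': "u \<in> keys f \<and> u \<noteq> a" if "u \<in> keys f'" for u
        using that by (auto simp: f'_def l_def in_keys_iff lookup_minus lookup_single when_def split: if_splits)
      have sV: "keys s \<subseteq> V" using less.prems ts by (auto simp: keys_add_nat)
      let ?m = "single s (c / l)"
      have mV: "?m \<in> polys V" using sV by (rule polys_single)
      have eq: "single t c = f * ?m + - (f' * ?m)"
        using l by (simp add: f'_def left_diff_distrib mult_single ts)
      have 1: "?P (f * ?m)"
        using mV polys_zero by (intro bexI[of _ ?m] bexI[of _ 0]) auto
      have 2: "?P (- (f' * ?m))"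
      proof (rule poly_induct_add[of "- (f' * ?m)" ?P])
        fix r d assume "r \<in> keys (- (f' * ?m))"
        then have "r \<in> keys (f' * ?m)" by (simp add: in_keys_iff)
        then obtain u where u: "u \<in> keys f'" "r = u + s"
          using Poly_Mapping.keys_mult[of f' ?m] by (auto split: if_splits)
        have uf: "u \<in> keys f" "u \<noteq> a" using kf'[OF u(1)] by auto
        have ku: "keys u \<subseteq> {i}" using f uf(1) by (simp add: polys_def)
        have "lookup u i < lookup a i"
          using a(2)[OF uf(1)] exponents_single_var_eq[OF ku ka] uf(2) by (auto simp: le_less)
        then have "lookup r i < lookup t i" by (simp add: u(2) ts lookup_add)
        moreover have "keys r \<subseteq> V" using ku sV i by (auto simp: u(2) keys_add_nat)
        ultimately show "?P (single r d)" by (rule less.hyps)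
      qed (fact add, fact zero)
      show ?thesis unfolding eq by (rule add[OF 1 2])
    qed
  qed
  show ?thesis
  proof (rule poly_induct_add[of p ?P])
    fix t c assume "t \<in> keys p"
    then have "keys t \<subseteq> V" using p by (simp add: polys_def)
    then show "?P (single t c)" by (rule mon)
  qed (fact add, fact zero)
qed

text \<open>Replacing \<open>u\<close> by its remainder modulo \<open>f\<close> makes the degree in \<open>x\<^sub>i\<close> of the left-hand side smaller than that of
  every nonzero multiple of \<open>f\<close>, because \<open>g\<close> does not involve \<open>x\<^sub>i\<close>.\<close>
lemma univariate_coprime_cancel:
  fixes f g :: "'k::field mpoly"
  assumes f: "f \<in> polys {i}" "f \<noteq> 0" and g: "g \<in> polys {j}" "g \<noteq> 0" and ij: "i \<noteq> j" "i \<in> V" "j \<in> V"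
    and u: "u \<in> polys V" and eq: "g * u = f * v"
  obtains q where "q \<in> polys V" "u = f * q"
proof -
  obtain a where a: "a \<in> keys f" "\<And>s. s \<in> keys f \<Longrightarrow> lookup s i \<le> lookup a i"
    using ex_max_var_exponent[OF f(2)] by blast
  obtain q r where q: "q \<in> polys V" "r \<in> polys V" "u = f * q + r" "\<forall>t\<in>keys r. lookup t i < lookup a i"
    using univariate_division[OF f(1) a ij(2) u] by blast
  define w where "w = v - g * q"
  have gr: "g * r = f * w" using eq by (simp add: q(3) w_def algebra_simps)
  have "w = 0"
  proof (rule ccontr)
    assume "w \<noteq> 0"
    then obtain b where b: "b \<in> keys w" "\<And>s. s \<in> keys w \<Longrightarrow> lookup s i \<le> lookup b i"
      using ex_max_var_exponent by blast
    have kf: "keys s \<subseteq> {i}" if "s \<in> keys f" for s using f(1) that by (simp add: polys_def)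
    have "lookup (f * w) (a + b) = lookup f a * lookup w b"
    proof (rule lookup_mult_extreme)
      fix s t assume st: "s \<in> keys f" "t \<in> keys w" "s + t = a + b"
      have "lookup s i + lookup t i = lookup a i + lookup b i" using arg_cong[OF st(3), of "\<lambda>t. lookup t i"] by (simp add: lookup_add)
      then have "lookup s i = lookup a i" using a(2)[OF st(1)] b(2)[OF st(2)] by linarith
      then have "s = a" using exponents_single_var_eq kf st(1) a(1) by blast
      then show "s = a \<and> t = b" using st(3) by simp
    qed
    then have "a + b \<in> keys (g * r)" using a(1) b(1) by (simp add: gr in_keys_iff)
    then obtain s t where st: "s \<in> keys g" "t \<in> keys r" "a + b = s + t"
      using Poly_Mapping.keys_mult[of g r] by blast
    have "keys s \<subseteq> {j}" using g(1) st(1) by (simp add: polys_def)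
    then have "lookup s i = 0" using ij(1) by (auto simp: in_keys_iff subset_iff)
    then have "lookup a i \<le> lookup t i" using arg_cong[OF st(3), of "\<lambda>t. lookup t i"] by (simp add: lookup_add)
    then show False using q(4) st(2) by fastforce
  qed
  then have "g * r = 0" using gr by simp
  then have "r = 0" using g(2) by simp
  then show thesis using that[OF q(1)] q(3) by simp
qed

lemma (in cring) maximalideal_inverse:
  assumes "maximalideal M R" "u \<in> carrier R" "u \<notin> M"
  obtains w where "w \<in> carrier R" "u \<otimes> w \<ominus> \<one> \<in> M"
proof -
  interpret M: maximalideal M R by fact
  have J: "ideal (M <+>\<^bsub>R\<^esub> PIdl u) R" by (rule ideal_adjoin[OF M.ideal_axioms assms(2)])
  have "M <+>\<^bsub>R\<^esub> PIdl u \<noteq> M" using mem_ideal_adjoin[OF M.ideal_axioms assms(2)] assms(3) by blast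
  then have "M <+>\<^bsub>R\<^esub> PIdl u = carrier R"
    using M.I_maximal[OF J subset_ideal_adjoin[OF M.ideal_axioms assms(2)]] ideal.Icarr[OF J] by blast
  then obtain m w where mw: "\<one> = m \<oplus> w \<otimes> u" "m \<in> M" "w \<in> carrier R"
    using ideal_adjoinD[OF M.ideal_axioms assms(2), of \<one>] by auto
  have mc: "m \<in> carrier R" using mw M.Icarr by auto
  have "u \<otimes> w \<ominus> \<one> = \<ominus> m"
  proof -
    have "u \<otimes> w \<ominus> (m \<oplus> u \<otimes> w) = \<ominus> m" using mc mw(3) assms(2) by algebra
    then show ?thesis using mw(1) mw(3) assms(2) by (simp add: m_comm)
  qed
  also have "\<ominus> m \<in> M" by (rule additive_subgroup.a_inv_closed[OF M.additive_subgroup_axioms mw(2)])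
  finally show thesis using that mw(3) by blast
qed

lemma (in cring) regular_sequence_pairI:
  assumes f: "f \<in> carrier R" and g: "g \<in> carrier R"
    and reg_f: "\<And>a. a \<in> carrier R \<Longrightarrow> f \<otimes> a = \<zero> \<Longrightarrow> a = \<zero>"
    and reg_g: "\<And>a b. a \<in> carrier R \<Longrightarrow> b \<in> carrier R \<Longrightarrow> g \<otimes> a = b \<otimes> f \<Longrightarrow> \<exists>c\<in>carrier R. a = c \<otimes> f"
    and I: "ideal I R" "I \<noteq> carrier R" "f \<in> I" "g \<in> I"
  shows "regular_sequence R [f, g]"
  unfolding regular_sequence_def
proof (intro conjI allI impI ballI)
  show "set [f, g] \<subseteq> carrier R" using f g by simp
  have "Idl (set [f, g]) \<subseteq> I" by (rule genideal_minimal[OF I(1)]) (use I in simp)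
  then show "Idl (set [f, g]) \<noteq> carrier R" using I(2) ideal.Icarr[OF I(1)] by blast
  have empty: "Idl {} = {\<zero>}"
    using genideal_minimal[OF zeroideal, of "{}"] additive_subgroup.zero_closed[OF ideal.axioms(1)[OF genideal_ideal[of "{}"]]]
    by auto
  have pid: "Idl {f} = {x \<otimes> f | x. x \<in> carrier R}"
    using cgenideal_eq_genideal[OF f] by (simp add: cgenideal_def)
  fix i a assume i: "i < length [f, g]" and a: "a \<in> carrier R" and m: "[f, g] ! i \<otimes> a \<in> Idl (set (take i [f, g]))"
  consider "i = 0" | "i = 1" using i by fastforce
  then show "a \<in> Idl (set (take i [f, g]))"
  proof cases
    case 1
    then show ?thesis using m a reg_f by (simp add: empty)
  next
    case 2
    then have "g \<otimes> a \<in> {x \<otimes> f | x. x \<in> carrier R}" using m pid by simp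
    then obtain b where "b \<in> carrier R" "g \<otimes> a = b \<otimes> f" by blast
    then obtain c where "c \<in> carrier R" "a = c \<otimes> f" using reg_g a by blast
    then show ?thesis using 2 pid by auto
  qed
qed

section \<open>Interval graphs\<close>

lemma clique_in_maximal_clique:
  assumes "clique n E C" obtains D where "maximal_clique n E D" "C \<subseteq> D"
proof -
  define F where "F = {D. clique n E D \<and> C \<subseteq> D}"
  have "finite F" by (rule finite_subset[of _ "Pow {1..n}"]) (auto simp: F_def clique_def)
  moreover have "C \<in> F" using assms by (simp add: F_def)
  ultimately obtain D where "D \<in> F" "\<forall>D'\<in>F. D \<le> D' \<longrightarrow> D = D'"
    using finite_has_maximal[of F] by (metis empty_iff)
  then have "maximal_clique n E D" "C \<subseteq> D" by (auto simp: maximal_clique_def F_def)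
  then show thesis by (rule that)
qed

text \<open>The edge lies in a maximal clique, which is an interval and thus contains everything in between.\<close>
lemma interval_labeling_subedge:
  assumes simple: "simple_graph n E" and int: "interval_labeling n E"
    and e: "{i, j} \<in> E" and le: "i \<le> i'" "i' < j'" "j' \<le> j"
  shows "{i', j'} \<in> E"
proof -
  have "{i, j} \<subseteq> {1..n}" using simple e by (auto simp: simple_graph_def)
  then have "clique n E {i, j}" using e by (auto simp: clique_def insert_commute)
  then obtain C where C: "maximal_clique n E C" "{i, j} \<subseteq> C" by (rule clique_in_maximal_clique)
  have "\<exists>a b. C = {a..b}" using int C(1) unfolding interval_labeling_def by blast
  then obtain a b where "C = {a..b}" by blast
  then have "i' \<in> C" "j' \<in> C" using C(2) le by auto
  then show ?thesis using C(1) le(2) by (auto simp: maximal_clique_def clique_def)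
qed

lemma path_crosses:
  assumes "(u, v) \<in> {(x, y). {x, y} \<in> E}\<^sup>*" "u \<le> p" "p < v"
  shows "\<exists>x y. {x, y} \<in> E \<and> x \<le> p \<and> p < (y :: nat)"
  using assms
proof (induction rule: rtrancl_induct)
  case (step y z)
  show ?case
  proof (cases "p < y")
    case False
    then show ?thesis using step by (intro exI[of _ y] exI[of _ z]) auto
  qed (use step in auto)
qed simp

text \<open>A path from \<open>1\<close> to \<open>n\<close> has an edge that crosses from \<open>{1..p}\<close> to its complement.\<close>
lemma interval_labeling_consecutive:
  assumes simple: "simple_graph n E" and int: "interval_labeling n E" and conn: "connected_graph n E"
    and p: "1 \<le> p" "p < n"
  shows "{p, Suc p} \<in> E"
proof -
  have "(1, n) \<in> {(x, y). {x, y} \<in> E}\<^sup>*" using conn p by (auto simp: connected_graph_def)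
  then obtain x y where "{x, y} \<in> E" "x \<le> p" "p < y" using path_crosses[of 1 n E p] p by blast
  then show ?thesis using interval_labeling_subedge[OF simple int, of x y p "Suc p"] by auto
qed

section \<open>Hankel ideals\<close>

text \<open>\<open>x\<^sub>p\<close> and \<open>x\<^sub>q\<close> are the upper left and the lower right entry of a Hankel minor that generates the ideal.\<close>
definition spread_pair :: "nat set set \<Rightarrow> nat set set \<Rightarrow> nat \<Rightarrow> nat \<Rightarrow> bool" where
  "spread_pair E E' p q \<longleftrightarrow>
     (\<exists>i j k l. i < j \<and> k < l \<and> {i, j} \<in> E \<and> {k, l} \<in> E' \<and> p = i + k - 1 \<and> q = j + l - 1)"

locale hankel_graphs =
  fixes m n :: nat and E\<^sub>1 E\<^sub>2 :: "nat set set"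
  assumes m: "m \<ge> 2" and n: "n \<ge> 2"
    and simple1: "simple_graph m E\<^sub>1" and conn1: "connected_graph m E\<^sub>1" and int1: "interval_labeling m E\<^sub>1"
    and simple2: "simple_graph n E\<^sub>2" and conn2: "connected_graph n E\<^sub>2" and int2: "interval_labeling n E\<^sub>2"
begin

lemma edge1: "{i, j} \<in> E\<^sub>1 \<Longrightarrow> i < j \<Longrightarrow> 1 \<le> i \<and> j \<le> m"
  using simple1 by (auto simp: simple_graph_def)

lemma edge2: "{i, j} \<in> E\<^sub>2 \<Longrightarrow> i < j \<Longrightarrow> 1 \<le> i \<and> j \<le> n"
  using simple2 by (auto simp: simple_graph_def)

sublocale spread_relation "m + n - 1" "spread_pair E\<^sub>1 E\<^sub>2"
proof
  show "1 \<le> p \<and> p + 2 \<le> q \<and> q \<le> m + n - 1" if "spread_pair E\<^sub>1 E\<^sub>2 p q" for p q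
    using that edge1 edge2 unfolding spread_pair_def by fastforce
next
  fix p q p' q' assume "spread_pair E\<^sub>1 E\<^sub>2 p q" and le: "p \<le> p'" "q' \<le> q" "p' + 2 \<le> q'"
  then obtain i j k l where *: "i < j" "k < l" "{i, j} \<in> E\<^sub>1" "{k, l} \<in> E\<^sub>2" "p = i + k - 1" "q = j + l - 1"
    unfolding spread_pair_def by blast
  have ik: "1 \<le> i" "1 \<le> k" using edge1 edge2 * by auto
  \<comment> \<open>The upper left corner moves from (i, k) first down, to row j - 1 at most, and then to the right. The lower
    right corner takes the largest row that leaves a column to the right of k'.\<close>
  define i' where "i' = min (i + (p' - p)) (j - 1)"
  define k' where "k' = p' + 1 - i'"
  define j' where "j' = min j (q' - k')"
  define l' where "l' = q' + 1 - j'"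
  have i': "i \<le> i'" "i' < j" "k \<le> k'" "k' < l" "i' + k' - 1 = p'"
    using * le ik by (auto simp: i'_def k'_def min_def split: if_splits)
  have j': "i' < j'" "j' \<le> j" "k' < l'" "l' \<le> l" "j' + l' - 1 = q'"
    using * le ik i' by (auto simp: j'_def l'_def min_def split: if_splits)
  have "{i', j'} \<in> E\<^sub>1" using interval_labeling_subedge[OF simple1 int1 *(3)] i' j' by auto
  moreover have "{k', l'} \<in> E\<^sub>2" using interval_labeling_subedge[OF simple2 int2 *(4)] i' j' by auto
  ultimately show "spread_pair E\<^sub>1 E\<^sub>2 p' q'" unfolding spread_pair_def using i'(5) j' by blast
next
  fix p assume p: "1 \<le> p" "p + 2 \<le> m + n - 1"
  \<comment> \<open>The entry x_p is found in the first column as long as the rows allow it, with one row left below.\<close>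
  define i where "i = min p (m - 1)"
  define k where "k = p + 1 - i"
  have ik: "1 \<le> i" "i < m" "1 \<le> k" "k < n" "p = i + k - 1" "p + 2 = Suc i + Suc k - 1"
    using p m n by (auto simp: i_def k_def min_def split: if_splits)
  have "{i, Suc i} \<in> E\<^sub>1" by (rule interval_labeling_consecutive[OF simple1 int1 conn1 ik(1,2)])
  moreover have "{k, Suc k} \<in> E\<^sub>2" by (rule interval_labeling_consecutive[OF simple2 int2 conn2 ik(3,4)])
  ultimately show "spread_pair E\<^sub>1 E\<^sub>2 p (p + 2)" unfolding spread_pair_def using ik(5,6) by blast
qed

lemma hankel_minor_eq:
  assumes "1 \<le> i" "1 \<le> k" "i < j" "k < l"
  shows "hankel_minor i j k l = mvar (i + k - 1) * mvar (j + l - 1) - mvar (j + k - 1) * mvar (i + l - 1)"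
  by (simp add: hankel_minor_def hankel_entry_def)

lemma hankel_gens_polys:
  "{hankel_minor i j k l | i j k l. i < j \<and> k < l \<and> {i, j} \<in> E\<^sub>1 \<and> {k, l} \<in> E\<^sub>2} \<subseteq> (polys {1..m + n - 1} :: 'k::field mpoly set)"
proof -
  have "hankel_minor i j k l \<in> (polys {1..m + n - 1} :: 'k mpoly set)"
    if "i < j" "k < l" "{i, j} \<in> E\<^sub>1" "{k, l} \<in> E\<^sub>2" for i j k l
  proof -
    have "1 \<le> i" "j \<le> m" "1 \<le> k" "l \<le> n" using edge1 edge2 that by auto
    then show ?thesis using that unfolding hankel_minor_def hankel_entry_def mvar_def monomial_def
      by (intro polys_diff polys_mult polys_single) auto
  qed
  then show ?thesis by blast
qed

lemma hankel_ideal_ideal: "ideal (hankel_ideal m n E\<^sub>1 E\<^sub>2) (mpoly_ring (m + n - 1) :: 'k::field mpoly ring)"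
  and hankel_minor_mem: "i < j \<Longrightarrow> k < l \<Longrightarrow> {i, j} \<in> E\<^sub>1 \<Longrightarrow> {k, l} \<in> E\<^sub>2 \<Longrightarrow>
    hankel_minor i j k l \<in> (hankel_ideal m n E\<^sub>1 E\<^sub>2 :: 'k::field mpoly set)"
proof -
  interpret cring "mpoly_ring (m + n - 1) :: 'k mpoly ring" by (rule mpoly_ring_cring)
  show "ideal (hankel_ideal m n E\<^sub>1 E\<^sub>2) (mpoly_ring (m + n - 1) :: 'k::field mpoly ring)"
    unfolding hankel_ideal_def using hankel_gens_polys by (intro genideal_ideal) (simp add: mpoly_ring_simps)
  have "{hankel_minor i j k l | i j k l. i < j \<and> k < l \<and> {i, j} \<in> E\<^sub>1 \<and> {k, l} \<in> E\<^sub>2}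
      \<subseteq> (hankel_ideal m n E\<^sub>1 E\<^sub>2 :: 'k::field mpoly set)"
    unfolding hankel_ideal_def using hankel_gens_polys by (intro genideal_self) (simp add: mpoly_ring_simps)
  then show "hankel_minor i j k l \<in> (hankel_ideal m n E\<^sub>1 E\<^sub>2 :: 'k::field mpoly set)"
    if "i < j" "k < l" "{i, j} \<in> E\<^sub>1" "{k, l} \<in> E\<^sub>2" using that by blast
qed

text \<open>The minor itself relates \<open>x\<^sub>p x\<^sub>q\<close> to one product \<open>x\<^sub>c x\<^sub>d\<close> with the same index sum. All products between
  \<open>p + 1\<close> and \<open>q - 1\<close> are congruent to each other by induction, or there is only one of them.\<close>
lemma inner_pairs_congruent:
  assumes "spread_pair E\<^sub>1 E\<^sub>2 p q" "p \<le> a" "p \<le> b" "a + b = p + q"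
  shows "mvar p * mvar q - mvar a * mvar b \<in> (hankel_ideal m n E\<^sub>1 E\<^sub>2 :: 'k::field mpoly set)"
  using assms
proof (induction "q - p" arbitrary: p q a b rule: less_induct)
  case less
  let ?H = "hankel_ideal m n E\<^sub>1 E\<^sub>2 :: 'k mpoly set"
  note sub = mpoly_ideal_diff[OF hankel_ideal_ideal] and zero = mpoly_ideal_zero[OF hankel_ideal_ideal]
    and add = mpoly_ideal_add[OF hankel_ideal_ideal]
  have pq: "p + 2 \<le> q" using Rd_bounds[OF less.prems(1)] by auto
  obtain i j k l where *: "i < j" "k < l" "{i, j} \<in> E\<^sub>1" "{k, l} \<in> E\<^sub>2" "p = i + k - 1" "q = j + l - 1"
    using less.prems(1) unfolding spread_pair_def by blast
  have ik: "1 \<le> i" "1 \<le> k" using edge1 edge2 * by auto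
  define c d where "c = j + k - 1" and "d = i + l - 1"
  have cd: "p + 1 \<le> c" "p + 1 \<le> d" "c + d = p + q" using * ik by (auto simp: c_def d_def)
  have g: "mvar p * mvar q - mvar c * mvar d \<in> ?H"
    unfolding *(5,6) c_def d_def hankel_minor_eq[OF ik *(1,2), symmetric] by (rule hankel_minor_mem[OF *(1-4)])
  show ?case
  proof (cases "a = p \<or> b = p")
    case True
    then have "mvar p * mvar q = (mvar a * mvar b :: 'k mpoly)" using less.prems(4) by (auto simp: mult.commute)
    then show ?thesis using zero by simp
  next
    case False
    then have ab: "p + 1 \<le> a" "p + 1 \<le> b" using less.prems by auto
    show ?thesis
    proof (cases "p + 4 \<le> q")
      case True
      have inner: "spread_pair E\<^sub>1 E\<^sub>2 (p + 1) (q - 1)"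
        by (rule Rd_sub[OF less.prems(1)]) (use True in auto)
      have IH: "mvar (p + 1) * mvar (q - 1) - mvar x * mvar y \<in> ?H"
        if "p + 1 \<le> x" "p + 1 \<le> y" "x + y = p + q" for x y
        using that pq by (intro less.hyps inner) auto
      have "(mvar p * mvar q - mvar c * mvar d) - (mvar (p + 1) * mvar (q - 1) - mvar c * mvar d)
          + (mvar (p + 1) * mvar (q - 1) - mvar a * mvar b) \<in> ?H"
        by (rule add[OF sub[OF g IH[OF cd]] IH[OF ab less.prems(4)]])
      then show ?thesis by simp
    next
      case F: False
      then have "a = c \<and> b = d \<or> a = d \<and> b = c" using ab cd less.prems(4) pq by linarith
      then show ?thesis using g by (auto simp: mult.commute)
    qed
  qed
qed

theorem hankel_ideal_eq_spread_ideal: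
  "hankel_ideal m n E\<^sub>1 E\<^sub>2 = (spread_ideal :: 'k::field mpoly set)"
proof
  interpret cring "mpoly_ring (m + n - 1) :: 'k mpoly ring" by (rule mpoly_ring_cring)
  have "hankel_minor i j k l \<in> (spread_ideal :: 'k mpoly set)"
    if *: "i < j" "k < l" "{i, j} \<in> E\<^sub>1" "{k, l} \<in> E\<^sub>2" for i j k l
  proof -
    have ik: "1 \<le> i" "1 \<le> k" using edge1 edge2 * by auto
    have "spread_pair E\<^sub>1 E\<^sub>2 (i + k - 1) (j + l - 1)" unfolding spread_pair_def using * by blast
    then show ?thesis unfolding hankel_minor_eq[OF ik *(1,2)]
      using * ik by (intro outer_binomial_mem) auto
  qed
  then show "hankel_ideal m n E\<^sub>1 E\<^sub>2 \<subseteq> (spread_ideal :: 'k mpoly set)"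
    unfolding hankel_ideal_def by (intro genideal_minimal[OF spread_ideal(1)]) blast
  have "spread_binomial p q \<in> (hankel_ideal m n E\<^sub>1 E\<^sub>2 :: 'k mpoly set)" if pq: "spread_pair E\<^sub>1 E\<^sub>2 p q" for p q
  proof -
    have "p + 2 \<le> q" using Rd_bounds[OF pq] by simp
    then have "mvar p * mvar q - mvar (p + 1) * mvar (q - 1) \<in> (hankel_ideal m n E\<^sub>1 E\<^sub>2 :: 'k mpoly set)"
      by (intro inner_pairs_congruent[OF pq]) auto
    from mpoly_ideal_diff[OF hankel_ideal_ideal mpoly_ideal_zero[OF hankel_ideal_ideal] this]
    show ?thesis by (simp add: spread_binomial_def)
  qed
  then show "(spread_ideal :: 'k mpoly set) \<subseteq> hankel_ideal m n E\<^sub>1 E\<^sub>2"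
    unfolding spread_ideal_def by (intro genideal_minimal[OF hankel_ideal_ideal]) (auto simp: spread_binomials_def)
qed

end

section \<open>The quotient ring\<close>

lemma mpoly_ring_minus:
  assumes "a \<in> polys {1..N}" "b \<in> polys {1..N}"
  shows "a \<ominus>\<^bsub>mpoly_ring N\<^esub> b = (a - b :: 'k::field mpoly)"
proof -
  interpret cring "mpoly_ring N :: 'k mpoly ring" by (rule mpoly_ring_cring)
  have "\<ominus>\<^bsub>mpoly_ring N\<^esub> b = - b"
    by (rule minus_equality) (use assms in \<open>auto simp: mpoly_ring_simps intro: polys_uminus\<close>)
  then show ?thesis by (simp add: a_minus_def mpoly_ring_simps)
qed

lemma lookup_mult_zero: "lookup (p * q) 0 = lookup p 0 * lookup (q :: 'k::field mpoly) 0"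
proof -
  have "lookup (p * q) (0 + 0) = lookup p 0 * lookup q 0"
    by (rule lookup_mult_extreme) (metis Un_empty add.right_neutral keys_add_nat keys_eq_empty)
  then show ?thesis by simp
qed

context spread_relation
begin

text \<open>The polynomials in \<open>x\<^sub>1\<close> alone and in \<open>x\<^sub>N\<close> alone that Zariski's lemma provides in a maximal ideal form
  the regular sequence; they involve different variables because \<open>2 \<le> N\<close>.\<close>
theorem spread_quotient_cohen_macaulay:
  assumes N: "2 \<le> N"
  shows "cohen_macaulay (mpoly_ring N Quot (spread_ideal :: 'k::field mpoly set))"
    and "krull_dim (mpoly_ring N Quot (spread_ideal :: 'k::field mpoly set)) = 2"
proof -
  define R where "R = (mpoly_ring N :: 'k mpoly ring)"
  define J where "J = (spread_ideal :: 'k mpoly set)"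
  define Q where "Q = R Quot J"
  define h where "h = (+>\<^bsub>R\<^esub>) J"
  have R: "carrier R = polys {1..N}" "monoid.mult R = (*)" "monoid.one R = 1" "ring.zero R = 0" "ring.add R = (+)"
    by (simp_all add: R_def mpoly_ring_simps)
  interpret R: cring R unfolding R_def by (rule mpoly_ring_cring)
  interpret J: ideal J R unfolding R_def J_def by (rule spread_ideal(1))
  interpret h: localizing_hom R Q h unfolding Q_def h_def by (rule J.quotient_localizing_hom) (rule R.cring_axioms)
  have carrQ: "\<exists>a\<in>polys {1..N}. y = h a" if "y \<in> carrier Q" for y
  proof -
    have "\<exists>a\<in>carrier R. y = h a" using that unfolding Q_def FactRing_simps h_def by auto
    then show ?thesis by (simp add: R)
  qed
  have h_eq: "h a = h b \<longleftrightarrow> a - b \<in> J" if "a \<in> polys {1..N}" "b \<in> polys {1..N}" for a b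
    using R.quotient_eq_iff_same_a_r_cos[OF J.ideal_axioms, of a b] that
    unfolding R h_def by (simp add: R_def mpoly_ring_minus)
  have h_mult: "h a \<otimes>\<^bsub>Q\<^esub> h b = h (a * b)" if "a \<in> polys {1..N}" "b \<in> polys {1..N}" for a b
    using h.hom_mult[of a b] that by (simp add: R)
  have h_zero: "\<zero>\<^bsub>Q\<^esub> = h 0" using h.hom_zero by (simp add: R)
  have h_one: "\<one>\<^bsub>Q\<^esub> = h 1" using h.hom_one by (simp add: R)
  have h_closed: "h a \<in> carrier Q" if "a \<in> polys {1..N}" for a using h.hom_closed[of a] that by (simp add: R)
  have memJ: "a \<in> J \<longleftrightarrow> a \<in> polys {1..N} \<and> NF a = 0" for a
    unfolding J_def by (rule mem_spread_ideal_iff)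
  have ends: "{1, N} \<subseteq> {1..N}" using N by auto
  \<comment> \<open>Taking normal forms commutes with multiplication by f and g, so both conditions turn into statements
    about polynomials.\<close>
  have regular: "regular_sequence Q [h f, h g]"
    if f: "f \<in> polys {1}" "f \<noteq> 0" and g: "g \<in> polys {N}" "g \<noteq> 0"
      and I: "ideal I Q" "I \<noteq> carrier Q" "h f \<in> I" "h g \<in> I" for f g I
  proof (rule h.S.regular_sequence_pairI[OF _ _ _ _ I])
    have fe: "f \<in> polys {1, N}" and ge: "g \<in> polys {1, N}"
      using f g polys_mono[of "{1}" "{1, N}"] polys_mono[of "{N}" "{1, N}"] by blast+
    have fS: "f \<in> polys {1..N}" and gS: "g \<in> polys {1..N}" using fe ge polys_mono[OF ends] by blast+
    show "h f \<in> carrier Q" "h g \<in> carrier Q" using fS gS by (simp_all add: h_closed)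
    have NFf: "NF (f * a) = f * NF a" if "a \<in> polys {1..N}" for a
      by (rule NF_mult_ends[OF fe that]) (use N in simp)
    have NFg: "NF (g * a) = g * NF a" if "a \<in> polys {1..N}" for a
      by (rule NF_mult_ends[OF ge that]) (use N in simp)
    fix y assume "y \<in> carrier Q"
    then obtain a where a: "a \<in> polys {1..N}" "y = h a" using carrQ by blast
    { assume "h f \<otimes>\<^bsub>Q\<^esub> y = \<zero>\<^bsub>Q\<^esub>"
      then have "f * a \<in> J"
        unfolding a(2) h_mult[OF fS a(1)] h_zero using h_eq[of "f * a" 0] fS a(1) by (simp add: polys_closed)
      then have "NF a = 0" using NFf[OF a(1)] f(2) by (simp add: memJ)
      then have "a \<in> J" using a(1) by (simp add: memJ)
      then show "y = \<zero>\<^bsub>Q\<^esub>"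
        unfolding a(2) h_zero using h_eq[of a 0] a(1) by (simp add: polys_closed) }
    fix z assume "z \<in> carrier Q" and eq: "h g \<otimes>\<^bsub>Q\<^esub> y = z \<otimes>\<^bsub>Q\<^esub> h f"
    then obtain b where b: "b \<in> polys {1..N}" "z = h b" using carrQ by blast
    have "h (g * a) = h (f * b)"
      using eq unfolding a(2) b(2) h_mult[OF gS a(1)] h_mult[OF b(1) fS] by (simp add: mult.commute)
    then have "g * a - f * b \<in> J" using h_eq a b fS gS by (simp add: polys_closed)
    then have "g * NF a = f * NF b" using NFf[OF b(1)] NFg[OF a(1)] by (simp add: memJ NF_diff)
    then obtain q where q: "q \<in> polys {1..N}" "NF a = f * q"
      using univariate_coprime_cancel[OF f g _ _ _ NF_polys[OF a(1)], of "NF b"] N by auto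
    have "a - q * f \<in> J" using diff_NF_mem[OF a(1)] unfolding J_def q(2) by (simp add: mult.commute)
    then have "y = h q \<otimes>\<^bsub>Q\<^esub> h f"
      unfolding a(2) h_mult[OF q(1) fS] using h_eq[of a "q * f"] a(1) q(1) fS by (simp add: polys_closed)
    then show "\<exists>c\<in>carrier Q. y = c \<otimes>\<^bsub>Q\<^esub> h f" using h_closed[OF q(1)] by blast
  qed
  have noeth: "noetherian_ring Q" by (rule h.noetherian) (unfold R_def, rule mpoly_ring_noetherian)
  have dim_le: "krull_dim Q \<le> enat 2"
  proof (rule h.krull_dim_le)
    fix P assume P: "\<forall>i\<le>Suc 2. primeideal (P i) R \<and> a_kernel R Q h \<subseteq> P i" "\<forall>i<Suc 2. P i \<subset> P (Suc i)"
    have "J \<subseteq> a_kernel R Q h"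
    proof
      fix a assume a: "a \<in> J"
      then have aS: "a \<in> polys {1..N}" by (simp add: memJ)
      then have "h a = h 0" using a by (subst h_eq) (simp_all add: polys_zero)
      then show "a \<in> a_kernel R Q h" unfolding a_kernel_def' R(1) h_zero using aS by blast
    qed
    then have sub: "spread_ideal \<subseteq> P 0" using P(1) unfolding J_def by blast
    have prime: "primeideal (P i) (mpoly_ring N)" if "i \<le> 3" for i using P(1) that by (simp add: R_def)
    have strict: "P i \<subset> P (Suc i)" if "i < 3" for i using P(2) that by simp
    show False by (rule no_long_prime_chain[of P, OF prime sub strict])
  qed
  have "\<exists>xs. regular_sequence Q xs \<and> set xs \<subseteq> M \<and> length xs = 2" if M: "maximalideal M Q" for M
  proof -
    interpret M: maximalideal M Q by fact
    define M' where "M' = {a \<in> polys {1..N}. h a \<in> M}"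
    have "maximal_ideal_polys N M'"
    proof (rule maximal_ideal_polys.intro)
      show "ideal M' (mpoly_ring N)"
        using h.contraction_ideal[OF M.ideal_axioms] unfolding M'_def R_def mpoly_ring_simps(1) .
      show "1 \<notin> M'" using M.one_imp_carrier M.I_notcarr by (auto simp: M'_def h_one)
      fix u assume u: "u \<in> polys {1..N}" "u \<notin> M'"
      then have "h u \<notin> M" by (simp add: M'_def)
      then obtain y where y: "y \<in> carrier Q" "h u \<otimes>\<^bsub>Q\<^esub> y \<ominus>\<^bsub>Q\<^esub> \<one>\<^bsub>Q\<^esub> \<in> M"
        using h.S.maximalideal_inverse[OF M h_closed[OF u(1)]] by blast
      obtain w where w: "w \<in> polys {1..N}" "y = h w" using carrQ y(1) by blast
      have uw: "u * w \<in> polys {1..N}" "u * w - 1 \<in> polys {1..N}" using u w by (simp_all add: polys_closed)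
      have "h (u * w) = h (u * w - 1) \<oplus>\<^bsub>Q\<^esub> \<one>\<^bsub>Q\<^esub>"
        using h.hom_add[of "u * w - 1" 1] uw by (simp add: R polys_one h_one)
      then have "h u \<otimes>\<^bsub>Q\<^esub> y \<ominus>\<^bsub>Q\<^esub> \<one>\<^bsub>Q\<^esub> = h (u * w - 1)"
        unfolding w(2) h_mult[OF u(1) w(1)] using h_closed[OF uw(2)]
        by (simp add: a_minus_def h.S.a_assoc h.S.r_neg)
      then show "\<exists>w\<in>polys {1..N}. u * w - 1 \<in> M'" using y(2) uw w(1) by (auto simp: M'_def)
    qed
    then interpret M': maximal_ideal_polys N M' .
    obtain f where f: "f \<in> polys {1}" "f \<in> M'" "f \<noteq> 0" using M'.ex_univariate_member[of 1] N by auto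
    obtain g where g: "g \<in> polys {N}" "g \<in> M'" "g \<noteq> 0" using M'.ex_univariate_member[of N] N by auto
    have "h f \<in> M" "h g \<in> M" using f g by (auto simp: M'_def)
    moreover from this have "regular_sequence Q [h f, h g]"
      using M.I_notcarr by (intro regular[OF f(1,3) g(1,3) M.ideal_axioms]) auto
    ultimately show ?thesis by (intro exI[of _ "[h f, h g]"]) simp
  qed
  then have "cohen_macaulay Q" by (rule h.S.cohen_macaulayI[OF noeth dim_le])
  then show "cohen_macaulay (mpoly_ring N Quot (spread_ideal :: 'k::field mpoly set))"
    by (simp add: Q_def R_def J_def)
  \<comment> \<open>The polynomials without constant term show that the images of x_1 and x_N generate a proper ideal.\<close>
  define I where "I = {p :: 'k mpoly. p \<in> polys {1..N} \<and> lookup p 0 = 0}"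
  have I: "ideal I R"
    unfolding R_def by (rule mpoly_idealI) (auto simp: I_def polys_closed lookup_add lookup_mult_zero)
  have nz: "expo a + expo b \<noteq> 0" for a b :: nat
    by (metis add_is_0 mon_degree_add mon_degree_single mon_degree_zero zero_neq_one)
  have JI: "J \<subseteq> I"
    unfolding J_def spread_ideal_def
    by (rule R.genideal_minimal[OF I, unfolded R_def])
       (use spread_binomials_polys nz in \<open>auto simp: I_def spread_binomials_def spread_binomial_eq lookup_minus lookup_single when_def\<close>)
  have "ideal (h ` I) Q" unfolding h_def Q_def by (rule R.ring_ideal_imp_quot_ideal[OF J.ideal_axioms I])
  moreover have "h ` I \<noteq> carrier Q"
  proof
    assume "h ` I = carrier Q"
    then have "h 1 \<in> h ` I" using h_closed polys_one by blast
    then obtain a where a: "a \<in> I" "h 1 = h a" by blast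
    then have "1 - a \<in> I" using h_eq[of 1 a] JI by (auto simp: I_def polys_one)
    then show False using a(1) by (simp add: I_def lookup_minus)
  qed
  moreover have "h (mvar i) \<in> h ` I" if "i \<in> {1..N}" for i
  proof -
    have "lookup (mvar i) 0 = (0 :: 'k)"
      by (simp add: mvar_def monomial_def lookup_single when_def single_eq_0_iff)
    then show ?thesis using mvar_polys[OF that] unfolding I_def by blast
  qed
  moreover have "mvar i \<noteq> (0 :: 'k mpoly)" for i by (simp add: mvar_def monomial_def single_eq_0_iff)
  ultimately have "regular_sequence Q [h (mvar 1), h (mvar N)]"
    using N by (intro regular mvar_polys) auto
  from h.S.length_regular_sequence_le_krull_dim[OF this] have "enat 2 \<le> krull_dim Q"
    by (simp add: numeral_2_eq_2)
  with dim_le have "krull_dim Q = enat 2" by (rule antisym)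
  then have "krull_dim Q = 2" by (simp add: numeral_eq_enat)
  then show "krull_dim (mpoly_ring N Quot (spread_ideal :: 'k::field mpoly set)) = 2"
    by (simp add: Q_def R_def J_def)
qed

end

theorem corollary1p2:
  fixes m n :: nat and E\<^sub>1 E\<^sub>2 :: "nat set set"
  assumes "m \<ge> 2" and "n \<ge> 2"
    and "simple_graph m E\<^sub>1" and "connected_graph m E\<^sub>1"
    and "closed_graph m E\<^sub>1" and "interval_labeling m E\<^sub>1"
    and "simple_graph n E\<^sub>2" and "connected_graph n E\<^sub>2"
    and "closed_graph n E\<^sub>2" and "interval_labeling n E\<^sub>2"
  shows "has_quadratic_groebner_basis revlex_less (m + n - 1)
           (hankel_ideal m n E\<^sub>1 E\<^sub>2 :: 'k::field mpoly set) \<and>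
         cohen_macaulay
           (mpoly_ring (m + n - 1) Quot (hankel_ideal m n E\<^sub>1 E\<^sub>2 :: 'k::field mpoly set)) \<and>
         krull_dim
           (mpoly_ring (m + n - 1) Quot (hankel_ideal m n E\<^sub>1 E\<^sub>2 :: 'k::field mpoly set)) = 2"
proof -
  interpret hankel_graphs m n E\<^sub>1 E\<^sub>2 by unfold_locales (rule assms)+
  have "2 \<le> m + n - 1" using assms(1,2) by simp
  then show ?thesis
    unfolding hankel_ideal_eq_spread_ideal
    using spread_ideal_quadratic_groebner spread_quotient_cohen_macaulay by blast
qed

end
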